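(* Let $\rho>1$, $R>0$, $p>1$, $q>1$, $s>1/p$. Suppose the random filter $Y$ satisfies the following condition for some constant $\nu\ge 0$ (condition $C_{low}$): there is a constant $C>0$ such that for all $j\in\mathbb{N}$, $$E(L^Y_j)\le C\,2^{-2\nu j},\qquad L^Y_j=\frac{1}{2^{j}}\sum_{l=2^j}^{2^{j+1}-1}|Y_l|^2 .$$ Set $\epsilon=\frac{2s+2\nu+1}{\rho}-\frac{2\nu+1}{p}$ and let $R_n$ be the minimax $L^\rho$-risk over $M(s,p,q,R)$ defined in the context. Then there exists a constant $c_0>0$, independent of $n$, such that for all integers $n\ge 2$: (i) if $\epsilon>0$ (regular case), $$R_n\ \ge\ c_0\left(\frac1n\right)^{\frac{s}{2s+2\nu+1}};$$ (ii) if $\epsilon\le 0$ (sparse case $\epsilon<0$ and critical case $\epsilon=0$), $$R_n\ \ge\ c_0\left(\frac{\log n}{n}\right)^{\frac{s-1/p+1/\rho}{2s+2\nu+1-2/p}}.$$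
   Context: Model. Let $W$ be a standard Wiener process on a probability space, and let $Y$ be a real random process on $[0,1]$ with values in $L^2([0,1])$, independent of $W$, whose distribution depends neither on $n$ nor on $f$. For $n\in\mathbb{N}^*$ one observes $(X_n(t),Y(t))_{t\in[0,1]}$ with $$dX_n(t)=(f\star Y)(t)\,dt+\sigma n^{-1/2}\,dW(t),\quad t\in[0,1],\qquad X_n(0)=x_0,$$ where $f\star Y(t)=\int_0^1 f(t-s)Y(s)\,ds$, $f:\mathbb{R}\to\mathbb{R}$ is an unknown $1$-periodic function, $x_0$ is deterministic and $\sigma>0$ is a known constant. $E_f$ denotes expectation when the target is $f$. $Y_l=\int_0^1 Y(t)e^{-2\pi i l t}dt$, $l\in\mathbb{Z}$, are the Fourier coefficients of $Y$. Function classes. $L^\rho([0,1])$ is the space of $1$-periodic $f:\mathbb{R}\to\mathbb{R}$ with $\|f\|_\rho=(\int_0^1|f|^\rho)^{1/\rho}<\infty$. Let $\varphi,\psi$ be the Meyer scaling function and Meyer wavelet, $\varphi_{j,k}(x)=2^{j/2}\varphi(2^jx-k)$, $\psi_{j,k}(x)=2^{j/2}\psi(2^jx-k)$, with periodizations $\Phi_{j,k}(x)=\sum_{l\in\mathbb{Z}}\varphi_{j,k}(x+l)$, $\Psi_{j,k}(x)=\sum_{l\in\mathbb{Z}}\psi_{j,k}(x+l)$ for $j\ge0$. Put $R_j=\{0,\dots,2^j-1\}$ for $j\ge 0$, $R_{-1}=\{0\}$, and $\Psi_{-1,0}=\Phi_{0,0}$. For $f\in L^p([0,1])$ let $\beta_{j,k}=\int_0^1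 f\Psi_{j,k}$ ($j\ge-1$, $k\in R_j$) and $$\|f\|_{s,p,q}=\Big(\sum_{j\ge -1}2^{j(s+1/2-1/p)q}\Big(\sum_{k\in R_j}|\beta_{j,k}|^p\Big)^{q/p}\Big)^{1/q}.$$ The periodic Besov space $B^s_{p,q}([0,1])$ is $\{f\in L^p([0,1]):\|f\|_{s,p,q}<\infty\}$, and $M(s,p,q,R)=\{f\in B^s_{p,q}([0,1]):\|f\|_{s,p,q}\le R\}$. For $s>1/p$ its elements are continuous (identify $f$ with its continuous representative). Minimax risk. $R_n=\inf_{\hat f_n}\sup_{f\in M(s,p,q,R)}E_f(\|\hat f_n-f\|_\rho)$, where the infimum is over all estimators measurable with respect to $\sigma((X_n(t),Y(t))_{t\in[0,1]})$. *)

theory Defs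
  imports "HOL-Probability.Probability"
begin

section \<open>The Meyer wavelet and its periodization\<close>

text \<open>
  A Meyer wavelet is determined by a smooth transition function \<open>v\<close>.  No particular \<open>v\<close> is
  singled out: everything below is parametrized by an arbitrary admissible one.
\<close>

definition meyer_transition :: "(real \<Rightarrow> real) \<Rightarrow> bool" where
  "meyer_transition v \<longleftrightarrow>
     (\<forall>m x. ((deriv ^^ m) v) differentiable (at x)) \<and>
     (\<forall>x\<le>0. v x = 0) \<and> (\<forall>x\<ge>1. v x = 1) \<and> (\<forall>x. v x + v (1 - x) = 1)"

text \<open>
  The Fourier transforms are written in the frequency variable \<open>\<xi> = \<omega> / (2 * pi)\<close>, i.e. with kernel
  \<open>exp (- 2 * pi * \<i> * x * \<xi>)\<close>.  Both satisfy \<open>cnj (F \<xi>) = F (- \<xi>)\<close>, so their inverse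
  transforms are real, and the \<open>Re\<close> below only adjusts the type.
\<close>

definition meyer_scaling_hat :: "(real \<Rightarrow> real) \<Rightarrow> real \<Rightarrow> complex" where
  "meyer_scaling_hat v \<xi> = complex_of_real
     (if \<bar>\<xi>\<bar> \<le> 1/3 then 1
      else if \<bar>\<xi>\<bar> \<le> 2/3 then cos (pi / 2 * v (3 * \<bar>\<xi>\<bar> - 1))
      else 0)"

definition meyer_wavelet_hat :: "(real \<Rightarrow> real) \<Rightarrow> real \<Rightarrow> complex" where
  "meyer_wavelet_hat v \<xi> = cis (pi * \<xi>) * complex_of_real
     (if 1/3 \<le> \<bar>\<xi>\<bar> \<and> \<bar>\<xi>\<bar> \<le> 2/3 then sin (pi / 2 * v (3 * \<bar>\<xi>\<bar> - 1))
      else if 2/3 \<le> \<bar>\<xi>\<bar> \<and> \<bar>\<xi>\<bar> \<le> 4/3 then cos (pi / 2 * v (3 / 2 * \<bar>\<xi>\<bar> - 1))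
      else 0)"

definition inverse_fourier :: "(real \<Rightarrow> complex) \<Rightarrow> real \<Rightarrow> complex" where
  "inverse_fourier F x = (LINT \<xi>|lborel. F \<xi> * cis (2 * pi * \<xi> * x))"

definition meyer_scaling :: "(real \<Rightarrow> real) \<Rightarrow> real \<Rightarrow> real" where
  "meyer_scaling v x = Re (inverse_fourier (meyer_scaling_hat v) x)"

definition meyer_wavelet :: "(real \<Rightarrow> real) \<Rightarrow> real \<Rightarrow> real" where
  "meyer_wavelet v x = Re (inverse_fourier (meyer_wavelet_hat v) x)"

definition dilate_translate :: "(real \<Rightarrow> real) \<Rightarrow> int \<Rightarrow> int \<Rightarrow> real \<Rightarrow> real" where
  "dilate_translate g j k x = 2 powr (real_of_int j / 2) * g (2 powr real_of_int j * x - real_of_int k)"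

definition periodize :: "(real \<Rightarrow> real) \<Rightarrow> real \<Rightarrow> real" where
  "periodize g x = (\<Sum>\<^sub>\<infinity>l\<in>(UNIV :: int set). g (x + real_of_int l))"

text \<open>Scales \<open>j\<close> range over the integers \<open>\<ge> -1\<close>; scale \<open>-1\<close> carries the scaling function.\<close>

definition periodic_meyer :: "(real \<Rightarrow> real) \<Rightarrow> int \<Rightarrow> int \<Rightarrow> real \<Rightarrow> real" where
  "periodic_meyer v j k =
     (if j = -1 then periodize (dilate_translate (meyer_scaling v) 0 0)
      else periodize (dilate_translate (meyer_wavelet v) j k))"

definition shift_set :: "int \<Rightarrow> int set" where
  "shift_set j = (if j = -1 then {0} else {0..2 ^ nat j - 1})"


section \<open>Function classes\<close>

text \<open>Meant for exponents \<open>r > 0\<close> only.\<close>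

definition ennreal_powr :: "ennreal \<Rightarrow> real \<Rightarrow> ennreal" where
  "ennreal_powr a r = (if a = \<infinity> then \<infinity> else ennreal (enn2real a powr r))"

definition Lnorm :: "real \<Rightarrow> (real \<Rightarrow> real) \<Rightarrow> ennreal" where
  "Lnorm r g =
     ennreal_powr (\<integral>\<^sup>+x\<in>{0..1}. ennreal (\<bar>g x\<bar> powr r) \<partial>lborel) (1 / r)"

definition Lspace :: "real \<Rightarrow> (real \<Rightarrow> real) set" where
  "Lspace r = {f. (\<forall>x. f (x + 1) = f x) \<and> f \<in> borel_measurable borel \<and> Lnorm r f < \<infinity>}"

definition wavelet_coeff :: "(real \<Rightarrow> real) \<Rightarrow> (real \<Rightarrow> real) \<Rightarrow> int \<Rightarrow> int \<Rightarrow> real" where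
  "wavelet_coeff v f j k = (LINT x:{0..1}|lborel. f x * periodic_meyer v j k x)"

definition besov_norm ::
  "(real \<Rightarrow> real) \<Rightarrow> real \<Rightarrow> real \<Rightarrow> real \<Rightarrow> (real \<Rightarrow> real) \<Rightarrow> ennreal" where
  "besov_norm v s p q f =
     ennreal_powr
       (\<Sum>\<^sub>\<infinity>j\<in>{-1..}. ennreal (2 powr (real_of_int j * (s + 1/2 - 1/p) * q) *
          (\<Sum>k\<in>shift_set j. \<bar>wavelet_coeff v f j k\<bar> powr p) powr (q / p)))
       (1 / q)"

definition besov_space ::
  "(real \<Rightarrow> real) \<Rightarrow> real \<Rightarrow> real \<Rightarrow> real \<Rightarrow> (real \<Rightarrow> real) set" where
  "besov_space v s p q = {f \<in> Lspace p. besov_norm v s p q f < \<infinity>}"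

text \<open>
  For \<open>s > 1/p\<close> every element of the Besov space is a.e. equal to a continuous function; the ball
  consists of these continuous representatives.
\<close>

definition besov_ball ::
  "(real \<Rightarrow> real) \<Rightarrow> real \<Rightarrow> real \<Rightarrow> real \<Rightarrow> real \<Rightarrow> (real \<Rightarrow> real) set" where
  "besov_ball v s p q R =
     {f \<in> besov_space v s p q. continuous_on UNIV f \<and> besov_norm v s p q f \<le> ennreal R}"


section \<open>The observation model\<close>

text \<open>Processes are indexed by \<open>t \<in> {0..1}\<close>; their values at other times are irrelevant.\<close>

definition standard_wiener :: "'w measure \<Rightarrow> (real \<Rightarrow> 'w \<Rightarrow> real) \<Rightarrow> bool" where
  "standard_wiener M W \<longleftrightarrow>
     (\<forall>t\<in>{0..1}. W t \<in> borel_measurable M) \<and>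
     (AE \<omega> in M. W 0 \<omega> = 0) \<and>
     (\<forall>s t. 0 \<le> s \<and> s < t \<and> t \<le> 1 \<longrightarrow>
        distributed M lborel (\<lambda>\<omega>. W t \<omega> - W s \<omega>) (normal_density 0 (sqrt (t - s)))) \<and>
     (\<forall>(m::nat) \<tau>. (\<forall>i\<le>m. \<tau> i \<in> {0..1}) \<and> (\<forall>i<m. \<tau> i < \<tau> (Suc i)) \<longrightarrow>
        prob_space.indep_vars M (\<lambda>_. borel) (\<lambda>i \<omega>. W (\<tau> (Suc i)) \<omega> - W (\<tau> i) \<omega>) {..<m}) \<and>
     (AE \<omega> in M. continuous_on {0..1} (\<lambda>t. W t \<omega>))"

definition L2_process :: "'w measure \<Rightarrow> (real \<Rightarrow> 'w \<Rightarrow> real) \<Rightarrow> bool" where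
  "L2_process M Y \<longleftrightarrow>
     (\<lambda>(\<omega>, t). Y t \<omega>) \<in> borel_measurable (M \<Otimes>\<^sub>M restrict_space borel {0..1}) \<and>
     (AE \<omega> in M. set_integrable lborel {0..1} (\<lambda>t. (Y t \<omega>)\<^sup>2))"

definition sample_path :: "(real \<Rightarrow> 'w \<Rightarrow> real) \<Rightarrow> 'w \<Rightarrow> real \<Rightarrow> real" where
  "sample_path Z \<omega> = (\<lambda>t\<in>{0..1}. Z t \<omega>)"

definition indep_processes ::
  "'w measure \<Rightarrow> (real \<Rightarrow> 'w \<Rightarrow> real) \<Rightarrow> (real \<Rightarrow> 'w \<Rightarrow> real) \<Rightarrow> bool" where
  "indep_processes M Z Z' \<longleftrightarrow>
     prob_space.indep_var M (\<Pi>\<^sub>M t\<in>{0..1}. borel) (sample_path Z) (\<Pi>\<^sub>M t\<in>{0..1}. borel) (sample_path Z')"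

definition convolve :: "(real \<Rightarrow> real) \<Rightarrow> (real \<Rightarrow> real) \<Rightarrow> real \<Rightarrow> real" where
  "convolve f y t = (LINT s:{0..1}|lborel. f (t - s) * y s)"

text \<open>The integrated form of \<open>dX = (f \<star> Y) dt + \<sigma> n powr (-1/2) dW\<close>, \<open>X 0 = x0\<close>.\<close>

definition observed_process ::
  "(real \<Rightarrow> 'w \<Rightarrow> real) \<Rightarrow> (real \<Rightarrow> 'w \<Rightarrow> real) \<Rightarrow> real \<Rightarrow> real \<Rightarrow> nat \<Rightarrow> (real \<Rightarrow> real) \<Rightarrow>
     real \<Rightarrow> 'w \<Rightarrow> real" where
  "observed_process W Y \<sigma> x0 n f t \<omega> =
     x0 + (LINT u:{0..t}|lborel. convolve f (\<lambda>s. Y s \<omega>) u) + \<sigma> * real n powr (-1/2) * W t \<omega>"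

definition observation ::
  "(real \<Rightarrow> 'w \<Rightarrow> real) \<Rightarrow> (real \<Rightarrow> 'w \<Rightarrow> real) \<Rightarrow> real \<Rightarrow> real \<Rightarrow> nat \<Rightarrow> (real \<Rightarrow> real) \<Rightarrow>
     'w \<Rightarrow> real \<Rightarrow> real \<times> real" where
  "observation W Y \<sigma> x0 n f \<omega> = (\<lambda>t\<in>{0..1}. (observed_process W Y \<sigma> x0 n f t \<omega>, Y t \<omega>))"

definition observation_space :: "(real \<Rightarrow> real \<times> real) measure" where
  "observation_space = (\<Pi>\<^sub>M t\<in>{0..1}. borel)"


section \<open>Minimax risk\<close>

text \<open>
  An estimator measurable with respect to the \<open>\<sigma>\<close>-algebra generated by the observation is a
  measurable functional of the observed path, the same functional whatever the target is.  It takes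
  functions as values, which are required to be jointly measurable.
\<close>

definition estimators :: "((real \<Rightarrow> real \<times> real) \<Rightarrow> real \<Rightarrow> real) set" where
  "estimators = {T. (\<lambda>(z, x). T z x) \<in> borel_measurable (observation_space \<Otimes>\<^sub>M borel)}"

definition minimax_risk ::
  "'w measure \<Rightarrow> (real \<Rightarrow> 'w \<Rightarrow> real) \<Rightarrow> (real \<Rightarrow> 'w \<Rightarrow> real) \<Rightarrow> real \<Rightarrow> real \<Rightarrow>
     real \<Rightarrow> (real \<Rightarrow> real) set \<Rightarrow> nat \<Rightarrow> ennreal" where
  "minimax_risk M W Y \<sigma> x0 \<rho> F n =
     (INF T\<in>estimators. SUP f\<in>F.
        (\<integral>\<^sup>+\<omega>. Lnorm \<rho> (\<lambda>x. T (observation W Y \<sigma> x0 n f \<omega>) x - f x) \<partial>M))"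


section \<open>The condition on the random filter\<close>

definition fourier_coeff :: "(real \<Rightarrow> real) \<Rightarrow> int \<Rightarrow> complex" where
  "fourier_coeff y l = (LINT t:{0..1}|lborel. complex_of_real (y t) * cis (- 2 * pi * real_of_int l * t))"

definition dyadic_energy :: "(real \<Rightarrow> real) \<Rightarrow> nat \<Rightarrow> real" where
  "dyadic_energy y j = 1 / 2 ^ j * (\<Sum>l = 2 ^ j..2 ^ (j + 1) - 1. (cmod (fourier_coeff y l))\<^sup>2)"

definition C_low :: "'w measure \<Rightarrow> (real \<Rightarrow> 'w \<Rightarrow> real) \<Rightarrow> real \<Rightarrow> bool" where
  "C_low M Y \<nu> \<longleftrightarrow> (\<exists>C>0. \<forall>j::nat.
     (\<integral>\<^sup>+\<omega>. ennreal (dyadic_energy (\<lambda>t. Y t \<omega>) j) \<partial>M) \<le> ennreal (C * 2 powr (- 2 * \<nu> * real j)))"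

end

theory Submission
  imports Defs
begin

text \<open>
  Both bounds hold whatever the sign of \<open>\<epsilon>\<close>.  The hypotheses are trigonometric polynomials with frequencies in
  one dyadic block \<open>[N, 2N)\<close>, \<open>N = 2\<^sup>j\<close>: sums of translates, by multiples of \<open>1 / N\<close>, of a modulated Fejer kernel.
  As \<open>\<psi>\<close> is band-limited and \<open>O(1 / (1 + y\<^sup>2))\<close>, only the wavelet scales \<open>j, j + 1, j + 2\<close> see them, so their
  Besov norms are controlled by their sup and \<open>L\<^sup>1\<close> norms, without the orthonormality of the wavelet basis.

  Given \<open>Y\<close>, the observation is a Wiener process with a drift, and \<open>C\<^sub>l\<^sub>o\<^sub>w\<close> bounds, in expectation, the energy of
  the difference of the drifts of two hypotheses.  Girsanov's theorem is replaced by an inequality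
  \<open>P(obs\<^sub>f \<in> A, energy small) \<le> exp b / \<theta> + \<theta> P(obs\<^sub>g \<in> A)\<close> that is proved for cylinder sets \<open>A\<close>, where it only
  concerns Gaussian increments, and then passes to all measurable sets by approximation.

  The regular rate follows from Assouad's argument over all subsets of translates, with the loss localized on
  disjoint cells.  For the sparse rate each single translate is compared with \<open>f = 0\<close>: few of them can be close to
  a given estimate, while the likelihood cost is only a small power of \<open>N\<close>.
\<close>

section \<open>Shifted Gaussian vectors\<close>

text \<open>Condition \<open>C_low\<close> bounds an expected energy only, so for a given
  realization of \<open>Y\<close> the two drifts may be far apart. Laws are therefore compared on
  the event that the energy is small, and Markov's inequality pays for the complement; on that event
  the second moment of the likelihood ratio gives the term \<open>exp b / \<theta>\<close>. The free
  parameters \<open>b\<close> and \<open>\<theta>\<close> are constants in the regular case; in the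
  sparse case \<open>b\<close> grows like \<open>j\<close> and \<open>\<theta>\<close> is
  \<open>2 powr (j / 2)\<close>. Conditioning on \<open>Y\<close> meets an obstacle: independence
  concerns the product sigma-algebra of the path of \<open>Y\<close>, and there the drift, a time
  integral of \<open>Y\<close>, is not visibly measurable. Joint measurability of the process yields
  almost surely equal versions that are. Fejer kernels are chosen for their positivity: one of them
  has integral 1, and the \<open>2 ^ j\<close> translates add up to the constant
  \<open>2 ^ j\<close>, which controls sup norms uniformly over all subsets of translates. The
  frequencies stay in one dyadic block because \<open>C_low\<close> sums over exactly such
  blocks.\<close>

lemma gaussian_shift_density:
  fixes \<phi> :: "real \<Rightarrow> ennreal"
  assumes [measurable]: "\<phi> \<in> borel_measurable borel" and sd: "sd > 0"
  shows "(\<integral>\<^sup>+x. \<phi> (x + a) \<partial>density lborel (normal_density 0 sd)) =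
    (\<integral>\<^sup>+x. ennreal (exp ((a * x - a\<^sup>2 / 2) / sd\<^sup>2)) * \<phi> x \<partial>density lborel (normal_density 0 sd))"
proof -
  have "(\<integral>\<^sup>+x. \<phi> (x + a) \<partial>density lborel (normal_density 0 sd)) =
      (\<integral>\<^sup>+x. ennreal (normal_density 0 sd x) * \<phi> (x + a) \<partial>lborel)"
    by (subst nn_integral_density) auto
  also have "\<dots> = (\<integral>\<^sup>+x. ennreal (normal_density 0 sd (x - a)) * \<phi> x \<partial>lborel)"
    using nn_integral_real_affine[of "\<lambda>x. ennreal (normal_density 0 sd (x - a)) * \<phi> x" 1 a]
    by (simp add: add.commute)
  also have "\<dots> = (\<integral>\<^sup>+x. ennreal (normal_density 0 sd x) * (ennreal (exp ((a * x - a\<^sup>2 / 2) / sd\<^sup>2)) * \<phi> x) \<partial>lborel)"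
  proof (rule nn_integral_cong)
    fix x
    \<comment> \<open>The quotient of the two densities is the one-dimensional Cameron-Martin
      factor.\<close>
    have "normal_density 0 sd (x - a) = normal_density 0 sd x * exp ((a * x - a\<^sup>2 / 2) / sd\<^sup>2)"
      using sd by (simp add: normal_density_def mult_exp_exp[symmetric] power2_eq_square field_simps)
        (simp add: exp_add[symmetric] field_simps)
    then show "ennreal (normal_density 0 sd (x - a)) * \<phi> x =
      ennreal (normal_density 0 sd x) * (ennreal (exp ((a * x - a\<^sup>2 / 2) / sd\<^sup>2)) * \<phi> x)"
      by (simp add: ennreal_mult mult.assoc)
  qed
  also have "\<dots> = (\<integral>\<^sup>+x. ennreal (exp ((a * x - a\<^sup>2 / 2) / sd\<^sup>2)) * \<phi> x \<partial>density lborel (normal_density 0 sd))"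
    by (subst nn_integral_density) auto
  finally show ?thesis .
qed

text \<open>The square of the factor for the shift \<open>a\<close> is the factor for the shift
  \<open>2 * a\<close> times a constant, and every factor integrates to 1: apply
  \<open>gaussian_shift_density\<close> to the constant function 1.\<close>

lemma gaussian_shift_second_moment:
  assumes sd: "sd > 0"
  shows "(\<integral>\<^sup>+x. ennreal ((exp ((a * x - a\<^sup>2 / 2) / sd\<^sup>2))\<^sup>2) \<partial>density lborel (normal_density 0 sd)) =
    ennreal (exp (a\<^sup>2 / sd\<^sup>2))"
proof -
  interpret N: prob_space "density lborel (normal_density 0 sd)"
    using prob_space_normal_density[OF sd] .
  have "(\<integral>\<^sup>+x. ennreal ((exp ((a * x - a\<^sup>2 / 2) / sd\<^sup>2))\<^sup>2) \<partial>density lborel (normal_density 0 sd)) =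
     (\<integral>\<^sup>+x. ennreal (exp (((2*a) * x - (2*a)\<^sup>2 / 2) / sd\<^sup>2)) * ennreal (exp (a\<^sup>2 / sd\<^sup>2)) \<partial>density lborel (normal_density 0 sd))"
  proof (rule nn_integral_cong)
    fix x
    have "(exp ((a * x - a\<^sup>2 / 2) / sd\<^sup>2))\<^sup>2 = exp (((2*a) * x - (2*a)\<^sup>2 / 2) / sd\<^sup>2) * exp (a\<^sup>2 / sd\<^sup>2)"
      using sd by (simp add: power2_eq_square mult_exp_exp field_simps)
    then show "ennreal ((exp ((a * x - a\<^sup>2 / 2) / sd\<^sup>2))\<^sup>2) =
      ennreal (exp (((2*a) * x - (2*a)\<^sup>2 / 2) / sd\<^sup>2)) * ennreal (exp (a\<^sup>2 / sd\<^sup>2))"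
      by (simp add: ennreal_mult)
  qed
  also have "\<dots> = (\<integral>\<^sup>+x. ennreal (exp (a\<^sup>2 / sd\<^sup>2)) \<partial>density lborel (normal_density 0 sd))"
    by (subst gaussian_shift_density[OF _ sd, symmetric]) auto
  also have "\<dots> = ennreal (exp (a\<^sup>2 / sd\<^sup>2))"
    using N.emeasure_space_1 by simp
  finally show ?thesis .
qed

definition gaussian_product :: "nat set \<Rightarrow> (nat \<Rightarrow> real) \<Rightarrow> (nat \<Rightarrow> real) measure" where
  "gaussian_product I sd = (\<Pi>\<^sub>M i\<in>I. density lborel (normal_density 0 (sd i)))"

lemma sets_gaussian_product [measurable_cong]:
  "sets (gaussian_product I sd) = sets (\<Pi>\<^sub>M i\<in>I. borel)"
  unfolding gaussian_product_def by (intro sets_PiM_cong) auto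

text \<open>Fubini peels off one coordinate: the induction hypothesis treats the inner integral,
  where that coordinate is already shifted, and the one-dimensional formula treats the outer
  one.\<close>

lemma gaussian_product_shift_density:
  fixes \<phi> :: "(nat \<Rightarrow> real) \<Rightarrow> ennreal"
  assumes "finite I" "\<And>i. sd i > 0" "\<phi> \<in> borel_measurable (\<Pi>\<^sub>M i\<in>I. borel)"
  shows "(\<integral>\<^sup>+u. \<phi> (\<lambda>i\<in>I. u i + a i) \<partial>gaussian_product I sd) =
    (\<integral>\<^sup>+u. (\<Prod>i\<in>I. ennreal (exp ((a i * u i - (a i)\<^sup>2 / 2) / (sd i)\<^sup>2))) * \<phi> u \<partial>gaussian_product I sd)"
  using assms
proof (induction I arbitrary: \<phi>)
  case empty
  have "gaussian_product {} sd = count_space {\<lambda>k. undefined}"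
    by (simp add: gaussian_product_def PiM_empty)
  then show ?case
    by (simp add: nn_integral_count_space_finite)
next
  case (insert j I)
  let ?N = "\<lambda>i. density lborel (normal_density 0 (sd i))"
  interpret prob_space "?N i" for i
    using prob_space_normal_density insert.prems(1) by auto
  interpret product_sigma_finite ?N
    by unfold_locales
  note [measurable] = insert.prems(2)
  have m0: "\<phi> \<in> borel_measurable (Pi\<^sub>M (insert j I) ?N)"
    using insert.prems(2) sets_gaussian_product[of "insert j I" sd]
    by (simp add: gaussian_product_def cong: measurable_cong_sets)
  have m1: "(\<lambda>u. \<phi> (\<lambda>i\<in>insert j I. u i + a i)) \<in> borel_measurable (Pi\<^sub>M (insert j I) ?N)"
    by measurable
  have m2: "(\<lambda>u. (\<Prod>i\<in>insert j I. ennreal (exp ((a i * u i - (a i)\<^sup>2 / 2) / (sd i)\<^sup>2))) * \<phi> u)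
      \<in> borel_measurable (Pi\<^sub>M (insert j I) ?N)"
    using m0 by measurable
  let ?r = "\<lambda>i x. ennreal (exp ((a i * x - (a i)\<^sup>2 / 2) / (sd i)\<^sup>2))"
  have "(\<integral>\<^sup>+u. \<phi> (\<lambda>i\<in>insert j I. u i + a i) \<partial>gaussian_product (insert j I) sd) =
      (\<integral>\<^sup>+y. \<integral>\<^sup>+u. \<phi> (\<lambda>i\<in>insert j I. (u(j := y)) i + a i) \<partial>Pi\<^sub>M I ?N \<partial>?N j)"
    unfolding gaussian_product_def
    by (rule product_nn_integral_insert_rev[OF insert.hyps m1])
  also have "\<dots> = (\<integral>\<^sup>+y. \<integral>\<^sup>+u. (\<Prod>i\<in>I. ?r i (u i)) * \<phi> (u(j := y + a j)) \<partial>Pi\<^sub>M I ?N \<partial>?N j)"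
  proof (rule nn_integral_cong)
    fix y
    have "(\<lambda>i\<in>insert j I. (u(j := y)) i + a i) = (\<lambda>i\<in>I. u i + a i)(j := y + a j)" for u
      using insert.hyps by (auto simp: fun_eq_iff)
    then have "(\<integral>\<^sup>+u. \<phi> (\<lambda>i\<in>insert j I. (u(j := y)) i + a i) \<partial>Pi\<^sub>M I ?N) =
       (\<integral>\<^sup>+u. (\<lambda>w. \<phi> (w(j := y + a j))) (\<lambda>i\<in>I. u i + a i) \<partial>gaussian_product I sd)"
      by (simp add: gaussian_product_def)
    also have "\<dots> = (\<integral>\<^sup>+u. (\<Prod>i\<in>I. ?r i (u i)) * \<phi> (u(j := y + a j)) \<partial>gaussian_product I sd)"
    proof (rule insert.IH)
      have "(\<lambda>w. w(j := y + a j)) \<in> measurable (\<Pi>\<^sub>M i\<in>I. borel) (\<Pi>\<^sub>M i\<in>insert j I. borel)"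
        by (rule measurable_fun_upd[where J=I]) auto
      then show "(\<lambda>w. \<phi> (w(j := y + a j))) \<in> borel_measurable (\<Pi>\<^sub>M i\<in>I. borel)"
        by (rule measurable_compose) (rule insert.prems(2))
    qed (use insert.prems(1) in auto)
    finally show "(\<integral>\<^sup>+u. \<phi> (\<lambda>i\<in>insert j I. (u(j := y)) i + a i) \<partial>Pi\<^sub>M I ?N) =
       (\<integral>\<^sup>+u. (\<Prod>i\<in>I. ?r i (u i)) * \<phi> (u(j := y + a j)) \<partial>Pi\<^sub>M I ?N)"
      by (simp add: gaussian_product_def)
  qed
  also have "\<dots> = (\<integral>\<^sup>+y. ?r j y * (\<integral>\<^sup>+u. (\<Prod>i\<in>I. ?r i (u i)) * \<phi> (u(j := y)) \<partial>Pi\<^sub>M I ?N) \<partial>?N j)"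
  proof (rule gaussian_shift_density[of "\<lambda>y. \<integral>\<^sup>+u. (\<Prod>i\<in>I. ?r i (u i)) * \<phi> (u(j := y)) \<partial>Pi\<^sub>M I ?N"])
    interpret I: finite_product_sigma_finite ?N I by standard fact
    have "(\<lambda>p. (snd p)(j := fst p)) \<in> measurable (borel \<Otimes>\<^sub>M Pi\<^sub>M I ?N) (Pi\<^sub>M (insert j I) ?N)"
      by (rule measurable_fun_upd[where J=I]) auto
    from measurable_compose[OF this m0]
    have [measurable]: "(\<lambda>p. \<phi> ((snd p)(j := fst p))) \<in> borel_measurable (borel \<Otimes>\<^sub>M Pi\<^sub>M I ?N)" .
    have "(\<lambda>p. (\<Prod>i\<in>I. ?r i (snd p i)) * \<phi> ((snd p)(j := fst p))) \<in> borel_measurable (borel \<Otimes>\<^sub>M Pi\<^sub>M I ?N)"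
      by measurable
    then show "(\<lambda>y. \<integral>\<^sup>+u. (\<Prod>i\<in>I. ?r i (u i)) * \<phi> (u(j := y)) \<partial>Pi\<^sub>M I ?N) \<in> borel_measurable borel"
      by (intro I.borel_measurable_nn_integral) (simp add: case_prod_unfold)
  qed (use insert.prems(1) in auto)
  also have "\<dots> = (\<integral>\<^sup>+y. \<integral>\<^sup>+u. (\<Prod>i\<in>insert j I. ?r i ((u(j := y)) i)) * \<phi> (u(j := y)) \<partial>Pi\<^sub>M I ?N \<partial>?N j)"
  proof (rule nn_integral_cong)
    fix y
    have "(\<Prod>i\<in>insert j I. ?r i ((u(j := y)) i)) = ?r j y * (\<Prod>i\<in>I. ?r i (u i))" for u
      using insert.hyps by (auto intro!: arg_cong2[where f="(*)"] prod.cong)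
    then show "?r j y * (\<integral>\<^sup>+u. (\<Prod>i\<in>I. ?r i (u i)) * \<phi> (u(j := y)) \<partial>Pi\<^sub>M I ?N) =
      (\<integral>\<^sup>+u. (\<Prod>i\<in>insert j I. ?r i ((u(j := y)) i)) * \<phi> (u(j := y)) \<partial>Pi\<^sub>M I ?N)"
      using m0 by (simp only: mult.assoc) (subst nn_integral_cmult, measurable)
  qed
  also have "\<dots> = (\<integral>\<^sup>+u. (\<Prod>i\<in>insert j I. ?r i (u i)) * \<phi> u \<partial>gaussian_product (insert j I) sd)"
    unfolding gaussian_product_def
    by (rule product_nn_integral_insert_rev[OF insert.hyps m2, symmetric])
  finally show ?case .
qed

text \<open>The likelihood ratio \<open>r\<close> satisfies \<open>r \<le> r\<^sup>2 / \<theta> + \<theta>\<close>, and its second moment is explicit.\<close>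

lemma gaussian_product_shift_bound:
  assumes I: "finite I" and sd: "\<And>i. sd i > 0" and S [measurable]: "S \<in> sets (\<Pi>\<^sub>M i\<in>I. borel)"
    and "\<theta> > 0"
  shows "emeasure (gaussian_product I sd) {u \<in> space (\<Pi>\<^sub>M i\<in>I. borel). (\<lambda>i\<in>I. u i + a i) \<in> S} \<le>
    ennreal (exp (\<Sum>i\<in>I. (a i)\<^sup>2 / (sd i)\<^sup>2) / \<theta>) + ennreal \<theta> * emeasure (gaussian_product I sd) S"
proof -
  let ?N = "\<lambda>i. density lborel (normal_density 0 (sd i))"
  let ?G = "gaussian_product I sd"
  interpret prob_space "?N i" for i
    using prob_space_normal_density sd by auto
  interpret product_sigma_finite ?N
    by unfold_locales
  let ?r = "\<lambda>i x. exp ((a i * x - (a i)\<^sup>2 / 2) / (sd i)\<^sup>2)"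
  let ?R = "\<lambda>u. \<Prod>i\<in>I. ?r i (u i)"
  have R0: "?R u \<ge> 0" for u by (intro prod_nonneg) auto
  have sp: "space (\<Pi>\<^sub>M i\<in>I. borel) = space ?G"
    by (rule sets_eq_imp_space_eq[symmetric]) (rule sets_gaussian_product)
  have "emeasure ?G {u \<in> space (\<Pi>\<^sub>M i\<in>I. borel). (\<lambda>i\<in>I. u i + a i) \<in> S} =
     (\<integral>\<^sup>+u. indicator S (\<lambda>i\<in>I. u i + a i) \<partial>?G)"
  proof -
    have "{u \<in> space ?G. (\<lambda>i\<in>I. u i + a i) \<in> S} \<in> sets ?G" by measurable
    then have "emeasure ?G {u \<in> space ?G. (\<lambda>i\<in>I. u i + a i) \<in> S} =
        (\<integral>\<^sup>+u. indicator {u \<in> space ?G. (\<lambda>i\<in>I. u i + a i) \<in> S} u \<partial>?G)"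
      by (rule nn_integral_indicator[symmetric])
    also have "\<dots> = (\<integral>\<^sup>+u. indicator S (\<lambda>i\<in>I. u i + a i) \<partial>?G)"
      by (rule nn_integral_cong) (auto simp: indicator_def)
    finally show ?thesis unfolding sp .
  qed
  also have "\<dots> = (\<integral>\<^sup>+u. (\<Prod>i\<in>I. ennreal (?r i (u i))) * indicator S u \<partial>?G)"
    by (rule gaussian_product_shift_density[OF I sd]) auto
  also have "\<dots> \<le> (\<integral>\<^sup>+u. (\<Prod>i\<in>I. ennreal ((?r i (u i))\<^sup>2)) * ennreal (1 / \<theta>) + ennreal \<theta> * indicator S u \<partial>?G)"
  proof (rule nn_integral_mono)
    fix u
    have "?R u \<le> (?R u)\<^sup>2 * (1 / \<theta>) + \<theta>"
    proof (cases "?R u \<le> \<theta>")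
      case True
      then show ?thesis using \<open>\<theta> > 0\<close> by (smt (verit) divide_nonneg_pos mult_nonneg_nonneg zero_le_power2)
    next
      case False
      then have "?R u * \<theta> \<le> (?R u)\<^sup>2" using R0[of u] by (simp add: power2_eq_square mult_left_mono)
      then have "?R u \<le> (?R u)\<^sup>2 * (1 / \<theta>)" using \<open>\<theta> > 0\<close> by (simp add: field_simps)
      then show ?thesis using \<open>\<theta> > 0\<close> by simp
    qed
    then have "ennreal (?R u) \<le> ennreal ((?R u)\<^sup>2) * ennreal (1 / \<theta>) + ennreal \<theta>"
      using \<open>\<theta> > 0\<close> by (simp add: ennreal_mult'[symmetric] ennreal_plus[symmetric] del: ennreal_plus)
    then show "(\<Prod>i\<in>I. ennreal (?r i (u i))) * indicator S u \<le>
      (\<Prod>i\<in>I. ennreal ((?r i (u i))\<^sup>2)) * ennreal (1 / \<theta>) + ennreal \<theta> * indicator S u"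
      by (auto simp: prod_ennreal prod_power_distrib split: split_indicator)
  qed
  also have "\<dots> = (\<integral>\<^sup>+u. (\<Prod>i\<in>I. ennreal ((?r i (u i))\<^sup>2)) \<partial>?G) * ennreal (1 / \<theta>) + ennreal \<theta> * emeasure ?G S"
    by (simp add: nn_integral_add nn_integral_multc nn_integral_cmult)
  also have "(\<integral>\<^sup>+u. (\<Prod>i\<in>I. ennreal ((?r i (u i))\<^sup>2)) \<partial>?G) = (\<Prod>i\<in>I. ennreal (exp ((a i)\<^sup>2 / (sd i)\<^sup>2)))"
    unfolding gaussian_product_def
    by (subst product_nn_integral_prod[OF I]) (auto simp: gaussian_shift_second_moment[OF sd])
  also have "\<dots> = ennreal (exp (\<Sum>i\<in>I. (a i)\<^sup>2 / (sd i)\<^sup>2))"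
    using I by (simp add: prod_ennreal exp_sum)
  also have "ennreal (exp (\<Sum>i\<in>I. (a i)\<^sup>2 / (sd i)\<^sup>2)) * ennreal (1 / \<theta>) = ennreal (exp (\<Sum>i\<in>I. (a i)\<^sup>2 / (sd i)\<^sup>2) / \<theta>)"
    using \<open>\<theta> > 0\<close> by (simp add: ennreal_mult'[symmetric])
  finally show ?thesis .
qed

text \<open>Two measures are treated at once because a single cylinder set will have to serve under
  both drifts. A countable union is first cut to a finite one, as only finite unions stay in the
  algebra.\<close>

lemma algebra_approximation:
  assumes fin1: "finite_measure \<mu>" and fin2: "finite_measure \<nu>"
    and alg: "algebra \<Omega> \<A>" and s1: "sets \<mu> = sigma_sets \<Omega> \<A>" and s2: "sets \<nu> = sigma_sets \<Omega> \<A>"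
    and A: "A \<in> sigma_sets \<Omega> \<A>" and e: "e > 0"
  shows "\<exists>B\<in>\<A>. measure \<mu> ((A - B) \<union> (B - A)) + measure \<nu> ((A - B) \<union> (B - A)) < e"
  using A e
proof (induction arbitrary: e)
  case (Basic a)
  then show ?case by (intro bexI[of _ a]) auto
next
  case Empty
  interpret algebra \<Omega> \<A> by fact
  show ?case using Empty by (intro bexI[of _ "{}"]) auto
next
  case (Compl a)
  interpret algebra \<Omega> \<A> by fact
  obtain B where B: "B \<in> \<A>" "measure \<mu> ((a - B) \<union> (B - a)) + measure \<nu> ((a - B) \<union> (B - a)) < e"
    using Compl by blast
  have "a \<subseteq> \<Omega>" using Compl(1) sigma_sets_into_sp[OF space_closed] by auto
  moreover have "B \<subseteq> \<Omega>" using B space_closed by auto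
  ultimately have "((\<Omega> - a) - (\<Omega> - B)) \<union> ((\<Omega> - B) - (\<Omega> - a)) = (a - B) \<union> (B - a)" by auto
  then show ?case using B by (intro bexI[of _ "\<Omega> - B"]) auto
next
  case (Union a)
  interpret algebra \<Omega> \<A> by fact
  interpret m: finite_measure \<mu> by fact
  interpret n: finite_measure \<nu> by fact
  let ?d = "\<lambda>A B. measure \<mu> ((A - B) \<union> (B - A)) + measure \<nu> ((A - B) \<union> (B - A))"
  have as: "a i \<in> sets \<mu>" "a i \<in> sets \<nu>" for i using Union s1 s2 by auto
  let ?U = "\<lambda>n. \<Union>i<n. a i"
  let ?T = "\<Union>i. a i"
  have T: "?T \<in> sets \<mu>" "?T \<in> sets \<nu>" using as by auto
  have inc: "incseq ?U" by (auto simp: incseq_def intro: less_le_trans)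
  have eq: "(\<Union>n. ?U n) = ?T" by auto
  have "(\<lambda>n. measure \<mu> (?U n)) \<longlonglongrightarrow> measure \<mu> ?T"
    using m.finite_Lim_measure_incseq[OF _ inc] as eq by auto
  moreover have "(\<lambda>n. measure \<nu> (?U n)) \<longlonglongrightarrow> measure \<nu> ?T"
    using n.finite_Lim_measure_incseq[OF _ inc] as eq by auto
  ultimately have "(\<lambda>n. (measure \<mu> ?T - measure \<mu> (?U n)) + (measure \<nu> ?T - measure \<nu> (?U n))) \<longlonglongrightarrow>
      (measure \<mu> ?T - measure \<mu> ?T) + (measure \<nu> ?T - measure \<nu> ?T)"
    by (intro tendsto_intros)
  then have "eventually (\<lambda>n. (measure \<mu> ?T - measure \<mu> (?U n)) + (measure \<nu> ?T - measure \<nu> (?U n)) < e/2) sequentially"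
    using \<open>e > 0\<close> by (intro order_tendstoD(2)[where y=0]) auto
  then obtain n where n: "(measure \<mu> ?T - measure \<mu> (?U n)) + (measure \<nu> ?T - measure \<nu> (?U n)) < e/2"
    by (auto simp: eventually_sequentially)
  \<comment> \<open>Half of \<open>e\<close> pays for cutting the union at \<open>n\<close>, the
    other half is shared by the \<open>n\<close> sets kept; \<open>n + 1\<close> avoids a zero
    divisor when \<open>n = 0\<close>.\<close>
  have "\<exists>B\<in>\<A>. ?d (a i) B < e / (2 * (real n + 1))" for i
    by (rule Union.IH) (use Union.prems in auto)
  then obtain B where B: "\<And>i. B i \<in> \<A>" "\<And>i. ?d (a i) (B i) < e / (2 * (real n + 1))" by metis
  let ?B = "\<Union>i<n. B i"
  have Bs: "B i \<in> sets \<mu>" "B i \<in> sets \<nu>" for i using B(1) s1 s2 by auto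
  have BA: "?B \<in> \<A>" using B by auto
  have sub: "(?T - ?B) \<union> (?B - ?T) \<subseteq> (?T - ?U n) \<union> (\<Union>i<n. (a i - B i) \<union> (B i - a i))" by auto
  have b: "measure \<kappa> ((?T - ?B) \<union> (?B - ?T)) \<le>
      (measure \<kappa> ?T - measure \<kappa> (?U n)) + (\<Sum>i<n. measure \<kappa> ((a i - B i) \<union> (B i - a i)))"
    if "finite_measure \<kappa>" "\<And>i. a i \<in> sets \<kappa>" "\<And>i. B i \<in> sets \<kappa>" for \<kappa>
  proof -
    interpret k: finite_measure \<kappa> by fact
    note [measurable] = that(2,3)
    have "measure \<kappa> ((?T - ?B) \<union> (?B - ?T)) \<le> measure \<kappa> ((?T - ?U n) \<union> (\<Union>i<n. (a i - B i) \<union> (B i - a i)))"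
      by (rule k.finite_measure_mono[OF sub]) auto
    also have "\<dots> \<le> measure \<kappa> (?T - ?U n) + measure \<kappa> (\<Union>i<n. (a i - B i) \<union> (B i - a i))"
      by (rule measure_Un_le) auto
    also have "measure \<kappa> (?T - ?U n) = measure \<kappa> ?T - measure \<kappa> (?U n)"
      by (rule k.finite_measure_Diff) auto
    also have "measure \<kappa> (\<Union>i<n. (a i - B i) \<union> (B i - a i)) \<le> (\<Sum>i<n. measure \<kappa> ((a i - B i) \<union> (B i - a i)))"
      by (rule k.finite_measure_subadditive_finite) auto
    finally show ?thesis by simp
  qed
  have "?d ?T ?B \<le> ((measure \<mu> ?T - measure \<mu> (?U n)) + (measure \<nu> ?T - measure \<nu> (?U n))) + (\<Sum>i<n. ?d (a i) (B i))"
    using b[OF fin1 as(1) Bs(1)] b[OF fin2 as(2) Bs(2)] by (simp add: sum.distrib)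
  also have "(\<Sum>i<n. ?d (a i) (B i)) \<le> (\<Sum>i<n. e / (2 * (real n + 1)))"
    using B(2) by (intro sum_mono) (auto intro: less_imp_le)
  also have "\<dots> \<le> e / 2"
    using Union.prems by (simp add: field_simps)
  finally have "?d ?T ?B < e" using n by simp
  then show ?case using BA by blast
qed

section \<open>Shifted Wiener processes\<close>

lemma finite_partition:
  fixes J :: "real set"
  assumes J: "finite J" "J \<subseteq> {0..1}"
  obtains \<tau> :: "nat \<Rightarrow> real" and m idx where "m > 0" "\<tau> 0 = 0" "\<And>i. i \<le> m \<Longrightarrow> \<tau> i \<in> {0..1}"
    "\<And>i. i < m \<Longrightarrow> \<tau> i < \<tau> (Suc i)" "\<And>t. t \<in> J \<Longrightarrow> idx t \<le> m \<and> \<tau> (idx t) = t"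
proof -
  \<comment> \<open>The point 0 lets increments telescope from \<open>W 0\<close>; together with 1
    it guarantees at least one increment.\<close>
  define J' where "J' = {0,1} \<union> J"
  have fin: "finite J'" using J by (simp add: J'_def)
  define xs where "xs = sorted_list_of_set J'"
  have xs: "set xs = J'" "sorted_wrt (<) xs" "length xs = card J'"
    using fin by (auto simp: xs_def)
  have "card {0, 1 :: real} \<le> card J'" using fin by (intro card_mono) (auto simp: J'_def)
  then have len: "length xs \<ge> 2" using xs(3) by simp
  define m where "m = length xs - 1"
  have m: "m > 0" using len by (simp add: m_def)
  have i0: "xs ! i \<in> {0..1}" if "i \<le> m" for i
  proof -
    have "xs ! i \<in> set xs" using that len by (intro nth_mem) (simp add: m_def)
    then show ?thesis using J(2) by (auto simp: xs(1) J'_def)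
  qed
  have inc: "xs ! i < xs ! Suc i" if "i < m" for i
    using sorted_wrt_nth_less[OF xs(2), of i "Suc i"] that by (simp add: m_def)
  obtain k where k: "k < length xs" "xs ! k = 0"
    using xs(1) by (metis J'_def UnI1 insertI1 in_set_conv_nth)
  have z: "xs ! 0 = 0"
  proof (cases "k = 0")
    case False
    then have "xs ! 0 < xs ! k" using sorted_wrt_nth_less[OF xs(2), of 0 k] k by simp
    then show ?thesis using i0[of 0] k by simp
  qed (use k in simp)
  have "\<exists>i. i \<le> m \<and> xs ! i = t" if "t \<in> J" for t
  proof -
    have "t \<in> set xs" using that xs by (auto simp: J'_def)
    then obtain i where "i < length xs" "xs ! i = t" by (auto simp: in_set_conv_nth)
    then show ?thesis by (intro exI[of _ i]) (auto simp: m_def)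
  qed
  then obtain idx where "\<And>t. t \<in> J \<Longrightarrow> idx t \<le> m \<and> xs ! (idx t) = t" by metis
  then show thesis using that[of m "\<lambda>i. xs ! i" idx] m z i0 inc by blast
qed

text \<open>Independent increments are turned into a product law; the characterization of
  independence used for this asks for a nonempty index set, hence \<open>m > 0\<close>.\<close>

lemma wiener_increments_law:
  assumes P: "prob_space M" and W: "standard_wiener M W" and "m > 0"
    and \<tau>: "\<And>i. i \<le> m \<Longrightarrow> \<tau> i \<in> {0..1}" "\<And>i. i < m \<Longrightarrow> \<tau> i < \<tau> (Suc i)"
    and sd: "\<And>i. i < m \<Longrightarrow> sd i = sqrt (\<tau> (Suc i) - \<tau> i)"
  shows "distr M (\<Pi>\<^sub>M i\<in>{..<m}. borel) (\<lambda>\<omega>. \<lambda>i\<in>{..<m}. W (\<tau> (Suc i)) \<omega> - W (\<tau> i) \<omega>) =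
    gaussian_product {..<m} sd"
proof -
  interpret prob_space M by fact
  have iv: "indep_vars (\<lambda>_. borel) (\<lambda>i \<omega>. W (\<tau> (Suc i)) \<omega> - W (\<tau> i) \<omega>) {..<m}"
    using W \<tau> unfolding standard_wiener_def by blast
  have d: "distributed M lborel (\<lambda>\<omega>. W (\<tau> (Suc i)) \<omega> - W (\<tau> i) \<omega>) (normal_density 0 (sd i))" if "i < m" for i
    using W \<tau>(1)[of i] \<tau>(1)[of "Suc i"] \<tau>(2)[of i] that unfolding standard_wiener_def sd[OF that] by auto
  have rv: "(\<lambda>\<omega>. W (\<tau> (Suc i)) \<omega> - W (\<tau> i) \<omega>) \<in> borel_measurable M" if "i \<in> {..<m}" for i
    using d[of i] that unfolding distributed_def by auto
  have "distr M (\<Pi>\<^sub>M i\<in>{..<m}. borel) (\<lambda>\<omega>. \<lambda>i\<in>{..<m}. W (\<tau> (Suc i)) \<omega> - W (\<tau> i) \<omega>) =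
      (\<Pi>\<^sub>M i\<in>{..<m}. distr M borel (\<lambda>\<omega>. W (\<tau> (Suc i)) \<omega> - W (\<tau> i) \<omega>))"
    using iv \<open>m > 0\<close> by (subst (asm) indep_vars_iff_distr_eq_PiM') (use rv in auto)
  also have "\<dots> = gaussian_product {..<m} sd"
    unfolding gaussian_product_def
  proof (rule PiM_cong)
    fix i assume "i \<in> {..<m}"
    then have "distr M lborel (\<lambda>\<omega>. W (\<tau> (Suc i)) \<omega> - W (\<tau> i) \<omega>) = density lborel (normal_density 0 (sd i))"
      using d[of i] unfolding distributed_def by auto
    moreover have "distr M borel (\<lambda>\<omega>. W (\<tau> (Suc i)) \<omega> - W (\<tau> i) \<omega>) = distr M lborel (\<lambda>\<omega>. W (\<tau> (Suc i)) \<omega> - W (\<tau> i) \<omega>)"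
      by (rule distr_cong) auto
    ultimately show "distr M borel (\<lambda>\<omega>. W (\<tau> (Suc i)) \<omega> - W (\<tau> i) \<omega>) = density lborel (normal_density 0 (sd i))"
      by simp
  qed simp
  finally show ?thesis .
qed

text \<open>\<open>G\<close> stands for the information in the filter: given \<open>G\<close> the
  drifts \<open>H\<close> and \<open>K\<close> are deterministic, while \<open>W\<close> keeps its
  law by \<open>ind\<close>. The bound \<open>energy\<close> is a discrete Cameron-Martin norm of
  \<open>H - K\<close>, asked along finite partitions because a cylinder set sees finitely many
  times only. \<open>E\<close> is the event on which it holds; the law with drift \<open>H\<close>
  is compared only there.\<close>

locale shifted_wiener = prob_space M
  for M :: "'w measure" +
  fixes W :: "real \<Rightarrow> 'w \<Rightarrow> real" and G :: "'w measure" and Y H K :: "real \<Rightarrow> 'w \<Rightarrow> real"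
    and x0 \<kappa> B \<theta> :: real and E :: "'w set"
  assumes W: "standard_wiener M W"
    and sub: "subalgebra M G"
    and mW: "sample_path W \<in> measurable M (\<Pi>\<^sub>M t\<in>{0..1}. borel)"
    and ind: "\<And>S D. S \<in> sets (\<Pi>\<^sub>M t\<in>{0..1}. borel) \<Longrightarrow> D \<in> sets G \<Longrightarrow>
      prob (sample_path W -` S \<inter> D) = prob (sample_path W -` S \<inter> space M) * prob D"
    and Y: "\<And>t. t \<in> {0..1} \<Longrightarrow> Y t \<in> borel_measurable G"
    and H: "\<And>t. t \<in> {0..1} \<Longrightarrow> H t \<in> borel_measurable G"
    and K: "\<And>t. t \<in> {0..1} \<Longrightarrow> K t \<in> borel_measurable G"
    and H0: "\<And>\<omega>. H 0 \<omega> = 0" and K0: "\<And>\<omega>. K 0 \<omega> = 0"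
    and E: "E \<in> sets G"
    and energy: "\<And>\<omega> \<tau> m. \<omega> \<in> E \<Longrightarrow> (\<And>i. i \<le> m \<Longrightarrow> \<tau> i \<in> {0..1}) \<Longrightarrow> (\<And>i. i < m \<Longrightarrow> \<tau> i < \<tau> (Suc i)) \<Longrightarrow>
      (\<Sum>i<m. ((H (\<tau> (Suc i)) \<omega> - K (\<tau> (Suc i)) \<omega>) - (H (\<tau> i) \<omega> - K (\<tau> i) \<omega>))\<^sup>2 / (\<tau> (Suc i) - \<tau> i)) \<le> \<kappa>\<^sup>2 * B"
    and \<kappa>: "\<kappa> > 0" and \<theta>: "\<theta> > 0"
begin

definition shifted_path :: "(real \<Rightarrow> 'w \<Rightarrow> real) \<Rightarrow> 'w \<Rightarrow> real \<Rightarrow> real \<times> real" where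
  "shifted_path h \<omega> = (\<lambda>t\<in>{0..1}. (x0 + h t \<omega> + \<kappa> * W t \<omega>, Y t \<omega>))"

lemma measurable_shifted_path:
  assumes "\<And>t. t \<in> {0..1} \<Longrightarrow> h t \<in> borel_measurable G"
  shows "shifted_path h \<in> measurable M observation_space"
proof -
  have "h t \<in> borel_measurable M" "Y t \<in> borel_measurable M" "W t \<in> borel_measurable M"
    if "t \<in> {0..1}" for t
    using that measurable_from_subalg[OF sub] assms Y W unfolding standard_wiener_def by auto
  then show ?thesis
    unfolding shifted_path_def observation_space_def
    by (intro measurable_restrict) auto
qed

text \<open>The joint law of the increments and of the outcome seen through \<open>G\<close> is a
  product, so Fubini freezes the outcome. On a slice the two paths differ by a deterministic shift
  of a Gaussian vector and \<open>gaussian_product_shift_bound\<close> applies; slices outside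
  \<open>E\<close> contribute nothing on the left.\<close>

lemma emeasure_cylinder_le:
  assumes J: "finite J" "J \<subseteq> {0..1}" and X: "X \<in> sets (\<Pi>\<^sub>M t\<in>J. borel)"
  shows "emeasure M {\<omega>\<in>E. restrict (shifted_path H \<omega>) J \<in> X} \<le>
    ennreal (exp B / \<theta>) + ennreal \<theta> * emeasure M {\<omega>\<in>space M. restrict (shifted_path K \<omega>) J \<in> X}"
proof -
  obtain \<tau> :: "nat \<Rightarrow> real" and m idx where \<tau>: "m > 0" "\<tau> 0 = 0" "\<And>i. i \<le> m \<Longrightarrow> \<tau> i \<in> {0..1}"
    "\<And>i. i < m \<Longrightarrow> \<tau> i < \<tau> (Suc i)" and idx: "\<And>t. t \<in> J \<Longrightarrow> idx t \<le> m \<and> \<tau> (idx t) = t"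
    using finite_partition[OF J] by metis
  define sd where "sd i = (if i < m then sqrt (\<tau> (Suc i) - \<tau> i) else 1)" for i
  have sd: "sd i > 0" for i using \<tau>(4)[of i] by (auto simp: sd_def)
  let ?B = "\<Pi>\<^sub>M i\<in>{..<m}. borel :: real measure"
  define V where "V \<omega> = (\<lambda>i\<in>{..<m}. W (\<tau> (Suc i)) \<omega> - W (\<tau> i) \<omega>)" for \<omega>
  define N where "N = gaussian_product {..<m} sd"
  have setsN [measurable_cong]: "sets N = sets ?B" unfolding N_def by (rule sets_gaussian_product)
  interpret pN: prob_space N
    unfolding N_def gaussian_product_def using sd by (intro prob_space_PiM prob_space_normal_density) auto
  have mV: "V \<in> measurable M ?B"
  proof -
    have "W t \<in> borel_measurable M" if "t \<in> {0..1}" for t using W that unfolding standard_wiener_def by auto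
    then show ?thesis unfolding V_def using \<tau>(3) by (intro measurable_restrict borel_measurable_diff) auto
  qed
  have lawV: "distr M ?B V = N"
    unfolding V_def N_def
    using \<tau> by (intro wiener_increments_law[OF prob_space_axioms W]) (auto simp: sd_def)
  define g where "g w = (\<lambda>i\<in>{..<m}. w (\<tau> (Suc i)) - w (\<tau> i) :: real)" for w
  have mg: "g \<in> measurable (\<Pi>\<^sub>M t\<in>{0..1}. borel) ?B"
    unfolding g_def using \<tau>(3) by (intro measurable_restrict borel_measurable_diff measurable_component_singleton) auto
  have gV: "g \<circ> sample_path W = V"
  proof
    fix \<omega>
    have "sample_path W \<omega> (\<tau> i) = W (\<tau> i) \<omega>" if "i \<le> m" for i
      using \<tau>(3)[OF that] by (simp add: sample_path_def)
    then show "(g \<circ> sample_path W) \<omega> = V \<omega>"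
      by (auto simp: g_def V_def fun_eq_iff)
  qed
  \<comment> \<open>\<open>M\<close> restricted to \<open>G\<close>. The product formula
    \<open>joint\<close> below expresses the independence of the increments from
    \<open>G\<close>.\<close>
  define G' where "G' = distr M G (\<lambda>\<omega>. \<omega>)"
  have setsG' [measurable_cong]: "sets G' = sets G" by (simp add: G'_def)
  have spG: "space G = space M" using sub by (simp add: subalgebra_def)
  have spG': "space G' = space M" by (simp add: G'_def spG)
  have idG: "(\<lambda>\<omega>. \<omega>) \<in> measurable M G" by (rule measurable_from_subalg[OF sub]) simp
  interpret pG: prob_space G'
    unfolding G'_def by (rule prob_space_distr) (rule idG)
  interpret pair_sigma_finite N G' ..
  have joint: "N \<Otimes>\<^sub>M G' = distr M (?B \<Otimes>\<^sub>M G) (\<lambda>\<omega>. (V \<omega>, \<omega>))"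
  proof (rule pair_measure_eqI)
    show "sets (N \<Otimes>\<^sub>M G') = sets (distr M (?B \<Otimes>\<^sub>M G) (\<lambda>\<omega>. (V \<omega>, \<omega>)))"
      by (simp add: setsN setsG' cong: sets_pair_measure_cong)
  next
    fix S D assume S: "S \<in> sets N" and D: "D \<in> sets G'"
    have S': "S \<in> sets ?B" and D': "D \<in> sets G" using S D setsN setsG' by auto
    have Dsub: "D \<subseteq> space M" using D' sets.sets_into_space spG by blast
    have gS: "g -` S \<inter> space (\<Pi>\<^sub>M t\<in>{0..1}. borel) \<in> sets (\<Pi>\<^sub>M t\<in>{0..1}. borel)"
      using mg S' by (rule measurable_sets)
    have v1: "sample_path W -` (g -` S \<inter> space (\<Pi>\<^sub>M t\<in>{0..1}. borel)) \<inter> Z = V -` S \<inter> Z" if "Z \<subseteq> space M" for Z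
    proof -
      have "g (sample_path W \<omega>) = V \<omega>" for \<omega> using gV by (simp add: fun_eq_iff)
      then show ?thesis using that measurable_space[OF mW] by auto
    qed
    have "emeasure N S * emeasure G' D = emeasure M (V -` S \<inter> space M) * emeasure M D"
      using emeasure_distr[OF mV S'] emeasure_distr[OF idG D'] Dsub
      by (simp add: lawV G'_def Int_absorb2)
    also have "\<dots> = ennreal (prob (V -` S \<inter> space M) * prob D)"
      by (simp add: emeasure_eq_measure ennreal_mult)
    also have "prob (V -` S \<inter> space M) * prob D = prob (V -` S \<inter> D)"
      using ind[OF gS D'] v1[of "space M"] v1[OF Dsub] by simp
    also have "ennreal \<dots> = emeasure (distr M (?B \<Otimes>\<^sub>M G) (\<lambda>\<omega>. (V \<omega>, \<omega>))) (S \<times> D)"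
      using S' D' Dsub mV idG
      by (subst emeasure_distr) (auto simp: emeasure_eq_measure intro!: arg_cong[where f=prob])
    finally show "emeasure N S * emeasure G' D = emeasure (distr M (?B \<Otimes>\<^sub>M G) (\<lambda>\<omega>. (V \<omega>, \<omega>))) (S \<times> D)" .
  qed unfold_locales
  \<comment> \<open>The observed values at the times in \<open>J\<close>, rebuilt from the noise
    increments and the filter. Since \<open>W 0 = 0\<close> holds only almost surely, so does the
    agreement with \<open>shifted_path\<close>.\<close>
  define F where "F h p = (\<lambda>t\<in>J. (x0 + h t (snd p) + \<kappa> * (\<Sum>i<idx t. fst p i), Y t (snd p)))"
    for h and p :: "(nat \<Rightarrow> real) \<times> 'w"
  have mF: "F h \<in> measurable (?B \<Otimes>\<^sub>M G) (\<Pi>\<^sub>M t\<in>J. borel)" if h: "\<And>t. t \<in> {0..1} \<Longrightarrow> h t \<in> borel_measurable G" for h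
    unfolding F_def
  proof (rule measurable_restrict)
    fix t assume t: "t \<in> J"
    then have [measurable]: "h t \<in> borel_measurable G" "Y t \<in> borel_measurable G" using h Y J by auto
    have [measurable]: "(\<lambda>p. fst p i) \<in> borel_measurable (?B \<Otimes>\<^sub>M G)" if "i < idx t" for i
      using that idx[OF t] by (intro measurable_compose[OF measurable_fst] measurable_component_singleton) auto
    show "(\<lambda>p. (x0 + h t (snd p) + \<kappa> * (\<Sum>i<idx t. fst p i), Y t (snd p))) \<in> measurable (?B \<Otimes>\<^sub>M G) borel"
      by (intro borel_measurable_Pair borel_measurable_add borel_measurable_times borel_measurable_sum) auto
  qed
  define SH where "SH = {p \<in> space (?B \<Otimes>\<^sub>M G). F H p \<in> X \<and> snd p \<in> E}"
  define SK where "SK = {p \<in> space (?B \<Otimes>\<^sub>M G). F K p \<in> X}"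
  have mSH: "SH \<in> sets (?B \<Otimes>\<^sub>M G)" unfolding SH_def
    using mF[OF H] X E by measurable
  have mSK: "SK \<in> sets (?B \<Otimes>\<^sub>M G)" unfolding SK_def
    using mF[OF K] X by measurable
  have W0: "AE \<omega> in M. W 0 \<omega> = 0" using W unfolding standard_wiener_def by auto
  have FV: "AE \<omega> in M. F h (V \<omega>, \<omega>) = restrict (shifted_path h \<omega>) J" for h
    using W0
  proof eventually_elim
    case (elim \<omega>)
    have "(\<Sum>i<idx t. V \<omega> i) = W t \<omega>" if "t \<in> J" for t
    proof -
      have "(\<Sum>i<idx t. V \<omega> i) = (\<Sum>i<idx t. W (\<tau> (Suc i)) \<omega> - W (\<tau> i) \<omega>)"
        using idx[OF that] by (intro sum.cong) (auto simp: V_def)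
      also have "\<dots> = W t \<omega>" using idx[OF that] elim \<tau>(2) by (simp add: sum_lessThan_telescope[of "\<lambda>i. W (\<tau> i) \<omega>"])
      finally show ?thesis .
    qed
    then show ?case using J by (auto simp: F_def shifted_path_def fun_eq_iff)
  qed
  have setsNG: "sets (N \<Otimes>\<^sub>M G') = sets (?B \<Otimes>\<^sub>M G)"
    by (intro sets_pair_measure_cong setsN setsG')
  have mVid: "(\<lambda>\<omega>. (V \<omega>, \<omega>)) \<in> measurable M (?B \<Otimes>\<^sub>M G)"
    using mV idG by (rule measurable_Pair)
  have mR: "(\<lambda>\<omega>. restrict (shifted_path h \<omega>) J) \<in> measurable M (\<Pi>\<^sub>M t\<in>J. borel)"
    if "\<And>t. t \<in> {0..1} \<Longrightarrow> h t \<in> borel_measurable G" for h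
    using measurable_compose[OF measurable_shifted_path[OF that, unfolded observation_space_def] measurable_restrict_subset[OF J(2)]]
    by simp
  have EM: "E \<in> sets M" using E sub by (auto simp: subalgebra_def)
  have EsM: "E \<subseteq> space M" using EM sets.sets_into_space by auto
  have lhs: "emeasure M {\<omega>\<in>E. restrict (shifted_path H \<omega>) J \<in> X} = emeasure (N \<Otimes>\<^sub>M G') SH"
  proof -
    have "emeasure (N \<Otimes>\<^sub>M G') SH = emeasure M ((\<lambda>\<omega>. (V \<omega>, \<omega>)) -` SH \<inter> space M)"
      unfolding joint by (rule emeasure_distr[OF mVid mSH])
    also have "\<dots> = emeasure M {\<omega>\<in>E. restrict (shifted_path H \<omega>) J \<in> X}"
    proof (rule emeasure_eq_AE)
      show "AE \<omega> in M. (\<omega> \<in> (\<lambda>\<omega>. (V \<omega>, \<omega>)) -` SH \<inter> space M) = (\<omega> \<in> {\<omega>\<in>E. restrict (shifted_path H \<omega>) J \<in> X})"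
        using FV[of H] AE_space
        by eventually_elim (use EsM measurable_space[OF mVid] in \<open>auto simp: SH_def\<close>)
      show "(\<lambda>\<omega>. (V \<omega>, \<omega>)) -` SH \<inter> space M \<in> sets M" using mVid mSH by (rule measurable_sets)
      have "{\<omega>\<in>E. restrict (shifted_path H \<omega>) J \<in> X} = E \<inter> ((\<lambda>\<omega>. restrict (shifted_path H \<omega>) J) -` X \<inter> space M)"
        using EsM by auto
      then show "{\<omega>\<in>E. restrict (shifted_path H \<omega>) J \<in> X} \<in> sets M"
        using EM measurable_sets[OF mR[OF H] X] by auto
    qed
    finally show ?thesis by simp
  qed
  have rhs: "emeasure M {\<omega>\<in>space M. restrict (shifted_path K \<omega>) J \<in> X} = emeasure (N \<Otimes>\<^sub>M G') SK"
  proof -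
    have "emeasure (N \<Otimes>\<^sub>M G') SK = emeasure M ((\<lambda>\<omega>. (V \<omega>, \<omega>)) -` SK \<inter> space M)"
      unfolding joint by (rule emeasure_distr[OF mVid mSK])
    also have "\<dots> = emeasure M {\<omega>\<in>space M. restrict (shifted_path K \<omega>) J \<in> X}"
    proof (rule emeasure_eq_AE)
      show "AE \<omega> in M. (\<omega> \<in> (\<lambda>\<omega>. (V \<omega>, \<omega>)) -` SK \<inter> space M) = (\<omega> \<in> {\<omega>\<in>space M. restrict (shifted_path K \<omega>) J \<in> X})"
        using FV[of K] AE_space
        by eventually_elim (use measurable_space[OF mVid] in \<open>auto simp: SK_def\<close>)
      show "(\<lambda>\<omega>. (V \<omega>, \<omega>)) -` SK \<inter> space M \<in> sets M" using mVid mSK by (rule measurable_sets)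
      have "{\<omega>\<in>space M. restrict (shifted_path K \<omega>) J \<in> X} = ((\<lambda>\<omega>. restrict (shifted_path K \<omega>) J) -` X \<inter> space M)"
        by auto
      then show "{\<omega>\<in>space M. restrict (shifted_path K \<omega>) J \<in> X} \<in> sets M"
        using measurable_sets[OF mR[OF K] X] by auto
    qed
    finally show ?thesis by simp
  qed
  have slice: "emeasure N ((\<lambda>u. (u, \<omega>)) -` SH) \<le>
      ennreal (exp B / \<theta>) + ennreal \<theta> * emeasure N ((\<lambda>u. (u, \<omega>)) -` SK)" if \<omega>: "\<omega> \<in> space M" for \<omega>
  proof (cases "\<omega> \<in> E")
    case False
    then have "(\<lambda>u. (u, \<omega>)) -` SH = {}" by (auto simp: SH_def)
    then show ?thesis by simp
  next
    case True
    define D where "D t = H t \<omega> - K t \<omega>" for t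
    define a where "a i = (D (\<tau> (Suc i)) - D (\<tau> i)) / \<kappa>" for i
    define S' where "S' = (\<lambda>u. (u, \<omega>)) -` SK"
    have S': "S' \<in> sets ?B" unfolding S'_def by (rule sets_Pair2[OF mSK])
    \<comment> \<open>Raising each noise increment by the increment of \<open>H - K\<close> divided
      by \<kappa> turns the drift \<open>K\<close> into \<open>H\<close>; by \<open>H0\<close> and
      \<open>K0\<close> the telescoping sums start at 0.\<close>
    have shift: "F H (u, \<omega>) = F K (\<lambda>i\<in>{..<m}. u i + a i, \<omega>)" for u
    proof -
      have "(\<Sum>i<idx t. (\<lambda>i\<in>{..<m}. u i + a i) i) = (\<Sum>i<idx t. u i) + D t / \<kappa>" if "t \<in> J" for t
      proof -
        have "(\<Sum>i<idx t. (\<lambda>i\<in>{..<m}. u i + a i) i) = (\<Sum>i<idx t. u i + a i)"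
          using idx[OF that] by (intro sum.cong) auto
        also have "\<dots> = (\<Sum>i<idx t. u i) + (\<Sum>i<idx t. D (\<tau> (Suc i)) - D (\<tau> i)) / \<kappa>"
          by (simp add: sum.distrib a_def sum_divide_distrib)
        also have "(\<Sum>i<idx t. D (\<tau> (Suc i)) - D (\<tau> i)) = D t"
          using idx[OF that] \<tau>(2) by (simp add: sum_lessThan_telescope[of "\<lambda>i. D (\<tau> i)"]) (simp add: D_def H0 K0)
        finally show ?thesis .
      qed
      then show ?thesis using \<kappa> by (auto simp: F_def fun_eq_iff D_def field_simps)
    qed
    have "(\<lambda>u. (u, \<omega>)) -` SH = {u \<in> space ?B. (\<lambda>i\<in>{..<m}. u i + a i) \<in> S'}"
      using True \<omega> by (auto simp: SH_def SK_def S'_def space_pair_measure spG shift space_PiM PiE_iff)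
    then have "emeasure N ((\<lambda>u. (u, \<omega>)) -` SH) \<le>
      ennreal (exp (\<Sum>i\<in>{..<m}. (a i)\<^sup>2 / (sd i)\<^sup>2) / \<theta>) + ennreal \<theta> * emeasure N S'"
      unfolding N_def using gaussian_product_shift_bound[OF _ sd S' \<theta>, where a=a] by simp
    also have "(\<Sum>i\<in>{..<m}. (a i)\<^sup>2 / (sd i)\<^sup>2) \<le> B"
    proof -
      have "(\<Sum>i\<in>{..<m}. (a i)\<^sup>2 / (sd i)\<^sup>2) = (\<Sum>i<m. ((D (\<tau> (Suc i)) - D (\<tau> i))\<^sup>2 / (\<tau> (Suc i) - \<tau> i)) / \<kappa>\<^sup>2)"
        using \<tau>(4) by (intro sum.cong) (auto simp: a_def sd_def power_divide less_imp_le)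
      also have "\<dots> = (\<Sum>i<m. (D (\<tau> (Suc i)) - D (\<tau> i))\<^sup>2 / (\<tau> (Suc i) - \<tau> i)) / \<kappa>\<^sup>2"
        by (simp add: sum_divide_distrib)
      also have "\<dots> \<le> B"
        using energy[of \<omega> m \<tau>, OF True \<tau>(3) \<tau>(4)] \<kappa> unfolding D_def by (simp add: field_simps)
      finally show ?thesis .
    qed
    finally show ?thesis using \<theta> unfolding S'_def
      by (auto simp: divide_right_mono ennreal_leI intro: add_right_mono)
  qed
  have "emeasure (N \<Otimes>\<^sub>M G') SH = (\<integral>\<^sup>+\<omega>. emeasure N ((\<lambda>u. (u, \<omega>)) -` SH) \<partial>G')"
    using mSH by (intro emeasure_pair_measure_alt2) (simp add: setsNG)
  also have "\<dots> \<le> (\<integral>\<^sup>+\<omega>. ennreal (exp B / \<theta>) + ennreal \<theta> * emeasure N ((\<lambda>u. (u, \<omega>)) -` SK) \<partial>G')"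
    by (rule nn_integral_mono) (use slice spG' in auto)
  also have "\<dots> = ennreal (exp B / \<theta>) + ennreal \<theta> * emeasure (N \<Otimes>\<^sub>M G') SK"
  proof -
    have s: "SK \<in> sets (N \<Otimes>\<^sub>M G')" using mSK by (simp add: setsNG)
    have [measurable]: "(\<lambda>\<omega>. emeasure N ((\<lambda>u. (u, \<omega>)) -` SK)) \<in> borel_measurable G'"
      by (rule measurable_emeasure_Pair2[OF s])
    show ?thesis
      by (simp add: nn_integral_add nn_integral_cmult emeasure_pair_measure_alt2[OF s] pG.emeasure_space_1)
  qed
  finally show ?thesis by (simp add: lhs rhs)
qed

text \<open>Cylinder sets form an algebra that generates \<open>observation_space\<close>, and both
  sides of the inequality move little when \<open>A\<close> changes by a set that is small under the
  laws of both paths.\<close>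

lemma prob_shifted_path_le:
  assumes A: "A \<in> sets observation_space"
  shows "prob {\<omega>\<in>E. shifted_path H \<omega> \<in> A} \<le> exp B / \<theta> + \<theta> * prob {\<omega>\<in>space M. shifted_path K \<omega> \<in> A}"
proof -
  let ?\<Omega> = "space observation_space"
  define \<A> where "\<A> = {A. \<exists>J X. finite J \<and> J \<subseteq> {0..1::real} \<and> X \<in> sets (\<Pi>\<^sub>M t\<in>J. borel :: (real \<times> real) measure) \<and>
     A = {z\<in>?\<Omega>. restrict z J \<in> X}}"
  have sp: "?\<Omega> = ({0..1} \<rightarrow>\<^sub>E UNIV)" by (simp add: observation_space_def space_PiM)
  have mr: "(\<lambda>z. restrict z J) \<in> measurable observation_space (\<Pi>\<^sub>M t\<in>J. borel)" if "J \<subseteq> {0..1}" for J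
    unfolding observation_space_def by (rule measurable_restrict_subset[OF that])
  have gen: "\<A> \<subseteq> sets observation_space"
  proof
    fix a assume "a \<in> \<A>"
    then obtain J X where JX: "J \<subseteq> {0..1::real}" "X \<in> sets (\<Pi>\<^sub>M t\<in>J. borel :: (real \<times> real) measure)"
      "a = {z\<in>?\<Omega>. restrict z J \<in> X}" by (auto simp: \<A>_def)
    have "a = (\<lambda>z. restrict z J) -` X \<inter> ?\<Omega>" using JX(3) by auto
    then show "a \<in> sets observation_space" using measurable_sets[OF mr[OF JX(1)] JX(2)] by simp
  qed
  have alg: "algebra ?\<Omega> \<A>"
  proof (rule algebra_iff_Un[THEN iffD2], intro conjI ballI)
    show "\<A> \<subseteq> Pow ?\<Omega>" by (auto simp: \<A>_def)
    show "{} \<in> \<A>" by (auto simp: \<A>_def intro!: exI[of _ "{}"])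
  next
    fix a assume "a \<in> \<A>"
    then obtain J X where JX: "finite J" "J \<subseteq> {0..1::real}" "X \<in> sets (\<Pi>\<^sub>M t\<in>J. borel :: (real \<times> real) measure)"
      "a = {z\<in>?\<Omega>. restrict z J \<in> X}" by (auto simp: \<A>_def)
    have "?\<Omega> - a = {z\<in>?\<Omega>. restrict z J \<in> space (\<Pi>\<^sub>M t\<in>J. borel :: (real \<times> real) measure) - X}"
      using JX(4) by (auto simp: space_PiM)
    moreover have "space (\<Pi>\<^sub>M t\<in>J. borel :: (real \<times> real) measure) - X \<in> sets (\<Pi>\<^sub>M t\<in>J. borel)"
      using JX(3) by auto
    ultimately show "?\<Omega> - a \<in> \<A>" unfolding \<A>_def using JX(1,2) by blast
  next
    fix a b assume "a \<in> \<A>" "b \<in> \<A>"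
    then obtain J X J' X' where JX: "finite J" "J \<subseteq> {0..1::real}" "X \<in> sets (\<Pi>\<^sub>M t\<in>J. borel :: (real \<times> real) measure)"
      "a = {z\<in>?\<Omega>. restrict z J \<in> X}" and JX': "finite J'" "J' \<subseteq> {0..1::real}" "X' \<in> sets (\<Pi>\<^sub>M t\<in>J'. borel :: (real \<times> real) measure)"
      "b = {z\<in>?\<Omega>. restrict z J' \<in> X'}" unfolding \<A>_def by blast
    \<comment> \<open>Two cylinders are rewritten over the union of their time sets.\<close>
    let ?L = "J \<union> J'" and ?M = "\<Pi>\<^sub>M t\<in>J \<union> J'. borel :: (real \<times> real) measure"
    have m: "(\<lambda>z. restrict z J) \<in> measurable ?M (\<Pi>\<^sub>M t\<in>J. borel)" "(\<lambda>z. restrict z J') \<in> measurable ?M (\<Pi>\<^sub>M t\<in>J'. borel)"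
      by (auto intro!: measurable_restrict_subset)
    let ?X = "{z\<in>space ?M. restrict z J \<in> X} \<union> {z\<in>space ?M. restrict z J' \<in> X'}"
    have "?X \<in> sets ?M"
      using measurable_sets[OF m(1) JX(3)] measurable_sets[OF m(2) JX'(3)]
      by (intro sets.Un) (simp_all add: vimage_def Int_def conj_commute)
    moreover have "a \<union> b = {z\<in>?\<Omega>. restrict z ?L \<in> ?X}"
    proof -
      have r: "restrict (restrict z ?L) J = restrict z J" "restrict (restrict z ?L) J' = restrict z J'"
        for z :: "real \<Rightarrow> real \<times> real" by (auto simp: fun_eq_iff)
      show ?thesis unfolding JX(4) JX'(4) by (auto simp only: r mem_Collect_eq Un_iff) (auto simp: space_PiM)
    qed
    ultimately show "a \<union> b \<in> \<A>" unfolding \<A>_def using JX(1,2) JX'(1,2)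
      by (intro CollectI exI[of _ ?L] exI[of _ ?X]) auto
  qed
  have sig: "sets observation_space = sigma_sets ?\<Omega> \<A>"
  proof
    show "sigma_sets ?\<Omega> \<A> \<subseteq> sets observation_space" using gen by (rule sets.sigma_sets_subset)
    have s1: "{f \<in> ?\<Omega>. f t \<in> S} \<in> \<A>" if t: "t \<in> {0..1}" and S: "S \<in> sets borel" for t and S :: "(real \<times> real) set"
    proof -
      let ?X = "{z\<in>space (\<Pi>\<^sub>M t\<in>{t}. borel :: (real \<times> real) measure). z t \<in> S}"
      have "?X \<in> sets (\<Pi>\<^sub>M t\<in>{t}. borel)"
        using S by measurable
      moreover have "{f \<in> ?\<Omega>. f t \<in> S} = {z\<in>?\<Omega>. restrict z {t} \<in> ?X}" by (auto simp: space_PiM)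
      ultimately show ?thesis unfolding \<A>_def using t by (intro CollectI exI[of _ "{t}"] exI[of _ ?X]) auto
    qed
    have "sets observation_space = sigma_sets ?\<Omega> {{f \<in> ?\<Omega>. f t \<in> S} | t S. t \<in> {0..1} \<and> S \<in> sets borel}"
      by (simp add: observation_space_def sets_PiM_single space_PiM)
    also have "\<dots> \<subseteq> sigma_sets ?\<Omega> \<A>"
      by (rule sigma_sets_mono) (auto intro!: sigma_sets.Basic s1 simp del: atLeastAtMost_iff)
    finally show "sets observation_space \<subseteq> sigma_sets ?\<Omega> \<A>" .
  qed
  define \<mu> where "\<mu> = distr M observation_space (shifted_path H)"
  define \<nu> where "\<nu> = distr M observation_space (shifted_path K)"
  note mH = measurable_shifted_path[of H, OF H] and mK = measurable_shifted_path[of K, OF K]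
  have EM: "E \<in> sets M" using E sub by (auto simp: subalgebra_def)
  have EsM: "E \<subseteq> space M" using EM sets.sets_into_space by auto
  have \<mu>: "measure \<mu> S = prob {\<omega>\<in>space M. shifted_path H \<omega> \<in> S}" if "S \<in> sets observation_space" for S
    unfolding \<mu>_def using that by (subst measure_distr[OF mH]) (auto intro!: arg_cong[where f=prob])
  have \<nu>: "measure \<nu> S = prob {\<omega>\<in>space M. shifted_path K \<omega> \<in> S}" if "S \<in> sets observation_space" for S
    unfolding \<nu>_def using that by (subst measure_distr[OF mK]) (auto intro!: arg_cong[where f=prob])
  have f1: "finite_measure \<mu>" unfolding \<mu>_def by (rule finite_measure_distr[OF mH])
  have f2: "finite_measure \<nu>" unfolding \<nu>_def by (rule finite_measure_distr[OF mK])
  interpret m: finite_measure \<mu> by fact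
  interpret n: finite_measure \<nu> by fact
  have s1: "sets \<mu> = sets observation_space" and s2: "sets \<nu> = sets observation_space"
    by (auto simp: \<mu>_def \<nu>_def)
  have mE: "{\<omega>\<in>E. shifted_path H \<omega> \<in> S} \<in> sets M" if "S \<in> sets observation_space" for S
  proof -
    have "{\<omega>\<in>E. shifted_path H \<omega> \<in> S} = E \<inter> (shifted_path H -` S \<inter> space M)" using EsM by auto
    then show ?thesis using measurable_sets[OF mH that] EM by auto
  qed
  have mHS: "{\<omega>\<in>space M. shifted_path H \<omega> \<in> S} \<in> sets M" if "S \<in> sets observation_space" for S
    using measurable_sets[OF mH that] by (simp add: vimage_def Int_def conj_commute)
  have "prob {\<omega>\<in>E. shifted_path H \<omega> \<in> A} \<le> exp B / \<theta> + \<theta> * measure \<nu> A + e" if "e > 0" for e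
  proof -
    \<comment> \<open>The approximation error enters once directly and once multiplied by \<theta>,
      hence the divisor.\<close>
    have "e / (1 + \<theta>) > 0" using that \<theta> by simp
    then obtain C where C: "C \<in> \<A>" "measure \<mu> ((A - C) \<union> (C - A)) + measure \<nu> ((A - C) \<union> (C - A)) < e / (1 + \<theta>)"
      using algebra_approximation[OF f1 f2 alg _ _ _ , of A "e / (1 + \<theta>)"] s1 s2 sig A by auto
    have Cs: "C \<in> sets observation_space" using C gen by auto
    obtain J X where JX: "finite J" "J \<subseteq> {0..1::real}" "X \<in> sets (\<Pi>\<^sub>M t\<in>J. borel :: (real \<times> real) measure)"
      "C = {z\<in>?\<Omega>. restrict z J \<in> X}" using C(1) by (auto simp: \<A>_def)
    have pin: "shifted_path h \<omega> \<in> ?\<Omega>" for h \<omega> by (simp add: sp shifted_path_def)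
    have "emeasure M {\<omega>\<in>E. shifted_path H \<omega> \<in> C} \<le> ennreal (exp B / \<theta>) + ennreal \<theta> * emeasure M {\<omega>\<in>space M. shifted_path K \<omega> \<in> C}"
      using emeasure_cylinder_le[OF JX(1-3)] pin unfolding JX(4) by simp
    then have c: "prob {\<omega>\<in>E. shifted_path H \<omega> \<in> C} \<le> exp B / \<theta> + \<theta> * measure \<nu> C"
      using \<theta> unfolding \<nu>[OF Cs]
      by (simp add: emeasure_eq_measure ennreal_mult'[symmetric] ennreal_plus[symmetric] del: ennreal_plus)
    have D: "measure \<mu> (A - C) \<le> measure \<mu> ((A - C) \<union> (C - A))" "measure \<nu> (C - A) \<le> measure \<nu> ((A - C) \<union> (C - A))"
      using A Cs s1 s2 by (auto intro!: m.finite_measure_mono n.finite_measure_mono)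
    have "prob {\<omega>\<in>E. shifted_path H \<omega> \<in> A} \<le> prob ({\<omega>\<in>E. shifted_path H \<omega> \<in> C} \<union> {\<omega>\<in>space M. shifted_path H \<omega> \<in> A - C})"
      using EsM mE[OF Cs] mHS[of "A - C"] A Cs by (intro finite_measure_mono sets.Un) auto
    also have "\<dots> \<le> prob {\<omega>\<in>E. shifted_path H \<omega> \<in> C} + prob {\<omega>\<in>space M. shifted_path H \<omega> \<in> A - C}"
      using mE[OF Cs] mHS[of "A - C"] A Cs by (intro measure_Un_le) auto
    also have "prob {\<omega>\<in>space M. shifted_path H \<omega> \<in> A - C} = measure \<mu> (A - C)"
      using A Cs by (intro \<mu>[symmetric]) auto
    finally have "prob {\<omega>\<in>E. shifted_path H \<omega> \<in> A} \<le> exp B / \<theta> + \<theta> * measure \<nu> C + measure \<mu> (A - C)"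
      using c by simp
    also have "measure \<nu> C \<le> measure \<nu> (A \<union> (C - A))"
      using A Cs s2 by (intro n.finite_measure_mono) auto
    also have "measure \<nu> (A \<union> (C - A)) \<le> measure \<nu> A + measure \<nu> (C - A)"
      using A Cs s2 by (intro measure_Un_le) auto
    finally have "prob {\<omega>\<in>E. shifted_path H \<omega> \<in> A} \<le> exp B / \<theta> + \<theta> * measure \<nu> A + (\<theta> * measure \<nu> (C - A) + measure \<mu> (A - C))"
      using \<theta> by (simp add: algebra_simps)
    also have "\<theta> * measure \<nu> (C - A) + measure \<mu> (A - C) \<le> \<theta> * (e / (1 + \<theta>)) + e / (1 + \<theta>)"
      using C(2) D \<theta> measure_nonneg[of \<mu> "(A - C) \<union> (C - A)"] measure_nonneg[of \<nu> "(A - C) \<union> (C - A)"]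
      by (intro add_mono mult_left_mono) linarith+
    also have "\<theta> * (e / (1 + \<theta>)) + e / (1 + \<theta>) = e"
    proof -
      have "\<theta> * (e / (1 + \<theta>)) + e / (1 + \<theta>) = (1 + \<theta>) * (e / (1 + \<theta>))"
        by (simp only: distrib_right mult_1_left add.commute)
      then show ?thesis using \<theta> by simp
    qed
    finally show ?thesis by simp
  qed
  then have "prob {\<omega>\<in>E. shifted_path H \<omega> \<in> A} \<le> exp B / \<theta> + \<theta> * measure \<nu> A"
    by (rule field_le_epsilon)
  then show ?thesis using \<nu>[OF A] by simp
qed

end

section \<open>The Meyer wavelet\<close>

text \<open>For \<open>0 \<le> a\<close>, the inverse Fourier transform at \<open>y\<close> of the
  even function with profile \<open>S\<close> on absolute frequencies from \<open>a\<close> to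
  \<open>b\<close>; the factor 2 accounts for negative frequencies.\<close>

definition cos_transform :: "(real \<Rightarrow> real) \<Rightarrow> real \<Rightarrow> real \<Rightarrow> real \<Rightarrow> real" where
  "cos_transform S a b y = 2 * integral {a..b} (\<lambda>u. S u * cos (2 * pi * u * y))"

lemma continuous_cos_transform:
  assumes "continuous_on {a..b} S"
  shows "continuous_on UNIV (cos_transform S a b)"
proof -
  have c: "continuous_on (UNIV \<times> cbox a b) (\<lambda>(y, u). S u * cos (2 * pi * u * y))"
  proof -
    have "continuous_on (UNIV \<times> cbox a b) (\<lambda>p :: real \<times> real. S (snd p))"
      by (rule continuous_on_compose2[OF assms]) (auto intro!: continuous_intros)
    then show ?thesis
      unfolding case_prod_unfold by (intro continuous_intros)
  qed
  show ?thesis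
    unfolding cos_transform_def using integral_continuous_on_param[OF c]
    by (auto intro!: continuous_intros simp: cbox_interval)
qed

text \<open>Two integrations by parts gain a factor of order \<open>1 / y^2\<close>. The assumptions
  \<open>z\<close> remove the boundary terms; at \<open>a = 0\<close> the one containing
  \<open>S a\<close> vanishes through the sine.\<close>

lemma cos_transform_decay:
  fixes S :: "real \<Rightarrow> real"
  assumes ab: "a \<le> b" and S: "\<And>u. (S has_real_derivative S1 u) (at u)" "\<And>u. (S1 has_real_derivative S2 u) (at u)"
    and S2: "continuous_on UNIV S2" and z: "S b = 0" "S1 a = 0" "S1 b = 0" "a = 0 \<or> S a = 0"
  shows "\<exists>C>0. \<forall>y. \<bar>cos_transform S a b y\<bar> \<le> C / (1 + y\<^sup>2)"
proof -
  have cS: "continuous_on A S" and cS1: "continuous_on A S1" for A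
    using S by (auto intro!: continuous_at_imp_continuous_on intro: DERIV_isCont)
  have cS2: "continuous_on A S2" for A using S2 by (rule continuous_on_subset) auto
  obtain m where m: "\<And>u. u \<in> {a..b} \<Longrightarrow> \<bar>S u\<bar> \<le> m"
    using compact_imp_bounded[OF compact_continuous_image[OF cS compact_Icc]] unfolding bounded_iff by fastforce
  obtain m2 where m2: "\<And>u. u \<in> {a..b} \<Longrightarrow> \<bar>S2 u\<bar> \<le> m2"
    using compact_imp_bounded[OF compact_continuous_image[OF cS2 compact_Icc]] unfolding bounded_iff by fastforce
  have m0: "m \<ge> 0" "m2 \<ge> 0" using m[of a] m2[of a] ab by auto
  \<comment> \<open>The trivial bound of the integral plus the bound after two integrations by
    parts; the summand 1 makes \<open>C\<close> positive.\<close>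
  define C where "C = 2 * (b - a) * (m + m2) + 1"
  have "\<bar>cos_transform S a b y\<bar> \<le> C / (1 + y\<^sup>2)" for y
  proof -
    define w where "w = 2 * pi * y"
    let ?I = "integral {a..b} (\<lambda>u. S u * cos (w * u))"
    let ?J = "integral {a..b} (\<lambda>u. S2 u * cos (w * u))"
    \<comment> \<open>Both integrations by parts at once: the boundary expression is an
      antiderivative of the integrand.\<close>
    have "((\<lambda>u. w\<^sup>2 * (S u * cos (w * u)) + S2 u * cos (w * u)) has_integral
      ((w * S b * sin (w * b) + S1 b * cos (w * b)) - (w * S a * sin (w * a) + S1 a * cos (w * a)))) {a..b}"
      by (rule fundamental_theorem_of_calculus[OF ab])
        (auto intro!: derivative_eq_intros DERIV_subset[OF S(1)] DERIV_subset[OF S(2)]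
          simp: has_real_derivative_iff_has_vector_derivative[symmetric] power2_eq_square algebra_simps)
    then have i0: "((\<lambda>u. w\<^sup>2 * (S u * cos (w * u)) + S2 u * cos (w * u)) has_integral 0) {a..b}"
      using z by auto
    have i1: "(\<lambda>u. S u * cos (w * u)) integrable_on {a..b}" "(\<lambda>u. S2 u * cos (w * u)) integrable_on {a..b}"
      by (auto intro!: integrable_continuous_interval continuous_intros cS cS2)
    have eq: "w\<^sup>2 * ?I = - ?J"
      using has_integral_unique[OF i0 has_integral_add[OF has_integral_mult_right[OF integrable_integral[OF i1(1)]]
        integrable_integral[OF i1(2)]]] by linarith
    have b1: "\<bar>?I\<bar> \<le> m * (b - a)"
    proof -
      have "norm ?I \<le> m * (b - a)"
        using ab m by (intro integral_bound) (auto intro!: continuous_intros cS simp: abs_mult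
          intro: order_trans[OF mult_mono[of _ _ _ 1]])
      then show ?thesis by simp
    qed
    have b2: "\<bar>?J\<bar> \<le> m2 * (b - a)"
    proof -
      have "norm ?J \<le> m2 * (b - a)"
        using ab m2 by (intro integral_bound) (auto intro!: continuous_intros cS2 simp: abs_mult
          intro: order_trans[OF mult_mono[of _ _ _ 1]])
      then show ?thesis by simp
    qed
    have "y\<^sup>2 \<le> w\<^sup>2"
    proof -
      have "1 \<le> (2 * pi)\<^sup>2" using pi_gt3 by (intro one_le_power) auto
      then have "1 * y\<^sup>2 \<le> (2 * pi)\<^sup>2 * y\<^sup>2" by (rule mult_right_mono) auto
      then show ?thesis by (simp add: w_def power_mult_distrib)
    qed
    then have "y\<^sup>2 * \<bar>?I\<bar> \<le> w\<^sup>2 * \<bar>?I\<bar>" by (rule mult_right_mono) auto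
    also have "\<dots> = \<bar>?J\<bar>" using eq by (metis abs_minus_cancel abs_mult abs_power2)
    finally have "(1 + y\<^sup>2) * (2 * \<bar>?I\<bar>) \<le> C"
      using b1 b2 by (simp add: C_def algebra_simps)
    moreover have "\<bar>cos_transform S a b y\<bar> = 2 * \<bar>?I\<bar>"
      by (simp add: cos_transform_def w_def abs_mult mult.commute mult.left_commute)
    moreover have "1 + y\<^sup>2 > 0" by (rule add_pos_nonneg) auto
    ultimately show ?thesis by (simp add: pos_le_divide_eq mult.commute)
  qed
  moreover have "C > 0" using ab m0 by (simp add: C_def add_nonneg_pos)
  ultimately show ?thesis by blast
qed

text \<open>Folding at 0 leaves a cosine integral because the profile is even, and the phase factor
  is a translation by \<kappa>. It is used with \<kappa> = 0 for the scaling function and \<kappa> =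
  1/2 for the wavelet, whose transform carries \<open>cis (pi * \<xi>)\<close>.\<close>

lemma Re_inverse_fourier_even:
  fixes S :: "real \<Rightarrow> real"
  assumes S: "continuous_on UNIV S" and ab: "0 \<le> a" "a \<le> b"
    and z: "\<And>u. 0 \<le> u \<Longrightarrow> u \<notin> {a..b} \<Longrightarrow> S u = 0" "S b = 0" and za: "a = 0 \<or> S a = 0"
  shows "Re (inverse_fourier (\<lambda>\<xi>. cis (2 * pi * \<kappa> * \<xi>) * complex_of_real (S \<bar>\<xi>\<bar>)) y) =
    cos_transform S a b (y + \<kappa>)"
proof -
  define h where "h \<xi> = complex_of_real (S \<bar>\<xi>\<bar>) * cis (2 * pi * \<xi> * (y + \<kappa>))" for \<xi>
  have cS: "continuous_on A (\<lambda>\<xi>. S \<bar>\<xi>\<bar>)" for A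
    by (rule continuous_on_compose2[OF S]) (auto intro!: continuous_intros)
  have ch: "continuous_on A h" for A
    unfolding h_def by (intro continuous_intros cS)
  have "inverse_fourier (\<lambda>\<xi>. cis (2 * pi * \<kappa> * \<xi>) * complex_of_real (S \<bar>\<xi>\<bar>)) y = (LINT \<xi>|lborel. h \<xi>)"
    unfolding inverse_fourier_def h_def
    by (intro Bochner_Integration.integral_cong) (auto simp: cis_mult algebra_simps)
  also have "\<dots> = (LINT \<xi>:{-b..b}|lborel. h \<xi>)"
    unfolding set_lebesgue_integral_def
    by (intro Bochner_Integration.integral_cong) (use z ab in \<open>auto simp: h_def indicator_def\<close>)
  also have "\<dots> = integral {-b..b} h"
    by (intro set_borel_integral_eq_integral borel_integrable_atLeastAtMost' ch)
  finally have "Re (inverse_fourier (\<lambda>\<xi>. cis (2 * pi * \<kappa> * \<xi>) * complex_of_real (S \<bar>\<xi>\<bar>)) y) = Re (integral {-b..b} h)"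
    by simp
  also have "\<dots> = integral {-b..b} (\<lambda>\<xi>. Re (h \<xi>))"
    using integral_linear[OF integrable_continuous_interval[OF ch] bounded_linear_Re] by (simp add: comp_def)
  also have "(\<lambda>\<xi>. Re (h \<xi>)) = (\<lambda>\<xi>. S \<bar>\<xi>\<bar> * cos (2 * pi * \<xi> * (y + \<kappa>)))"
    by (simp add: h_def fun_eq_iff)
  also have "integral {-b..b} \<dots> = 2 * integral {0..b} (\<lambda>u. S u * cos (2 * pi * u * (y + \<kappa>)))"
  proof -
    let ?g = "\<lambda>\<xi>. S \<bar>\<xi>\<bar> * cos (2 * pi * \<xi> * (y + \<kappa>))"
    have ig: "?g integrable_on {c..d}" for c d
      by (auto intro!: integrable_continuous_interval continuous_intros cS)
    have "integral {-b..b} ?g = integral {-b..0} ?g + integral {0..b} ?g"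
      using ab by (intro Henstock_Kurzweil_Integration.integral_combine[symmetric] ig) auto
    also have "integral {-b..0} ?g = integral {0..b} ?g"
      using Henstock_Kurzweil_Integration.integral_reflect_real[where f="?g" and a=0 and b=b] by simp
    also have "integral {0..b} ?g = integral {0..b} (\<lambda>u. S u * cos (2 * pi * u * (y + \<kappa>)))"
      by (rule Henstock_Kurzweil_Integration.integral_cong) auto
    finally show ?thesis by simp
  qed
  also have "integral {0..b} (\<lambda>u. S u * cos (2 * pi * u * (y + \<kappa>))) = integral {a..b} (\<lambda>u. S u * cos (2 * pi * u * (y + \<kappa>)))"
  proof -
    let ?g = "\<lambda>u. S u * cos (2 * pi * u * (y + \<kappa>))"
    have ig: "?g integrable_on {c..d}" for c d
      by (auto intro!: integrable_continuous_interval continuous_intros continuous_on_subset[OF S])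
    have "integral {0..b} ?g = integral {0..a} ?g + integral {a..b} ?g"
      using ab by (intro Henstock_Kurzweil_Integration.integral_combine[symmetric] ig) auto
    also have "integral {0..a} ?g = integral {0..a} (\<lambda>u. 0)"
    proof (cases "a = 0")
      case False
      then show ?thesis using z za by (intro Henstock_Kurzweil_Integration.integral_cong) force
    qed simp
    finally show ?thesis by simp
  qed
  finally show ?thesis by (simp add: cos_transform_def)
qed

section \<open>Smoothness of the Meyer profiles\<close>

lemma deriv_eq_0_at_left:
  fixes f :: "real \<Rightarrow> real"
  assumes "(f has_real_derivative D) (at x)" "\<And>y. y \<le> x \<Longrightarrow> f y = c"
  shows "D = 0"
proof (rule ccontr)
  assume "D \<noteq> 0"
  then consider "D > 0" | "D < 0" by linarith
  then obtain d where "d > 0" "\<And>h. h > 0 \<Longrightarrow> h < d \<Longrightarrow> f (x - h) \<noteq> f x"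
    using DERIV_pos_inc_left[OF assms(1)] DERIV_neg_dec_left[OF assms(1)] by (metis less_irrefl)
  from this(2)[of "d / 2"] \<open>d > 0\<close> show False using assms(2)[of x] assms(2)[of "x - d / 2"] by auto
qed

lemma meyer_transition_derivs:
  assumes "meyer_transition v"
  obtains v1 v2 where "\<And>x. (v has_real_derivative v1 x) (at x)" "\<And>x. (v1 has_real_derivative v2 x) (at x)"
    "continuous_on UNIV v2" "v1 0 = 0" "v1 1 = 0"
proof -
  have d: "((deriv ^^ m) v) differentiable (at x)" for m x
    using assms unfolding meyer_transition_def by blast
  have 0: "(v has_real_derivative deriv v x) (at x)" for x
    using d[of 0 x] by (simp add: DERIV_deriv_iff_real_differentiable)
  have 1: "(deriv v has_real_derivative deriv (deriv v) x) (at x)" for x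
    using d[of 1 x] by (simp add: DERIV_deriv_iff_real_differentiable)
  have 2: "continuous_on UNIV (deriv (deriv v))"
    using d[of 2] by (auto simp: numeral_2_eq_2 intro!: continuous_at_imp_continuous_on differentiable_imp_continuous_within)
  have v: "\<And>x. x \<le> 0 \<Longrightarrow> v x = 0" "\<And>x. x \<ge> 1 \<Longrightarrow> v x = 1"
    using assms unfolding meyer_transition_def by auto
  have z0: "deriv v 0 = 0" using deriv_eq_0_at_left[OF 0 v(1)] by simp
  \<comment> \<open>Reflection moves the half-line \<open>x \<ge> 1\<close>, where \<open>v\<close>
    is constant, to the left of -1.\<close>
  have "((\<lambda>x. v (- x)) has_real_derivative - deriv v 1) (at (-1))"
    using DERIV_chain2[where f=v and g="\<lambda>x. - x" and x="-1" and Db="-1" and Da="deriv v 1" and s=UNIV] 0[of 1]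
      DERIV_minus[OF DERIV_ident, where 'a=real] by simp
  then have z1: "- deriv v 1 = 0" by (rule deriv_eq_0_at_left[where c=1]) (use v in auto)
  show thesis using that[OF 0 1 2 z0] z1 by simp
qed

definition meyer_phi_profile :: "(real \<Rightarrow> real) \<Rightarrow> real \<Rightarrow> real" where
  "meyer_phi_profile v u = cos (pi / 2 * v (3 * u - 1))"

definition meyer_psi_profile :: "(real \<Rightarrow> real) \<Rightarrow> real \<Rightarrow> real" where
  "meyer_psi_profile v u = sin (pi / 2 * v (3 * u - 1)) * cos (pi / 2 * v (3 / 2 * u - 1))"

text \<open>The profiles of the two Fourier transforms are single smooth expressions in \<open>\<bar>\<xi>\<bar>\<close>; the case
  distinctions in their definitions only record where \<open>v\<close> is constant.\<close>

lemma meyer_scaling_eq: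
  assumes m: "meyer_transition v"
  shows "meyer_scaling v y = cos_transform (meyer_phi_profile v) 0 (2/3) y"
proof -
  obtain v1 v2 where v: "\<And>x. (v has_real_derivative v1 x) (at x)" using meyer_transition_derivs[OF m] by metis
  have cv: "continuous_on A v" for A using v by (auto intro!: continuous_at_imp_continuous_on intro: DERIV_isCont)
  have c: "continuous_on UNIV (meyer_phi_profile v)"
    unfolding meyer_phi_profile_def by (intro continuous_intros continuous_on_compose2[OF cv[of UNIV]]) auto
  have v01: "\<And>x. x \<le> 0 \<Longrightarrow> v x = 0" "\<And>x. x \<ge> 1 \<Longrightarrow> v x = 1"
    using m unfolding meyer_transition_def by auto
  have "meyer_scaling_hat v = (\<lambda>\<xi>. cis (2 * pi * 0 * \<xi>) * complex_of_real (meyer_phi_profile v \<bar>\<xi>\<bar>))"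
  proof
    fix \<xi> :: real
    show "meyer_scaling_hat v \<xi> = cis (2 * pi * 0 * \<xi>) * complex_of_real (meyer_phi_profile v \<bar>\<xi>\<bar>)"
      by (auto simp: meyer_scaling_hat_def meyer_phi_profile_def v01)
  qed
  then have "meyer_scaling v y = Re (inverse_fourier (\<lambda>\<xi>. cis (2 * pi * 0 * \<xi>) * complex_of_real (meyer_phi_profile v \<bar>\<xi>\<bar>)) y)"
    by (simp add: meyer_scaling_def)
  also have "\<dots> = cos_transform (meyer_phi_profile v) 0 (2/3) (y + 0)"
    by (rule Re_inverse_fourier_even[OF c]) (auto simp: meyer_phi_profile_def v01)
  finally show ?thesis by simp
qed

lemma meyer_wavelet_eq:
  assumes m: "meyer_transition v"
  shows "meyer_wavelet v y = cos_transform (meyer_psi_profile v) (1/3) (4/3) (y + 1/2)"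
proof -
  obtain v1 v2 where v: "\<And>x. (v has_real_derivative v1 x) (at x)" using meyer_transition_derivs[OF m] by metis
  have cv: "continuous_on A v" for A using v by (auto intro!: continuous_at_imp_continuous_on intro: DERIV_isCont)
  have c: "continuous_on UNIV (meyer_psi_profile v)"
    unfolding meyer_psi_profile_def by (intro continuous_intros continuous_on_compose2[OF cv[of UNIV]]) auto
  have v01: "\<And>x. x \<le> 0 \<Longrightarrow> v x = 0" "\<And>x. x \<ge> 1 \<Longrightarrow> v x = 1"
    using m unfolding meyer_transition_def by auto
  have "meyer_wavelet_hat v = (\<lambda>\<xi>. cis (2 * pi * (1/2) * \<xi>) * complex_of_real (meyer_psi_profile v \<bar>\<xi>\<bar>))"
  proof
    fix \<xi> :: real
    show "meyer_wavelet_hat v \<xi> = cis (2 * pi * (1/2) * \<xi>) * complex_of_real (meyer_psi_profile v \<bar>\<xi>\<bar>)"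
      by (auto simp: meyer_wavelet_hat_def meyer_psi_profile_def v01)
  qed
  then have "meyer_wavelet v y = Re (inverse_fourier (\<lambda>\<xi>. cis (2 * pi * (1/2) * \<xi>) * complex_of_real (meyer_psi_profile v \<bar>\<xi>\<bar>)) y)"
    by (simp add: meyer_wavelet_def)
  also have "\<dots> = cos_transform (meyer_psi_profile v) (1/3) (4/3) (y + 1/2)"
    by (rule Re_inverse_fourier_even[OF c]) (auto simp: meyer_psi_profile_def v01)
  finally show ?thesis .
qed

text \<open>What is used of a profile: it is \<open>C\<^sup>2\<close> and vanishes, with its derivative, at the ends of \<open>[a, b]\<close>
  (at \<open>a = 0\<close>, the centre of symmetry, only the derivative has to vanish).\<close>

definition smooth_profile :: "real \<Rightarrow> real \<Rightarrow> (real \<Rightarrow> real) \<Rightarrow> bool" where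
  "smooth_profile a b S \<longleftrightarrow> (\<exists>S1 S2. (\<forall>u. (S has_real_derivative S1 u) (at u)) \<and>
     (\<forall>u. (S1 has_real_derivative S2 u) (at u)) \<and> continuous_on UNIV S2 \<and>
     0 \<le> a \<and> a \<le> b \<and> S b = 0 \<and> S1 a = 0 \<and> S1 b = 0 \<and> (a = 0 \<or> S a = 0))"

lemma smooth_profile_phi:
  assumes m: "meyer_transition v"
  shows "smooth_profile 0 (2/3) (meyer_phi_profile v)"
proof -
  obtain v1 v2 where v: "\<And>x. (v has_real_derivative v1 x) (at x)" "\<And>x. (v1 has_real_derivative v2 x) (at x)"
    "continuous_on UNIV v2" "v1 0 = 0" "v1 1 = 0" using meyer_transition_derivs[OF m] by metis
  have v01: "\<And>x. x \<le> 0 \<Longrightarrow> v x = 0" "\<And>x. x \<ge> 1 \<Longrightarrow> v x = 1"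
    using m unfolding meyer_transition_def by auto
  \<comment> \<open>At \<open>u = 0\<close> the argument \<open>3 * u - 1\<close> is -1, inside the
    region where \<open>v\<close> is 0.\<close>
  have v10: "v1 (-1) = 0" using deriv_eq_0_at_left[OF v(1)[of "-1"]] v01(1) by auto
  have cv: "continuous_on A v" "continuous_on A v1" for A
    using v(1,2) by (auto intro!: continuous_at_imp_continuous_on intro: DERIV_isCont)
  define S1 where "S1 u = - sin (pi / 2 * v (3 * u - 1)) * (3 * pi / 2 * v1 (3 * u - 1))" for u
  define S2 where "S2 u = - cos (pi / 2 * v (3 * u - 1)) * (3 * pi / 2 * v1 (3 * u - 1))\<^sup>2
    - sin (pi / 2 * v (3 * u - 1)) * (9 * pi / 2 * v2 (3 * u - 1))" for u
  have "(meyer_phi_profile v has_real_derivative S1 u) (at u)" for u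
    unfolding meyer_phi_profile_def S1_def
    by (auto intro!: derivative_eq_intros DERIV_chain2[OF v(1)])
  moreover have "(S1 has_real_derivative S2 u) (at u)" for u
    unfolding S1_def S2_def
    by (auto intro!: derivative_eq_intros DERIV_chain2[OF v(1)] DERIV_chain2[OF v(2)] simp: power2_eq_square algebra_simps)
  moreover have "continuous_on UNIV S2"
    unfolding S2_def
    by (intro continuous_intros continuous_on_compose2[OF cv(1)[of UNIV]] continuous_on_compose2[OF cv(2)[of UNIV]]
      continuous_on_compose2[OF v(3)]) auto
  moreover have "meyer_phi_profile v (2/3) = 0" "S1 0 = 0" "S1 (2/3) = 0"
    by (auto simp: meyer_phi_profile_def S1_def v01 v10 v)
  ultimately show ?thesis unfolding smooth_profile_def by (intro exI[of _ S1] exI[of _ S2]) auto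
qed

lemma smooth_profile_psi:
  assumes m: "meyer_transition v"
  shows "smooth_profile (1/3) (4/3) (meyer_psi_profile v)"
proof -
  obtain v1 v2 where v: "\<And>x. (v has_real_derivative v1 x) (at x)" "\<And>x. (v1 has_real_derivative v2 x) (at x)"
    "continuous_on UNIV v2" "v1 0 = 0" "v1 1 = 0" using meyer_transition_derivs[OF m] by metis
  have v01: "\<And>x. x \<le> 0 \<Longrightarrow> v x = 0" "\<And>x. x \<ge> 1 \<Longrightarrow> v x = 1"
    using m unfolding meyer_transition_def by auto
  have cv: "continuous_on A v" "continuous_on A v1" for A
    using v(1,2) by (auto intro!: continuous_at_imp_continuous_on intro: DERIV_isCont)
  \<comment> \<open>The arguments \<open>3 * u - 1\<close> and \<open>3 / 2 * u - 1\<close> are 0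
    and -1/2 at \<open>u = 1/3\<close>, and 3 and 1 at \<open>u = 4/3\<close>; the derivative of
    \<open>v\<close> vanishes at all four.\<close>
  have v1neg: "v1 (-1/2) = 0" using deriv_eq_0_at_left[OF v(1)[of "-1/2"]] v01(1) by auto
  have v13: "v1 3 = 0"
  proof -
    have "((\<lambda>x. v (- x)) has_real_derivative - v1 3) (at (-3))"
      using DERIV_chain2[where f=v and g="\<lambda>x. - x" and x="-3" and Db="-1" and Da="v1 3" and s=UNIV] v(1)[of 3]
        DERIV_minus[OF DERIV_ident, where 'a=real] by simp
    then have "- v1 3 = 0" by (rule deriv_eq_0_at_left[where c=1]) (use v01 in auto)
    then show ?thesis by simp
  qed
  define A where "A u = sin (pi / 2 * v (3 * u - 1))" for u
  define A1 where "A1 u = cos (pi / 2 * v (3 * u - 1)) * (3 * pi / 2 * v1 (3 * u - 1))" for u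
  define A2 where "A2 u = - sin (pi / 2 * v (3 * u - 1)) * (3 * pi / 2 * v1 (3 * u - 1))\<^sup>2
    + cos (pi / 2 * v (3 * u - 1)) * (9 * pi / 2 * v2 (3 * u - 1))" for u
  define B where "B u = cos (pi / 2 * v (3 / 2 * u - 1))" for u
  define B1 where "B1 u = - sin (pi / 2 * v (3 / 2 * u - 1)) * (3 / 4 * pi * v1 (3 / 2 * u - 1))" for u
  define B2 where "B2 u = - cos (pi / 2 * v (3 / 2 * u - 1)) * (3 / 4 * pi * v1 (3 / 2 * u - 1))\<^sup>2
    - sin (pi / 2 * v (3 / 2 * u - 1)) * (9 / 8 * pi * v2 (3 / 2 * u - 1))" for u
  have A: "(A has_real_derivative A1 u) (at u)" "(A1 has_real_derivative A2 u) (at u)" for u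
    unfolding A_def A1_def A2_def
    by (auto intro!: derivative_eq_intros DERIV_chain2[OF v(1)] DERIV_chain2[OF v(2)] simp: power2_eq_square field_simps)
  have B: "(B has_real_derivative B1 u) (at u)" "(B1 has_real_derivative B2 u) (at u)" for u
    unfolding B_def B1_def B2_def
    by (auto intro!: derivative_eq_intros DERIV_chain2[OF v(1)] DERIV_chain2[OF v(2)] simp: power2_eq_square field_simps)
  have c: "continuous_on UNIV A" "continuous_on UNIV A1" "continuous_on UNIV A2"
    "continuous_on UNIV B" "continuous_on UNIV B1" "continuous_on UNIV B2"
    unfolding A_def A1_def A2_def B_def B1_def B2_def
    by (intro continuous_intros continuous_on_compose2[OF cv(1)[of UNIV]] continuous_on_compose2[OF cv(2)[of UNIV]]
      continuous_on_compose2[OF v(3)]; simp)+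
  define S1 where "S1 u = A1 u * B u + A u * B1 u" for u
  define S2 where "S2 u = A2 u * B u + 2 * (A1 u * B1 u) + A u * B2 u" for u
  have eq: "meyer_psi_profile v = (\<lambda>u. A u * B u)" by (simp add: fun_eq_iff meyer_psi_profile_def A_def B_def)
  have "(meyer_psi_profile v has_real_derivative S1 u) (at u)" for u
    unfolding eq S1_def by (auto intro!: derivative_eq_intros A B)
  moreover have "(S1 has_real_derivative S2 u) (at u)" for u
    unfolding S1_def S2_def by (auto intro!: derivative_eq_intros A B)
  moreover have "continuous_on UNIV S2" unfolding S2_def by (intro continuous_intros c)
  moreover have "meyer_psi_profile v (4/3) = 0" "meyer_psi_profile v (1/3) = 0" "S1 (1/3) = 0" "S1 (4/3) = 0"
    using v01 v v1neg v13 by (auto simp: meyer_psi_profile_def S1_def A_def A1_def B_def B1_def)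
  ultimately show ?thesis unfolding smooth_profile_def by (intro exI[of _ S1] exI[of _ S2]) auto
qed

lemma smooth_profile_decay:
  assumes "smooth_profile a b S"
  shows "\<exists>C>0. \<forall>y. \<bar>cos_transform S a b y\<bar> \<le> C / (1 + y\<^sup>2)"
  using assms cos_transform_decay[of a b S] unfolding smooth_profile_def by metis

lemma smooth_profile_continuous:
  assumes "smooth_profile a b S"
  shows "continuous_on A S"
  using assms unfolding smooth_profile_def
  by (auto intro!: continuous_at_imp_continuous_on intro: DERIV_isCont)

section \<open>Oscillatory integrals and frequencies outside the support\<close>

lemma oscillatory_integral_bound:
  fixes T :: "real \<Rightarrow> real"
  assumes ab: "a \<le> b" and T: "\<And>u. u \<in> {a..b} \<Longrightarrow> (T has_real_derivative T1 u) (at u)"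
    and T1: "continuous_on {a..b} T1"
  shows "\<exists>C\<ge>0. \<forall>\<kappa> \<beta>. \<bar>\<kappa> * integral {a..b} (\<lambda>u. T u * sin (\<kappa> * u + \<beta>))\<bar> \<le> C"
proof -
  have cT: "continuous_on {a..b} T" using T by (meson DERIV_isCont continuous_at_imp_continuous_on)
  obtain m where m: "\<And>u. u \<in> {a..b} \<Longrightarrow> \<bar>T1 u\<bar> \<le> m"
    using compact_imp_bounded[OF compact_continuous_image[OF T1 compact_Icc]] unfolding bounded_iff by fastforce
  have m0: "m \<ge> 0" using m[of a] ab by auto
  define C where "C = \<bar>T a\<bar> + \<bar>T b\<bar> + m * (b - a)"
  have "\<bar>\<kappa> * integral {a..b} (\<lambda>u. T u * sin (\<kappa> * u + \<beta>))\<bar> \<le> C" for \<kappa> \<beta>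
  proof -
    let ?I = "integral {a..b} (\<lambda>u. T u * sin (\<kappa> * u + \<beta>))"
    let ?J = "integral {a..b} (\<lambda>u. T1 u * cos (\<kappa> * u + \<beta>))"
    \<comment> \<open>One integration by parts trades the factor \<kappa> for boundary terms and an
      integral of \<open>T1\<close>, bounded whatever \<kappa> and \<beta> are. Keeping \<kappa> as
      a factor avoids a case split at 0.\<close>
    have f: "((\<lambda>u. \<kappa> * (T u * sin (\<kappa> * u + \<beta>)) - T1 u * cos (\<kappa> * u + \<beta>)) has_integral
      ((- T b * cos (\<kappa> * b + \<beta>)) - (- T a * cos (\<kappa> * a + \<beta>)))) {a..b}"
      by (rule fundamental_theorem_of_calculus[OF ab])
        (auto intro!: derivative_eq_intros DERIV_subset[OF T]
          simp: has_real_derivative_iff_has_vector_derivative[symmetric] algebra_simps)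
    have i: "(\<lambda>u. T u * sin (\<kappa> * u + \<beta>)) integrable_on {a..b}" "(\<lambda>u. T1 u * cos (\<kappa> * u + \<beta>)) integrable_on {a..b}"
      by (auto intro!: integrable_continuous_interval continuous_intros cT T1)
    have eq: "\<kappa> * ?I = ?J + (T a * cos (\<kappa> * a + \<beta>) - T b * cos (\<kappa> * b + \<beta>))"
      using has_integral_unique[OF f has_integral_diff[OF has_integral_mult_right[OF integrable_integral[OF i(1)]]
        integrable_integral[OF i(2)]]] by linarith
    have "norm ?J \<le> m * (b - a)"
      using ab m by (intro integral_bound) (auto intro!: continuous_intros T1 simp: abs_mult
          intro: order_trans[OF mult_mono[of _ _ _ 1]])
    moreover have c: "\<bar>T c * cos x\<bar> \<le> \<bar>T c\<bar>" for c x
      using mult_left_mono[OF abs_cos_le_one[of x], of "\<bar>T c\<bar>"] by (simp add: abs_mult)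
    ultimately show ?thesis using c[of a "\<kappa> * a + \<beta>"] c[of b "\<kappa> * b + \<beta>"] unfolding eq C_def real_norm_def
      by linarith
  qed
  moreover have "C \<ge> 0" using ab m0 by (simp add: C_def)
  ultimately show ?thesis by blast
qed

text \<open>Integrating in \<open>x\<close> first leaves oscillatory integrals over \<open>u\<close>, whose amplitude \<open>S u / (u * Q - l)\<close> has no pole
  because \<open>l\<close> is outside the dilated support.\<close>

lemma cos_transform_frequency_vanish:
  fixes Q w d :: real
  assumes S: "smooth_profile a b S" and Q: "Q > 0" and l: "l > 0" and out: "\<And>u. u \<in> {a..b} \<Longrightarrow> u * Q \<noteq> l"
  shows "(\<lambda>n. integral {- real n..real n + 1} (\<lambda>x. cos (2 * pi * l * x + \<phi>) * cos_transform S a b (Q * x - d))) \<longlonglongrightarrow> 0"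
proof -
  obtain S1 where S1: "\<And>u. (S has_real_derivative S1 u) (at u)" "continuous_on UNIV S1" and ab: "0 \<le> a" "a \<le> b"
    using S unfolding smooth_profile_def
    by (metis DERIV_isCont continuous_at_imp_continuous_on)
  have cS: "continuous_on A S" for A using smooth_profile_continuous[OF S] .
  \<comment> \<open>Product-to-sum splits the integrand into the frequencies
    \<open>u * Q + l\<close> and \<open>u * Q - l\<close> in \<open>x\<close>; \<epsilon> = 1 or -1
    selects one of them, and \<open>T\<close> is its amplitude after integration in
    \<open>x\<close>.\<close>
  define T where "T \<epsilon> u = S u / (2 * pi * (u * Q + \<epsilon> * l))" for \<epsilon> u
  define J where "J \<epsilon> x = integral {a..b} (\<lambda>u. T \<epsilon> u * sin ((2 * pi * (Q * x - d)) * u + \<epsilon> * (2 * pi * l * x + \<phi>)))" for \<epsilon> x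
  have nz: "u * Q + \<epsilon> * l \<noteq> 0" if "u \<in> {a..b}" "\<epsilon> = 1 \<or> \<epsilon> = -1" for u \<epsilon>
    using out[OF that(1)] that ab l Q mult_nonneg_nonneg[of u Q] by (auto simp del: mult_nonneg_nonneg)
  \<comment> \<open>As a function of \<open>u\<close>, the integrand of \<open>J\<close> at
    \<open>x\<close> oscillates with frequency \<open>2 * pi * (Q * x - d)\<close>, which is
    unbounded in \<open>x\<close>; hence the decay.\<close>
  have J0: "(\<lambda>n. J \<epsilon> (X n)) \<longlonglongrightarrow> 0"
    if \<epsilon>: "\<epsilon> = 1 \<or> \<epsilon> = -1" and X: "filterlim (\<lambda>n. \<bar>X n\<bar>) at_top sequentially" for \<epsilon> and X :: "nat \<Rightarrow> real"
  proof -
    have "\<exists>C\<ge>0. \<forall>\<kappa> \<beta>. \<bar>\<kappa> * integral {a..b} (\<lambda>u. T \<epsilon> u * sin (\<kappa> * u + \<beta>))\<bar> \<le> C"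
    proof (rule oscillatory_integral_bound[OF ab(2)])
      let ?D = "\<lambda>u. 2 * pi * (u * Q + \<epsilon> * l)"
      fix u assume u: "u \<in> {a..b}"
      show "(T \<epsilon> has_real_derivative (S1 u * ?D u - S u * (2 * pi * Q)) / (?D u * ?D u)) (at u)"
        unfolding T_def using nz[OF u \<epsilon>]
        by (auto intro!: derivative_eq_intros S1(1))
    next
      show "continuous_on {a..b} (\<lambda>u. (S1 u * (2 * pi * (u * Q + \<epsilon> * l)) - S u * (2 * pi * Q)) /
          ((2 * pi * (u * Q + \<epsilon> * l)) * (2 * pi * (u * Q + \<epsilon> * l))))"
        using nz[OF _ \<epsilon>] by (intro continuous_intros cS continuous_on_subset[OF S1(2)]) auto
    qed
    then obtain C where C: "C \<ge> 0" "\<And>\<kappa> \<beta>. \<bar>\<kappa> * integral {a..b} (\<lambda>u. T \<epsilon> u * sin (\<kappa> * u + \<beta>))\<bar> \<le> C" by blast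
    have b: "\<bar>2 * pi * (Q * X n - d)\<bar> * \<bar>J \<epsilon> (X n)\<bar> \<le> C" for n
      using C(2)[of "2 * pi * (Q * X n - d)"] unfolding J_def abs_mult[symmetric] by blast
    have "filterlim (\<lambda>n. 2 * pi * Q * \<bar>X n\<bar> - 2 * pi * \<bar>d\<bar>) at_top sequentially"
      unfolding diff_conv_add_uminus using Q
      by (subst add.commute) (intro filterlim_tendsto_add_at_top[OF tendsto_const] filterlim_tendsto_pos_mult_at_top[OF tendsto_const _ X], auto)
    then have lim: "(\<lambda>n. C / (2 * pi * Q * \<bar>X n\<bar> - 2 * pi * \<bar>d\<bar>)) \<longlonglongrightarrow> 0"
      by (intro tendsto_divide_0[OF tendsto_const] filterlim_at_top_imp_at_infinity)
    have "eventually (\<lambda>n. 2 * pi * Q * \<bar>X n\<bar> - 2 * pi * \<bar>d\<bar> > 0) sequentially"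
      using \<open>filterlim (\<lambda>n. 2 * pi * Q * \<bar>X n\<bar> - 2 * pi * \<bar>d\<bar>) at_top sequentially\<close>
      by (rule filterlim_at_top_dense[THEN iffD1, rule_format])
    then have "eventually (\<lambda>n. norm (J \<epsilon> (X n)) \<le> C / (2 * pi * Q * \<bar>X n\<bar> - 2 * pi * \<bar>d\<bar>)) sequentially"
    proof eventually_elim
      case (elim n)
      have "2 * pi * Q * \<bar>X n\<bar> - 2 * pi * \<bar>d\<bar> \<le> \<bar>2 * pi * (Q * X n - d)\<bar>"
      proof -
        have "Q * \<bar>X n\<bar> - \<bar>d\<bar> \<le> \<bar>Q * X n - d\<bar>" using abs_triangle_ineq2[of "Q * X n" d] Q by (simp add: abs_mult)
        then have "2 * pi * (Q * \<bar>X n\<bar> - \<bar>d\<bar>) \<le> 2 * pi * \<bar>Q * X n - d\<bar>" by (intro mult_left_mono) auto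
        also have "2 * pi * \<bar>Q * X n - d\<bar> = \<bar>2 * pi * (Q * X n - d)\<bar>" by (simp only: abs_mult) simp
        finally show ?thesis by (simp only: right_diff_distrib mult.assoc)
      qed
      then have "(2 * pi * Q * \<bar>X n\<bar> - 2 * pi * \<bar>d\<bar>) * \<bar>J \<epsilon> (X n)\<bar> \<le> C"
        by (rule order_trans[OF mult_right_mono[OF _ abs_ge_zero] b])
      then show ?case using elim by (simp add: pos_le_divide_eq mult.commute)
    qed
    then show ?thesis by (rule Lim_null_comparison[OF _ lim])
  qed
  have main: "integral {A..B} (\<lambda>x. cos (2 * pi * l * x + \<phi>) * cos_transform S a b (Q * x - d)) =
      (J 1 B + J (-1) B) - (J 1 A + J (-1) A)" if AB: "A \<le> B" for A B
  proof -
    let ?f = "\<lambda>x u. 2 * (cos (2 * pi * l * x + \<phi>) * (S u * cos (2 * pi * u * (Q * x - d))))"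
    have c: "continuous_on (cbox (A, a) (B, b)) (\<lambda>(x, u). ?f x u)"
    proof -
      have "continuous_on (cbox (A, a) (B, b)) (\<lambda>p :: real \<times> real. S (snd p))"
        by (rule continuous_on_compose2[OF cS[of UNIV]]) (auto intro!: continuous_intros)
      then show ?thesis unfolding case_prod_unfold by (intro continuous_intros)
    qed
    have "integral {A..B} (\<lambda>x. cos (2 * pi * l * x + \<phi>) * cos_transform S a b (Q * x - d)) =
        integral {A..B} (\<lambda>x. integral {a..b} (?f x))"
    proof (rule Henstock_Kurzweil_Integration.integral_cong)
      fix x
      show "cos (2 * pi * l * x + \<phi>) * cos_transform S a b (Q * x - d) = integral {a..b} (?f x)"
        by (simp only: cos_transform_def integral_mult_right)
    qed
    also have "\<dots> = integral {a..b} (\<lambda>u. integral {A..B} (\<lambda>x. ?f x u))"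
      using integral_swap_continuous[OF c] by (simp add: cbox_interval)
    also have "\<dots> = integral {a..b} (\<lambda>u.
       (T 1 u * sin ((2 * pi * (Q * B - d)) * u + 1 * (2 * pi * l * B + \<phi>)) +
        T (-1) u * sin ((2 * pi * (Q * B - d)) * u + (-1) * (2 * pi * l * B + \<phi>))) -
       (T 1 u * sin ((2 * pi * (Q * A - d)) * u + 1 * (2 * pi * l * A + \<phi>)) +
        T (-1) u * sin ((2 * pi * (Q * A - d)) * u + (-1) * (2 * pi * l * A + \<phi>))))"
    proof (rule Henstock_Kurzweil_Integration.integral_cong)
      fix u assume u: "u \<in> {a..b}"
      let ?a = "2 * pi * (u * Q + 1 * l)" and ?b = "2 * pi * (u * Q + (-1) * l)"
      have ab0: "?a \<noteq> 0" "?b \<noteq> 0" using nz[OF u, of 1] nz[OF u, of "-1"] by auto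
      have e: "?f x u = S u / ?a * (cos ((2 * pi * (Q * x - d)) * u + 1 * (2 * pi * l * x + \<phi>)) * ?a) +
           S u / ?b * (cos ((2 * pi * (Q * x - d)) * u + (-1) * (2 * pi * l * x + \<phi>)) * ?b)" for x
      proof -
        have k: "\<And>D c. D \<noteq> 0 \<Longrightarrow> S u / D * (c * D) = S u * c" by simp
        have t: "\<And>X Y. 2 * (cos Y * (S u * cos X)) = S u * (cos (X + 1 * Y) + cos (X + (-1) * Y))"
          by (simp add: cos_add cos_diff algebra_simps)
        have "2 * pi * u * (Q * x - d) = (2 * pi * (Q * x - d)) * u" by simp
        then have "?f x u = S u * (cos ((2 * pi * (Q * x - d)) * u + 1 * (2 * pi * l * x + \<phi>)) + cos ((2 * pi * (Q * x - d)) * u + (-1) * (2 * pi * l * x + \<phi>)))"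
          by (simp only: t)
        then show ?thesis unfolding k[OF ab0(1)] k[OF ab0(2)] by (simp only: distrib_left)
      qed
      have ds: "((\<lambda>x. sin ((2 * pi * (Q * x - d)) * u + \<epsilon> * (2 * pi * l * x + \<phi>))) has_real_derivative
          cos ((2 * pi * (Q * x - d)) * u + \<epsilon> * (2 * pi * l * x + \<phi>)) * (2 * pi * (u * Q + \<epsilon> * l))) (at x within X)" for \<epsilon> x X
        by (auto intro!: derivative_eq_intros simp: algebra_simps)
      have "((\<lambda>x. ?f x u) has_integral
        (S u / ?a * sin ((2 * pi * (Q * B - d)) * u + 1 * (2 * pi * l * B + \<phi>)) +
         S u / ?b * sin ((2 * pi * (Q * B - d)) * u + (-1) * (2 * pi * l * B + \<phi>))) -
        (S u / ?a * sin ((2 * pi * (Q * A - d)) * u + 1 * (2 * pi * l * A + \<phi>)) +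
         S u / ?b * sin ((2 * pi * (Q * A - d)) * u + (-1) * (2 * pi * l * A + \<phi>)))) {A..B}"
        unfolding e
        by (rule fundamental_theorem_of_calculus[OF AB],
            unfold has_real_derivative_iff_has_vector_derivative[symmetric])
          (intro DERIV_add DERIV_cmult ds)
      then show "integral {A..B} (\<lambda>x. ?f x u) =
       (T 1 u * sin ((2 * pi * (Q * B - d)) * u + 1 * (2 * pi * l * B + \<phi>)) +
        T (-1) u * sin ((2 * pi * (Q * B - d)) * u + (-1) * (2 * pi * l * B + \<phi>))) -
       (T 1 u * sin ((2 * pi * (Q * A - d)) * u + 1 * (2 * pi * l * A + \<phi>)) +
        T (-1) u * sin ((2 * pi * (Q * A - d)) * u + (-1) * (2 * pi * l * A + \<phi>)))"
        unfolding T_def by (rule integral_unique)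
    qed
    also have "\<dots> = (J 1 B + J (-1) B) - (J 1 A + J (-1) A)"
    proof -
      have "continuous_on {a..b} (T 1)" "continuous_on {a..b} (T (-1))"
        unfolding T_def using nz[of _ 1] nz[of _ "-1"] by (intro continuous_intros cS; simp)+
      then have i: "(\<lambda>u. T 1 u * sin (\<kappa> * u + \<beta>)) integrable_on {a..b}"
         "(\<lambda>u. T (-1) u * sin (\<kappa> * u + \<beta>)) integrable_on {a..b}" for \<kappa> \<beta>
        by (auto intro!: integrable_continuous_interval continuous_intros)
      show ?thesis unfolding J_def
        by (intro integral_unique has_integral_add has_integral_diff integrable_integral i)
    qed
    finally show ?thesis .
  qed
  have f1: "filterlim (\<lambda>n. \<bar>real n + 1\<bar>) at_top sequentially" and f2: "filterlim (\<lambda>n. \<bar>- real n\<bar>) at_top sequentially"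
    using filterlim_real_sequentially
    by (auto simp: add.commute intro!: filterlim_tendsto_add_at_top[OF tendsto_const])
  have "(\<lambda>n. (J 1 (real n + 1) + J (-1) (real n + 1)) - (J 1 (- real n) + J (-1) (- real n))) \<longlonglongrightarrow> (0 + 0) - (0 + 0)"
    by (intro tendsto_intros J0 f1 f2) auto
  then show ?thesis using main by simp
qed

section \<open>Periodization\<close>

lemma finite_int_bounded:
  fixes F :: "int set"
  assumes "finite F"
  obtains B where "\<And>x. x \<in> F \<Longrightarrow> \<bar>x\<bar> \<le> B"
  using assms by (meson Max_ge finite_imageI imageI)

text \<open>Each term is at most three times the increment of arctan over the unit interval starting
  at \<open>y + m\<close>, and these increments telescope to at most pi.\<close>

lemma sum_inverse_quadratic_le:
  fixes F :: "int set" and y :: real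
  assumes "finite F"
  shows "(\<Sum>m\<in>F. 1 / (1 + (y + of_int m)\<^sup>2)) \<le> 3 * pi"
proof -
  define h where "h m = arctan (y + of_int m + 1) - arctan (y + of_int m)" for m :: int
  have h0: "h m \<ge> 0" for m by (simp add: h_def arctan_le_iff)
  have le: "1 / (1 + (y + of_int m)\<^sup>2) \<le> 3 * h m" for m
  proof -
    define t where "t = y + of_int m"
    obtain z where z: "t < z" "z < t + 1" "arctan (t + 1) - arctan t = (t + 1 - t) * inverse (1 + z\<^sup>2)"
      using MVT2[of t "t + 1" arctan "\<lambda>x. inverse (1 + x\<^sup>2)"] DERIV_arctan by auto
    have "z\<^sup>2 \<le> 2 * t\<^sup>2 + 2"
    proof -
      have "(z - t)\<^sup>2 \<le> 1" using z by (simp add: power2_eq_square mult_le_one)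
      moreover have "z\<^sup>2 \<le> 2 * t\<^sup>2 + 2 * (z - t)\<^sup>2"
        using zero_le_power2[of "z - 2 * t"] by (simp add: power2_eq_square algebra_simps)
      ultimately show ?thesis by simp
    qed
    moreover have "3 * (1 + t\<^sup>2) = 3 + 2 * t\<^sup>2 + t\<^sup>2" by simp
    ultimately have "1 + z\<^sup>2 \<le> 3 * (1 + t\<^sup>2)" using zero_le_power2[of t] by linarith
    moreover have "1 + z\<^sup>2 > 0" "1 + t\<^sup>2 > 0" by (auto intro: add_pos_nonneg)
    ultimately have "1 / (1 + t\<^sup>2) \<le> 3 * inverse (1 + z\<^sup>2)" by (simp add: field_simps)
    then show ?thesis using z(3) by (simp add: h_def t_def)
  qed
  obtain M :: nat where M: "F \<subseteq> {- int M..<int M}"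
  proof -
    obtain B where B: "\<And>x. x \<in> F \<Longrightarrow> \<bar>x\<bar> \<le> B" using finite_int_bounded[OF assms] by blast
    show thesis by (rule that[of "nat B + 1"]) (use B in force)
  qed
  have "(\<Sum>m\<in>F. 1 / (1 + (y + of_int m)\<^sup>2)) \<le> (\<Sum>m\<in>F. 3 * h m)" by (intro sum_mono le)
  also have "\<dots> \<le> (\<Sum>m\<in>{- int M..<int M}. 3 * h m)"
    using M h0 by (intro sum_mono2) auto
  also have "\<dots> = 3 * (\<Sum>i<2 * M. h (int i - int M))"
    unfolding sum_distrib_left
    by (rule sum.reindex_bij_witness[of _ "\<lambda>i. int i - int M" "\<lambda>m. nat (m + int M)"]) auto
  also have "(\<Sum>i<2 * M. h (int i - int M)) =
      (\<Sum>i<2 * M. (\<lambda>i. arctan (y + real i - real M)) (Suc i) - (\<lambda>i. arctan (y + real i - real M)) i)"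
    by (simp add: h_def algebra_simps)
  also have "\<dots> = arctan (y + real (2 * M) - real M) - arctan (y + real 0 - real M)"
    by (subst sum_lessThan_telescope) simp
  also have "\<dots> \<le> pi" using arctan_bounded by (smt (verit) field_sum_of_halves)
  finally show ?thesis by simp
qed

lemma integral_inverse_quadratic_le:
  fixes Q d A B :: real
  assumes Q: "Q > 0" and AB: "A \<le> B"
  shows "integral {A..B} (\<lambda>x. 1 / (1 + (Q * x - d)\<^sup>2)) \<le> pi / Q"
proof -
  have "((\<lambda>x. 1 / (1 + (Q * x - d)\<^sup>2)) has_integral (arctan (Q * B - d) / Q - arctan (Q * A - d) / Q)) {A..B}"
    using Q by (intro fundamental_theorem_of_calculus[OF AB])
      (auto intro!: derivative_eq_intros
          simp: has_real_derivative_iff_has_vector_derivative[symmetric] inverse_eq_divide)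
  then have "integral {A..B} (\<lambda>x. 1 / (1 + (Q * x - d)\<^sup>2)) = (arctan (Q * B - d) - arctan (Q * A - d)) / Q"
    by (simp add: integral_unique diff_divide_distrib)
  also have "\<dots> \<le> pi / Q"
    using Q arctan_bounded[of "Q * B - d"] arctan_bounded[of "Q * A - d"] by (intro divide_right_mono) linarith+
  finally show ?thesis .
qed

lemma periodic_int:
  fixes f :: "real \<Rightarrow> real"
  assumes "\<And>x. f (x + 1) = f x"
  shows "f (x + of_int l) = f x"
proof (induction l arbitrary: x rule: int_induct[where k=0])
  case (step1 i)
  then show ?case using assms[of "x + of_int i"] by (simp add: add.assoc)
next
  case (step2 i)
  then show ?case using assms[of "x + of_int (i - 1)"] by (simp add: add.assoc)
qed simp

text \<open>\<open>Q\<close> is a natural number so that integer translates of \<open>x\<close> move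
  \<open>Q * x - d\<close> by integers, which is what \<open>sum_inverse_quadratic_le\<close> sums.
  Meyer wavelets of scale \<open>i\<close> fit with \<open>Q = 2 ^ i\<close>.\<close>

locale decaying =
  fixes g :: "real \<Rightarrow> real" and Q :: nat and d C :: real
  assumes cg: "continuous_on UNIV g" and Q: "Q \<ge> 1"
    and decay: "\<And>x. \<bar>g x\<bar> \<le> C / (1 + (real Q * x - d)\<^sup>2)"
begin

lemma C0: "C \<ge> 0"
  using decay[of "d / real Q"] Q by simp

lemma sum_translates_le:
  assumes "finite F"
  shows "(\<Sum>l\<in>F. \<bar>g (x + of_int l)\<bar>) \<le> 3 * pi * C"
proof -
  have "(\<Sum>l\<in>F. \<bar>g (x + of_int l)\<bar>) \<le> (\<Sum>l\<in>F. C * (1 / (1 + ((real Q * x - d) + of_int (int Q * l))\<^sup>2)))"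
  proof (rule sum_mono)
    fix l
    show "\<bar>g (x + of_int l)\<bar> \<le> C * (1 / (1 + ((real Q * x - d) + of_int (int Q * l))\<^sup>2))"
      using decay[of "x + of_int l"] by (simp add: algebra_simps)
  qed
  also have "\<dots> = C * (\<Sum>m\<in>(\<lambda>l. int Q * l) ` F. 1 / (1 + ((real Q * x - d) + of_int m)\<^sup>2))"
    using Q by (subst sum.reindex) (auto simp: inj_on_def sum_distrib_left)
  also have "\<dots> \<le> C * (3 * pi)"
    using C0 assms by (intro mult_left_mono sum_inverse_quadratic_le) auto
  finally show ?thesis by (simp add: mult.commute)
qed

text \<open>Continuous, uniformly bounded approximations of \<open>periodize g\<close>: integrals
  are evaluated for them and carried over to the limit.\<close>

definition partial :: "nat \<Rightarrow> real \<Rightarrow> real" where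
  "partial n x = (\<Sum>l\<in>{- int n..int n}. g (x + of_int l))"

lemma continuous_partial: "continuous_on A (partial n)"
  unfolding partial_def by (intro continuous_intros continuous_on_compose2[OF cg]) auto

lemma partial_bound: "\<bar>partial n x\<bar> \<le> 3 * pi * C"
  unfolding partial_def by (rule order_trans[OF sum_abs sum_translates_le]) simp

lemma partial_tendsto: "(\<lambda>n. partial n x) \<longlonglongrightarrow> periodize g x"
proof -
  have "(\<lambda>l::int. norm (g (x + of_int l))) summable_on UNIV"
    by (rule nonneg_bdd_above_summable_on)
      (auto intro!: bdd_aboveI2[where M="3 * pi * C"] sum_translates_le)
  then have "(\<lambda>l::int. g (x + of_int l)) summable_on UNIV"
    by (rule abs_summable_summable)
  then have "(sum (\<lambda>l::int. g (x + of_int l)) \<longlongrightarrow> periodize g x) (finite_subsets_at_top UNIV)"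
    unfolding periodize_def using has_sum_infsum by (simp add: has_sum_def)
  moreover have "filterlim (\<lambda>n. {- int n..int n}) (finite_subsets_at_top UNIV) sequentially"
    unfolding filterlim_finite_subsets_at_top
  proof (intro allI impI)
    fix X :: "int set" assume "finite X \<and> X \<subseteq> UNIV"
    then obtain B where B: "\<And>x. x \<in> X \<Longrightarrow> \<bar>x\<bar> \<le> B" using finite_int_bounded by blast
    show "eventually (\<lambda>n. finite {- int n..int n} \<and> X \<subseteq> {- int n..int n} \<and> {- int n..int n} \<subseteq> UNIV) sequentially"
      using eventually_ge_at_top[of "nat B"] by eventually_elim (use B in force)
  qed
  ultimately show ?thesis unfolding partial_def by (rule filterlim_compose)
qed

lemma integral_partial_tendsto:
  assumes cf: "continuous_on UNIV f"
  shows "(\<lambda>n. integral {0..1} (\<lambda>x. f x * partial n x)) \<longlonglongrightarrow> (LINT x:{0..1}|lborel. f x * periodize g x)"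
proof -
  have cf': "continuous_on A f" for A using cf by (rule continuous_on_subset) auto
  obtain m where m: "\<And>x. x \<in> {0..1} \<Longrightarrow> \<bar>f x\<bar> \<le> m"
    using compact_imp_bounded[OF compact_continuous_image[OF cf'[of "{0..1}"] compact_Icc]] unfolding bounded_iff by fastforce
  have [measurable]: "f \<in> borel_measurable borel" "partial n \<in> borel_measurable borel" for n
    using cf continuous_partial by (auto intro: borel_measurable_continuous_onI)
  have [measurable]: "periodize g \<in> borel_measurable borel"
    by (rule borel_measurable_LIMSEQ_real[OF partial_tendsto]) auto
  have "(\<lambda>n. LINT x:{0..1}|lborel. f x * partial n x) \<longlonglongrightarrow> (LINT x:{0..1}|lborel. f x * periodize g x)"
    unfolding set_lebesgue_integral_def
  proof (rule integral_dominated_convergence[where w="\<lambda>x. indicator {0..1} x * (m * (3 * pi * C))"])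
    show "integrable lborel (\<lambda>x :: real. indicator {0..1} x * (m * (3 * pi * C)))"
      by (intro integrable_mult_left integrable_real_indicator) auto
    show "AE x in lborel. (\<lambda>n. indicator {0..1} x *\<^sub>R (f x * partial n x)) \<longlonglongrightarrow> indicator {0..1} x *\<^sub>R (f x * periodize g x)"
      by (intro AE_I2 tendsto_intros partial_tendsto)
    fix n
    show "AE x in lborel. norm (indicator {0..1} x *\<^sub>R (f x * partial n x)) \<le> indicator {0..1} x * (m * (3 * pi * C))"
    proof (rule AE_I2)
      fix x
      show "norm (indicator {0..1} x *\<^sub>R (f x * partial n x)) \<le> indicator {0..1} x * (m * (3 * pi * C))"
        using mult_mono[OF m partial_bound[of n x]] m[of x] by (cases "x \<in> {0..1}") (auto simp: abs_mult)
    qed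
  qed auto
  moreover have "(LINT x:{0..1}|lborel. f x * partial n x) = integral {0..1} (\<lambda>x. f x * partial n x)" for n
    by (intro set_borel_integral_eq_integral borel_integrable_atLeastAtMost' continuous_intros cf' continuous_partial)
  ultimately show ?thesis by simp
qed

text \<open>Periodicity of \<open>f\<close> glues the translates over the unit interval into one
  integral over \<open>2 * n + 1\<close> consecutive unit intervals.\<close>

lemma integral_partial_eq:
  assumes cf: "continuous_on UNIV f" and per: "\<And>x. f (x + 1) = f x"
  shows "integral {0..1} (\<lambda>x. f x * partial n x) = integral {- real n..real n + 1} (\<lambda>x. f x * g x)"
proof -
  have c: "continuous_on A f" "continuous_on A g" for A using cf cg by (auto intro: continuous_on_subset)
  have i: "(\<lambda>x. f x * g x) integrable_on {a..b}" for a b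
    by (intro integrable_continuous_interval continuous_intros c)
  have "integral {0..1} (\<lambda>x. f x * partial n x) = (\<Sum>l\<in>{- int n..int n}. integral {0..1} (\<lambda>x. f x * g (x + of_int l)))"
    unfolding partial_def sum_distrib_left
    by (intro integral_sum integrable_continuous_interval continuous_intros c continuous_on_compose2[OF cg]) auto
  also have "\<dots> = (\<Sum>l\<in>{- int n..int n}. integral {of_int l..of_int l + 1} (\<lambda>x. f x * g x))"
  proof (rule sum.cong[OF refl])
    fix l :: int
    have "(\<lambda>x. f x * g x) \<circ> ((+) (of_int l)) = (\<lambda>x. f x * g (x + of_int l))"
      using periodic_int[where f=f, OF per] by (simp add: fun_eq_iff add.commute)
    then show "integral {0..1} (\<lambda>x. f x * g (x + of_int l)) = integral {of_int l..of_int l + 1} (\<lambda>x. f x * g x)"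
      using integral_shift_Icc_real[of 0 1 "\<lambda>x. f x * g x" "of_int l"] by (simp add: add.commute)
  qed
  also have "\<dots> = integral {- real n..real n + 1} (\<lambda>x. f x * g x)"
  proof (induction n)
    case (Suc n)
    have e: "{- int (Suc n)..int (Suc n)} = insert (int n + 1) (insert (- int n - 1) {- int n..int n})" by auto
    have "(\<Sum>l\<in>{- int (Suc n)..int (Suc n)}. integral {of_int l..of_int l + 1} (\<lambda>x. f x * g x)) =
      integral {real n + 1..real n + 2} (\<lambda>x. f x * g x) + (integral {- real n - 1..- real n} (\<lambda>x. f x * g x) + integral {- real n..real n + 1} (\<lambda>x. f x * g x))"
      unfolding e using Suc by (simp add: algebra_simps)
    also have "integral {- real n - 1..- real n} (\<lambda>x. f x * g x) + integral {- real n..real n + 1} (\<lambda>x. f x * g x) =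
       integral {- real n - 1..real n + 1} (\<lambda>x. f x * g x)"
      by (intro Henstock_Kurzweil_Integration.integral_combine i) auto
    also have "integral {real n + 1..real n + 2} (\<lambda>x. f x * g x) + integral {- real n - 1..real n + 1} (\<lambda>x. f x * g x) =
      integral {- real n - 1..real n + 2} (\<lambda>x. f x * g x)"
      by (subst add.commute) (intro Henstock_Kurzweil_Integration.integral_combine i, auto)
    also have "\<dots> = integral {- real (Suc n)..real (Suc n) + 1} (\<lambda>x. f x * g x)"
    proof -
      have "- real n - 1 = - real (Suc n)" "real n + 2 = real (Suc n) + 1" by auto
      then show ?thesis by (simp only:)
    qed
    finally show ?case .
  qed simp
  finally show ?thesis .
qed

text \<open>Sup norm of \<open>f\<close> times the integral over the line of the majorant of
  \<open>g\<close>.\<close>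

lemma coefficient_bound:
  assumes cf: "continuous_on UNIV f" and per: "\<And>x. f (x + 1) = f x" and b: "\<And>x. \<bar>f x\<bar> \<le> m"
  shows "\<bar>LINT x:{0..1}|lborel. f x * periodize g x\<bar> \<le> m * (C * pi / real Q)"
proof -
  have c: "continuous_on A f" "continuous_on A g" for A using cf cg by (auto intro: continuous_on_subset)
  have m0: "m \<ge> 0" using b[of 0] by linarith
  have "norm (integral {0..1} (\<lambda>x. f x * partial n x)) \<le> m * (C * pi / real Q)" for n
  proof -
    have nz: "1 + (real Q * x - d)\<^sup>2 \<noteq> 0" for x
      using add_pos_nonneg[OF zero_less_one zero_le_power2[of "real Q * x - d"]] by linarith
    have "norm (integral {- real n..real n + 1} (\<lambda>x. f x * g x)) \<le>
        integral {- real n..real n + 1} (\<lambda>x. m * (C * (1 / (1 + (real Q * x - d)\<^sup>2))))"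
    proof (rule integral_norm_bound_integral)
      fix x assume "x \<in> {- real n..real n + 1}"
      show "norm (f x * g x) \<le> m * (C * (1 / (1 + (real Q * x - d)\<^sup>2)))"
        using mult_mono[OF b[of x] decay[of x]] m0 by (simp add: abs_mult)
    qed (use nz in \<open>auto intro!: integrable_continuous_interval continuous_intros c\<close>)
    also have "\<dots> = m * (C * integral {- real n..real n + 1} (\<lambda>x. 1 / (1 + (real Q * x - d)\<^sup>2)))"
      by (simp only: integral_mult_right)
    also have "\<dots> \<le> m * (C * (pi / real Q))"
      using m0 C0 Q by (intro mult_left_mono integral_inverse_quadratic_le) auto
    finally show ?thesis using integral_partial_eq[OF cf per] by simp
  qed
  then have "norm (LINT x:{0..1}|lborel. f x * periodize g x) \<le> m * (C * pi / real Q)"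
    by (intro LIMSEQ_le_const2[OF tendsto_norm[OF integral_partial_tendsto[OF cf]]]) auto
  then show ?thesis by simp
qed

end

text \<open>The \<open>L^1\<close> counterpart of \<open>coefficient_bound\<close>. Summing over
  \<open>k\<close> under the integral, the shifts \<open>Q * l - k\<close> with
  \<open>0 \<le> k < Q\<close> are distinct integers, so the translates of all \<open>g k\<close>
  together stay below \<open>3 * pi * C\<close> at each point.\<close>

lemma sum_coefficients_le:
  fixes g :: "int \<Rightarrow> real \<Rightarrow> real" and Q :: nat and c C :: real
  assumes dec: "\<And>k. decaying (g k) Q (of_int k - c) C" and cf: "continuous_on UNIV f"
  shows "(\<Sum>k\<in>{0..<int Q}. \<bar>LINT x:{0..1}|lborel. f x * periodize (g k) x\<bar>) \<le> 3 * pi * C * integral {0..1} (\<lambda>x. \<bar>f x\<bar>)"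
proof -
  have cf': "continuous_on A f" for A using cf by (rule continuous_on_subset) auto
  have C0: "C \<ge> 0" and Q: "Q \<ge> 1" using decaying.C0[OF dec[of 0]] decaying.Q[OF dec[of 0]] by auto
  let ?s = "\<lambda>k. decaying.partial (g k)"
  have cs: "continuous_on A (?s k n)" for A k n by (rule decaying.continuous_partial[OF dec])
  have "(\<Sum>k\<in>{0..<int Q}. \<bar>integral {0..1} (\<lambda>x. f x * ?s k n x)\<bar>) \<le> 3 * pi * C * integral {0..1} (\<lambda>x. \<bar>f x\<bar>)" for n
  proof -
    have b: "(\<Sum>k\<in>{0..<int Q}. \<bar>?s k n x\<bar>) \<le> 3 * pi * C" for x
    proof -
      have "(\<Sum>k\<in>{0..<int Q}. \<bar>?s k n x\<bar>) \<le> (\<Sum>k\<in>{0..<int Q}. \<Sum>l\<in>{- int n..int n}. \<bar>g k (x + of_int l)\<bar>)"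
        unfolding decaying.partial_def[OF dec] by (intro sum_mono sum_abs)
      also have "\<dots> \<le> (\<Sum>k\<in>{0..<int Q}. \<Sum>l\<in>{- int n..int n}. C * (1 / (1 + ((real Q * x + c) + of_int (int Q * l - k))\<^sup>2)))"
      proof (intro sum_mono)
        fix k l
        show "\<bar>g k (x + of_int l)\<bar> \<le> C * (1 / (1 + ((real Q * x + c) + of_int (int Q * l - k))\<^sup>2))"
          using decaying.decay[OF dec, of k "x + of_int l"] by (simp add: algebra_simps)
      qed
      also have "\<dots> = C * (\<Sum>p\<in>{0..<int Q} \<times> {- int n..int n}. 1 / (1 + ((real Q * x + c) + of_int (int Q * snd p - fst p))\<^sup>2))"
        by (simp add: sum_distrib_left sum.cartesian_product case_prod_unfold)
      also have "(\<Sum>p\<in>{0..<int Q} \<times> {- int n..int n}. 1 / (1 + ((real Q * x + c) + of_int (int Q * snd p - fst p))\<^sup>2)) =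
          (\<Sum>m\<in>(\<lambda>p. int Q * snd p - fst p) ` ({0..<int Q} \<times> {- int n..int n}). 1 / (1 + ((real Q * x + c) + of_int m)\<^sup>2))"
      proof (subst sum.reindex)
        show "inj_on (\<lambda>p. int Q * snd p - fst p) ({0..<int Q} \<times> {- int n..int n})"
        proof (rule inj_onI)
          fix p q assume p: "p \<in> {0..<int Q} \<times> {- int n..int n}" and q: "q \<in> {0..<int Q} \<times> {- int n..int n}"
            and e: "int Q * snd p - fst p = int Q * snd q - fst q"
          \<comment> \<open>The residue modulo \<open>Q\<close> recovers the first
            component.\<close>
          have "(- (int Q * snd p - fst p)) mod int Q = fst p" "(- (int Q * snd q - fst q)) mod int Q = fst q"
            using p q by (auto simp: mod_simps algebra_simps mod_diff_right_eq[symmetric])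
          then have "fst p = fst q" using e by simp
          with e Q show "p = q" by (simp add: prod_eq_iff)
        qed
      qed simp
      also have "C * \<dots> \<le> C * (3 * pi)"
        using C0 by (intro mult_left_mono sum_inverse_quadratic_le) auto
      finally show ?thesis by (simp add: mult.commute)
    qed
    have "(\<Sum>k\<in>{0..<int Q}. \<bar>integral {0..1} (\<lambda>x. f x * ?s k n x)\<bar>) \<le>
        (\<Sum>k\<in>{0..<int Q}. integral {0..1} (\<lambda>x. \<bar>f x\<bar> * \<bar>?s k n x\<bar>))"
    proof (rule sum_mono)
      fix k
      have "norm (integral {0..1} (\<lambda>x. f x * ?s k n x)) \<le> integral {0..1} (\<lambda>x. \<bar>f x\<bar> * \<bar>?s k n x\<bar>)"
        by (rule integral_norm_bound_integral)
          (auto intro!: integrable_continuous_interval continuous_intros cf' cs simp: abs_mult)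
      then show "\<bar>integral {0..1} (\<lambda>x. f x * ?s k n x)\<bar> \<le> integral {0..1} (\<lambda>x. \<bar>f x\<bar> * \<bar>?s k n x\<bar>)" by simp
    qed
    also have "\<dots> = integral {0..1} (\<lambda>x. \<bar>f x\<bar> * (\<Sum>k\<in>{0..<int Q}. \<bar>?s k n x\<bar>))"
      unfolding sum_distrib_left
      by (intro integral_sum[symmetric] integrable_continuous_interval continuous_intros cf' cs) auto
    also have "\<dots> \<le> integral {0..1} (\<lambda>x. \<bar>f x\<bar> * (3 * pi * C))"
      by (intro integral_le integrable_continuous_interval continuous_intros cf' cs mult_left_mono b) auto
    also have "\<dots> = 3 * pi * C * integral {0..1} (\<lambda>x. \<bar>f x\<bar>)"
      by (simp only: integral_mult_left mult.commute)
    finally show ?thesis .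
  qed
  moreover have "(\<lambda>n. \<Sum>k\<in>{0..<int Q}. \<bar>integral {0..1} (\<lambda>x. f x * ?s k n x)\<bar>) \<longlonglongrightarrow>
      (\<Sum>k\<in>{0..<int Q}. \<bar>LINT x:{0..1}|lborel. f x * periodize (g k) x\<bar>)"
    by (intro tendsto_intros decaying.integral_partial_tendsto[OF dec cf])
  ultimately show ?thesis by (intro LIMSEQ_le_const2) auto
qed

section \<open>Besov norms of trigonometric polynomials\<close>

definition trig_poly :: "nat set \<Rightarrow> (nat \<Rightarrow> real) \<Rightarrow> (nat \<Rightarrow> real) \<Rightarrow> real \<Rightarrow> real" where
  "trig_poly L A B x = (\<Sum>l\<in>L. A l * cos (2 * pi * real l * x) + B l * sin (2 * pi * real l * x))"

lemma continuous_trig_poly: "continuous_on X (trig_poly L A B)"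
  unfolding trig_poly_def by (intro continuous_intros)

lemma trig_poly_periodic: "trig_poly L A B (x + 1) = trig_poly L A B x"
proof -
  have "cos (2 * pi * real l * (x + 1)) = cos (2 * pi * real l * x)" "sin (2 * pi * real l * (x + 1)) = sin (2 * pi * real l * x)" for l
  proof -
    have e: "2 * pi * real l * (x + 1) = 2 * pi * real l * x + 2 * real l * pi" by (simp add: algebra_simps)
    have "cos (2 * real l * pi) = 1" "sin (2 * real l * pi) = 0"
      using cos_2npi[of l] sin_2npi[of l] by (simp_all add: mult.commute mult.left_commute)
    then show "cos (2 * pi * real l * (x + 1)) = cos (2 * pi * real l * x)" "sin (2 * pi * real l * (x + 1)) = sin (2 * pi * real l * x)"
      unfolding e cos_add sin_add by simp_all
  qed
  then show ?thesis by (simp add: trig_poly_def)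
qed

text \<open>Unfolded over the line by periodicity, each frequency contributes an integral tending to
  0, as it lies outside the dilated support of the transform of \<open>g\<close>. Sines are treated
  as cosines with phase \<open>- pi / 2\<close>.\<close>

lemma trig_poly_coefficient_vanish:
  assumes dec: "decaying g Q d C" and S: "smooth_profile a b S"
    and g: "\<And>x. g x = E * cos_transform S a b (real Q * x - d)"
    and L: "\<And>l. l \<in> L \<Longrightarrow> l > 0" and out: "\<And>l u. l \<in> L \<Longrightarrow> u \<in> {a..b} \<Longrightarrow> u * real Q \<noteq> real l"
  shows "(LINT x:{0..1}|lborel. trig_poly L A B x * periodize g x) = 0"
proof -
  interpret decaying g Q d C by fact
  let ?P = "\<lambda>x. cos_transform S a b (real Q * x - d)"
  have cP: "continuous_on X ?P" for X
    by (rule continuous_on_compose2[OF continuous_cos_transform[OF smooth_profile_continuous[OF S]]])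
      (auto intro!: continuous_intros)
  have lim: "(\<lambda>n. integral {- real n..real n + 1} (\<lambda>x. cos (2 * pi * real l * x + \<phi>) * ?P x)) \<longlonglongrightarrow> 0" if "l \<in> L" for l \<phi>
    using cos_transform_frequency_vanish[OF S, of "real Q" "real l" \<phi> d] Q L[OF that] out[OF that] by auto
  have e: "trig_poly L A B x * g x = (\<Sum>l\<in>L. E * A l * (cos (2 * pi * real l * x + 0) * ?P x) + E * B l * (cos (2 * pi * real l * x + (- pi / 2)) * ?P x))" for x
  proof -
    have "cos (y + (- pi / 2)) = sin y" for y by (simp add: cos_diff)
    then show ?thesis by (simp add: trig_poly_def g sum_distrib_right sum_distrib_left algebra_simps)
  qed
  have "integral {- real n..real n + 1} (\<lambda>x. trig_poly L A B x * g x) =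
    (\<Sum>l\<in>L. E * A l * integral {- real n..real n + 1} (\<lambda>x. cos (2 * pi * real l * x + 0) * ?P x) +
       E * B l * integral {- real n..real n + 1} (\<lambda>x. cos (2 * pi * real l * x + (- pi / 2)) * ?P x))" for n
  proof (cases "finite L")
    case True
    show ?thesis unfolding e using True
      by (intro integral_unique has_integral_sum has_integral_add has_integral_mult_right integrable_integral
          integrable_continuous_interval continuous_intros cP) auto
  qed (simp add: e)
  moreover have "(\<lambda>n. \<Sum>l\<in>L. E * A l * integral {- real n..real n + 1} (\<lambda>x. cos (2 * pi * real l * x + 0) * ?P x) +
       E * B l * integral {- real n..real n + 1} (\<lambda>x. cos (2 * pi * real l * x + (- pi / 2)) * ?P x)) \<longlonglongrightarrow>
      (\<Sum>l\<in>L. E * A l * 0 + E * B l * 0)"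
    by (intro tendsto_intros lim)
  ultimately have "(\<lambda>n. integral {- real n..real n + 1} (\<lambda>x. trig_poly L A B x * g x)) \<longlonglongrightarrow> 0" by simp
  moreover have "(\<lambda>n. integral {- real n..real n + 1} (\<lambda>x. trig_poly L A B x * g x)) \<longlonglongrightarrow>
      (LINT x:{0..1}|lborel. trig_poly L A B x * periodize g x)"
    using integral_partial_tendsto[of "trig_poly L A B"] integral_partial_eq[of "trig_poly L A B"]
      continuous_trig_poly trig_poly_periodic by simp
  ultimately show ?thesis by (rule LIMSEQ_unique[symmetric])
qed

lemma ennreal_powr_le:
  assumes "a \<le> ennreal b" "b \<ge> 0" "r \<ge> 0"
  shows "ennreal_powr a r \<le> ennreal (b powr r)"
proof -
  have "a \<noteq> \<infinity>" using assms(1) by (metis ennreal_neq_top infinity_ennreal_def neq_top_trans)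
  moreover have "enn2real a \<le> b" using assms by (metis enn2real_ennreal enn2real_mono ennreal_less_top)
  ultimately show ?thesis using assms
    by (auto simp: ennreal_powr_def intro!: ennreal_leI powr_mono2)
qed

text \<open>Interpolation between the sup norm and the sum norm: of the \<open>p\<close> factors one
  is kept, the other \<open>p - 1\<close> are bounded by \<open>m\<close>.\<close>

lemma sum_powr_le:
  fixes \<beta> :: "'i \<Rightarrow> real"
  assumes "finite I" "p > 1" and m: "\<And>k. k \<in> I \<Longrightarrow> \<bar>\<beta> k\<bar> \<le> m" and s: "(\<Sum>k\<in>I. \<bar>\<beta> k\<bar>) \<le> t" and "m \<ge> 0"
  shows "(\<Sum>k\<in>I. \<bar>\<beta> k\<bar> powr p) \<le> m powr (p - 1) * t"
proof -
  have "(\<Sum>k\<in>I. \<bar>\<beta> k\<bar> powr p) \<le> (\<Sum>k\<in>I. m powr (p - 1) * \<bar>\<beta> k\<bar>)"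
  proof (rule sum_mono)
    fix k assume k: "k \<in> I"
    have "\<bar>\<beta> k\<bar> powr p = \<bar>\<beta> k\<bar> powr (p - 1) * \<bar>\<beta> k\<bar>"
      using powr_mult_base[of "\<bar>\<beta> k\<bar>" "p - 1"] by (simp add: mult.commute)
    also have "\<dots> \<le> m powr (p - 1) * \<bar>\<beta> k\<bar>"
      using m[OF k] \<open>p > 1\<close> by (intro mult_right_mono powr_mono2) auto
    finally show "\<bar>\<beta> k\<bar> powr p \<le> m powr (p - 1) * \<bar>\<beta> k\<bar>" .
  qed
  also have "\<dots> = m powr (p - 1) * (\<Sum>k\<in>I. \<bar>\<beta> k\<bar>)" by (simp add: sum_distrib_left)
  also have "\<dots> \<le> m powr (p - 1) * t" using s by (rule mult_left_mono) simp
  finally show ?thesis .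
qed

section \<open>Wavelet coefficients of a dyadic frequency block\<close>

lemma decaying_meyer_wavelet:
  assumes m: "meyer_transition v"
  shows "\<exists>C>0. \<forall>i k. decaying (dilate_translate (meyer_wavelet v) (int i) k) (2 ^ i) (of_int k - 1/2) (2 powr (real i / 2) * C)"
proof -
  note S = smooth_profile_psi[OF m]
  obtain C where C: "C > 0" "\<And>y. \<bar>cos_transform (meyer_psi_profile v) (1/3) (4/3) y\<bar> \<le> C / (1 + y\<^sup>2)"
    using smooth_profile_decay[OF S] by blast
  \<comment> \<open>The phase of the transform centres the wavelet at \<open>k - 1/2\<close> in the
    dilated variable.\<close>
  have e: "dilate_translate (meyer_wavelet v) (int i) k x =
      2 powr (real i / 2) * cos_transform (meyer_psi_profile v) (1/3) (4/3) (real (2 ^ i) * x - (of_int k - 1/2))" for i k x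
    by (simp add: dilate_translate_def meyer_wavelet_eq[OF m] powr_realpow algebra_simps)
  have "decaying (dilate_translate (meyer_wavelet v) (int i) k) (2 ^ i) (of_int k - 1/2) (2 powr (real i / 2) * C)" for i k
  proof
    show "continuous_on UNIV (dilate_translate (meyer_wavelet v) (int i) k)"
      unfolding e
      by (intro continuous_intros continuous_on_compose2[OF continuous_cos_transform[OF smooth_profile_continuous[OF S]]]) auto
    show "\<bar>dilate_translate (meyer_wavelet v) (int i) k x\<bar> \<le> 2 powr (real i / 2) * C / (1 + (real (2 ^ i) * x - (of_int k - 1 / 2))\<^sup>2)" for x
      unfolding e abs_mult using mult_left_mono[OF C(2), of "2 powr (real i / 2)"] by simp
  qed simp
  with C(1) show ?thesis by blast
qed

text \<open>The transform at scale \<open>i\<close> lives on absolute frequencies from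
  \<open>2 ^ i / 3\<close> to \<open>4 * 2 ^ i / 3\<close>. For \<open>i < j\<close> the upper end
  is below \<open>2 ^ j\<close>; for \<open>i > j + 2\<close> the lower end is at least
  \<open>8 * 2 ^ j / 3\<close>, beyond the block.\<close>

lemma meyer_wavelet_coefficient_vanish:
  assumes m: "meyer_transition v" and L: "L = {2 ^ j..<2 ^ (j + 1)}" and i: "i < j \<or> i > j + 2"
  shows "wavelet_coeff v (trig_poly L A B) (int i) k = 0"
proof -
  obtain C where dec: "decaying (dilate_translate (meyer_wavelet v) (int i) k) (2 ^ i) (of_int k - 1/2) (2 powr (real i / 2) * C)"
    using decaying_meyer_wavelet[OF m] by blast
  have "(LINT x:{0..1}|lborel. trig_poly L A B x * periodize (dilate_translate (meyer_wavelet v) (int i) k) x) = 0"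
  proof (rule trig_poly_coefficient_vanish[OF dec smooth_profile_psi[OF m]])
    fix x
    show "dilate_translate (meyer_wavelet v) (int i) k x =
      2 powr (real i / 2) * cos_transform (meyer_psi_profile v) (1/3) (4/3) (real (2 ^ i) * x - (of_int k - 1/2))"
      by (simp add: dilate_translate_def meyer_wavelet_eq[OF m] powr_realpow algebra_simps)
  next
    fix l assume "l \<in> L"
    then show "l > 0" using L by (auto intro: less_le_trans[of 0 "2 ^ j"])
  next
    fix l and u :: real assume l: "l \<in> L" and u: "u \<in> {1/3..4/3}"
    have l': "2 ^ j \<le> real l" "real l < 2 * 2 ^ j"
    proof -
      have "2 ^ j \<le> l" "l < 2 * 2 ^ j" using l L by auto
      then have "real (2 ^ j) \<le> real l" "real l < real (2 * 2 ^ j)" by (simp_all only: of_nat_le_iff of_nat_less_iff)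
      then show "2 ^ j \<le> real l" "real l < 2 * 2 ^ j" by simp_all
    qed
    show "u * real (2 ^ i) \<noteq> real l"
    proof (cases "i < j")
      case True
      have "2 ^ Suc i \<le> (2::real) ^ j" using True by (intro power_increasing) auto
      then have h: "2 ^ i \<le> (2::real) ^ j / 2" by simp
      have "u * 2 ^ i \<le> 4 / 3 * ((2::real) ^ j / 2)" using u h by (intro mult_mono) auto
      also have "\<dots> < 2 ^ j" by simp
      finally have "u * 2 ^ i < real l" using l'(1) by (rule less_le_trans)
      then show ?thesis by simp
    next
      case False
      then have "2 ^ (j + 3) \<le> (2::real) ^ i" using i by (intro power_increasing) auto
      then have h: "8 * 2 ^ j \<le> (2::real) ^ i" by (simp add: power_add)
      have "2 * 2 ^ j < 1 / 3 * (8 * (2::real) ^ j)" by simp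
      also have "\<dots> \<le> u * 2 ^ i" using u h by (intro mult_mono) auto
      finally have "real l < u * 2 ^ i" using l'(2) by linarith
      then show ?thesis by simp
    qed
  qed
  then show ?thesis by (simp add: wavelet_coeff_def periodic_meyer_def)
qed

text \<open>The frequencies of the scaling function stop at 2/3, those of the block are at least
  1.\<close>

lemma meyer_scaling_coefficient_vanish:
  assumes m: "meyer_transition v" and L: "L = {2 ^ j..<2 ^ (j + 1)}"
  shows "wavelet_coeff v (trig_poly L A B) (-1) k = 0"
proof -
  note S = smooth_profile_phi[OF m]
  obtain C where C: "C > 0" "\<And>y. \<bar>cos_transform (meyer_phi_profile v) 0 (2/3) y\<bar> \<le> C / (1 + y\<^sup>2)"
    using smooth_profile_decay[OF S] by blast
  have e: "dilate_translate (meyer_scaling v) 0 0 x = 1 * cos_transform (meyer_phi_profile v) 0 (2/3) (real 1 * x - 0)" for x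
    by (simp add: dilate_translate_def meyer_scaling_eq[OF m])
  have dec: "decaying (dilate_translate (meyer_scaling v) 0 0) 1 0 C"
  proof
    show "continuous_on UNIV (dilate_translate (meyer_scaling v) 0 0)"
      unfolding e by (intro continuous_intros continuous_on_compose2[OF continuous_cos_transform[OF smooth_profile_continuous[OF S]]]) auto
    show "\<bar>dilate_translate (meyer_scaling v) 0 0 x\<bar> \<le> C / (1 + (real 1 * x - 0)\<^sup>2)" for x
      unfolding e using C(2) by simp
  qed simp
  have "(LINT x:{0..1}|lborel. trig_poly L A B x * periodize (dilate_translate (meyer_scaling v) 0 0) x) = 0"
  proof (rule trig_poly_coefficient_vanish[OF dec S e])
    fix l assume "l \<in> L"
    then show l: "l > 0" using L by (auto intro: less_le_trans[of 0 "2 ^ j"])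
    show "u * real 1 \<noteq> real l" if "u \<in> {0..2/3}" for u using that l by auto
  qed
  then show ?thesis by (simp add: wavelet_coeff_def periodic_meyer_def)
qed

text \<open>On the three scales that contribute, the coefficients are of order
  \<open>a * 2 powr (j / 2)\<close> in sup norm and \<open>b * 2 powr (j / 2)\<close> in sum norm,
  and \<open>sum_powr_le\<close> interpolates. Keeping \<open>a\<close> and \<open>b\<close> apart
  serves full sums of bumps and single bumps alike.\<close>

lemma besov_norm_trig_poly:
  fixes s p q :: real
  assumes m: "meyer_transition v" and p: "p > 1" and q: "q > 1"
  shows "\<exists>C>0. \<forall>j A B a b. (\<forall>x. \<bar>trig_poly {2 ^ j..<2 ^ (j + 1)} A B x\<bar> \<le> a * 2 ^ j) \<longrightarrow>
     integral {0..1} (\<lambda>x. \<bar>trig_poly {2 ^ j..<2 ^ (j + 1)} A B x\<bar>) \<le> b \<longrightarrow>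
     besov_norm v s p q (trig_poly {2 ^ j..<2 ^ (j + 1)} A B) \<le>
       ennreal (C * 2 powr (real j * (s + 1/2 - 1/p)) * ((a * 2 powr (real j / 2)) powr (p - 1) * (b * 2 powr (real j / 2))) powr (1 / p))"
proof -
  obtain C where C: "C > 0" "\<And>i k. decaying (dilate_translate (meyer_wavelet v) (int i) k) (2 ^ i) (of_int k - 1/2) (2 powr (real i / 2) * C)"
    using decaying_meyer_wavelet[OF m] by blast
  \<comment> \<open>\<open>3 * pi\<close> comes from \<open>sum_coefficients_le\<close>, the further
    2 from replacing a scale \<open>i \<le> j + 2\<close> by \<open>j\<close>.\<close>
  define D where "D = 6 * pi * C"
  define e where "e = s + 1/2 - 1/p"
  have D: "D > 0" using C by (simp add: D_def)
  have main: "besov_norm v s p q (trig_poly {2 ^ j..<2 ^ (j + 1)} A B) \<le>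
       ennreal (3 * 2 powr (2 * \<bar>e\<bar>) * D * 2 powr (real j * e) * ((a * 2 powr (real j / 2)) powr (p - 1) * (b * 2 powr (real j / 2))) powr (1 / p))"
    if a: "\<And>x. \<bar>trig_poly {2 ^ j..<2 ^ (j + 1)} A B x\<bar> \<le> a * 2 ^ j"
      and b: "integral {0..1} (\<lambda>x. \<bar>trig_poly {2 ^ j..<2 ^ (j + 1)} A B x\<bar>) \<le> b" for j :: nat and A B a b
  proof -
    define L where "L = {2 ^ j..<2 ^ (j + 1) :: nat}"
    let ?f = "trig_poly L A B"
    let ?\<beta> = "wavelet_coeff v ?f"
    define X where "X = (a * 2 powr (real j / 2)) powr (p - 1) * (b * 2 powr (real j / 2))"
    define T where "T = 2 powr (2 * \<bar>e\<bar>) * D * 2 powr (real j * e) * X powr (1 / p)"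
    have a0: "a \<ge> 0"
    proof (rule ccontr)
      assume "\<not> a \<ge> 0"
      then have "a * 2 ^ j < 0" by (simp add: mult_neg_pos)
      then show False using order_trans[OF abs_ge_zero a[of 0]] by simp
    qed
    have b0: "b \<ge> 0"
      by (rule order_trans[OF _ b]) (auto intro!: Henstock_Kurzweil_Integration.integral_nonneg integrable_continuous_interval continuous_intros continuous_trig_poly)
    have X0: "X \<ge> 0" using b0 by (simp add: X_def)
    have T0: "T \<ge> 0" using D by (simp add: T_def)
    define t where "t j' = 2 powr (real_of_int j' * e * q) * (\<Sum>k\<in>shift_set j'. \<bar>?\<beta> j' k\<bar> powr p) powr (q / p)" for j'
    have tz: "t j' = 0" if "j' \<in> {-1..} - {int j..int j + 2}" for j'
    proof -
      have "?\<beta> j' k = 0" for k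
      proof (cases "j' = -1")
        case True
        then show ?thesis using meyer_scaling_coefficient_vanish[OF m L_def] by simp
      next
        case False
        then have "j' = int (nat j')" "nat j' < j \<or> nat j' > j + 2" using that by auto
        then show ?thesis using meyer_wavelet_coefficient_vanish[OF m L_def] by metis
      qed
      then show ?thesis using p by (simp add: t_def)
    qed
    have tb: "t j' \<le> T powr q" if j': "j' \<in> {int j..int j + 2}" for j'
    proof -
      define i where "i = nat j'"
      have i: "j' = int i" "j \<le> i" "i \<le> j + 2" using j' by (auto simp: i_def)
      have sh: "shift_set j' = {0..<int (2 ^ i)}" using i by (auto simp: shift_set_def)
      have bet: "?\<beta> j' k = (LINT x:{0..1}|lborel. ?f x * periodize (dilate_translate (meyer_wavelet v) (int i) k) x)" for k
        using i by (simp add: wavelet_coeff_def periodic_meyer_def)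
      have pj: "2 powr (real i / 2) \<le> 2 * 2 powr (real j / 2)"
      proof -
        have "2 powr (real i / 2) \<le> 2 powr (1 + real j / 2)" using i by (intro powr_mono) auto
        then show ?thesis by (simp add: powr_add)
      qed
      have c: "continuous_on UNIV ?f" by (rule continuous_trig_poly)
      have B1: "\<bar>?\<beta> j' k\<bar> \<le> D * (a * 2 powr (real j / 2))" for k
      proof -
        have "\<bar>?\<beta> j' k\<bar> \<le> a * 2 ^ j * (2 powr (real i / 2) * C * pi / real (2 ^ i))"
          unfolding bet using a by (intro decaying.coefficient_bound[OF C(2) c] trig_poly_periodic) (simp add: L_def)
        also have "\<dots> = a * C * pi * 2 powr (real j + real i / 2 - real i)"
          by (simp only: powr_diff powr_add) (simp add: powr_realpow)
        also have "2 powr (real j + real i / 2 - real i) \<le> 2 powr (real j / 2)"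
          using i by (intro powr_mono) auto
        also have "a * C * pi * 2 powr (real j / 2) \<le> D * (a * 2 powr (real j / 2))"
          using a0 C by (simp add: D_def mult.commute mult.left_commute)
        finally show ?thesis using a0 C by (simp add: mult_left_mono)
      qed
      have B2: "(\<Sum>k\<in>{0..<int (2 ^ i)}. \<bar>?\<beta> j' k\<bar>) \<le> D * (b * 2 powr (real j / 2))"
      proof -
        have "(\<Sum>k\<in>{0..<int (2 ^ i)}. \<bar>?\<beta> j' k\<bar>) \<le> 3 * pi * (2 powr (real i / 2) * C) * integral {0..1} (\<lambda>x. \<bar>?f x\<bar>)"
          unfolding bet by (rule sum_coefficients_le[OF C(2) c])
        also have "\<dots> \<le> 3 * pi * (2 powr (real i / 2) * C) * b"
          using b C by (intro mult_left_mono) (auto simp: L_def)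
        also have "\<dots> \<le> 3 * pi * ((2 * 2 powr (real j / 2)) * C) * b"
          using pj b0 C by (intro mult_right_mono mult_left_mono) auto
        finally show ?thesis by (simp add: D_def ac_simps)
      qed
      have "(\<Sum>k\<in>{0..<int (2 ^ i)}. \<bar>?\<beta> j' k\<bar> powr p) \<le> (D * (a * 2 powr (real j / 2))) powr (p - 1) * (D * (b * 2 powr (real j / 2)))"
        using B1 B2 a0 D p by (intro sum_powr_le) auto
      also have "\<dots> = D powr p * X"
      proof -
        have "D powr p = D powr (p - 1) * D" using D powr_mult_base[of D "p - 1"] by (simp add: mult.commute)
        then show ?thesis using D a0 by (simp add: X_def powr_mult mult.commute mult.left_commute)
      qed
      finally have S: "(\<Sum>k\<in>{0..<int (2 ^ i)}. \<bar>?\<beta> j' k\<bar> powr p) \<le> D powr p * X" .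
      \<comment> \<open>The exponent \<open>e\<close> may have either sign, and \<open>i - j\<close>
        is at most 2.\<close>
      have ie: "2 powr (real i * e) \<le> 2 powr (2 * \<bar>e\<bar>) * 2 powr (real j * e)"
      proof -
        have "real i * e = (real i - real j) * e + real j * e" by (simp add: algebra_simps)
        also have "(real i - real j) * e \<le> 2 * \<bar>e\<bar>"
          using i by (intro order_trans[OF mult_left_mono[OF abs_ge_self] mult_right_mono]) auto
        finally show ?thesis unfolding powr_add[symmetric] by (intro powr_mono) auto
      qed
      have "t j' = 2 powr (real i * e * q) * (\<Sum>k\<in>{0..<int (2 ^ i)}. \<bar>?\<beta> j' k\<bar> powr p) powr (q / p)"
        unfolding t_def sh using i by simp
      also have "\<dots> \<le> 2 powr (real i * e * q) * (D powr p * X) powr (q / p)"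
        using S p q by (intro mult_left_mono powr_mono2 sum_nonneg) auto
      also have "(D powr p * X) powr (q / p) = (D * X powr (1 / p)) powr q"
        using D X0 p by (simp add: powr_mult powr_powr)
      also have "2 powr (real i * e * q) = (2 powr (real i * e)) powr q" by (simp add: powr_powr)
      also have "\<dots> * (D * X powr (1 / p)) powr q \<le> (2 powr (2 * \<bar>e\<bar>) * 2 powr (real j * e)) powr q * (D * X powr (1 / p)) powr q"
        using ie q by (intro mult_right_mono powr_mono2) auto
      also have "\<dots> = T powr q" using D by (simp add: T_def powr_mult mult.commute mult.left_commute)
      finally show ?thesis .
    qed
    have "(\<Sum>\<^sub>\<infinity>j'\<in>{-1..}. ennreal (t j')) = (\<Sum>\<^sub>\<infinity>j'\<in>{int j..int j + 2}. ennreal (t j'))"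
      by (rule infsum_cong_neutral) (use tz in auto)
    also have "\<dots> = (\<Sum>j'\<in>{int j..int j + 2}. ennreal (t j'))" by (rule infsum_finite) simp
    also have "\<dots> \<le> (\<Sum>j'\<in>{int j..int j + 2}. ennreal (T powr q))"
      using tb by (intro sum_mono ennreal_leI) auto
    also have "\<dots> = ennreal (3 * T powr q)" by (simp add: ennreal_mult)
    finally have "besov_norm v s p q ?f \<le> ennreal ((3 * T powr q) powr (1 / q))"
      unfolding besov_norm_def t_def e_def using q by (intro ennreal_powr_le) auto
    also have "(3 * T powr q) powr (1 / q) = 3 powr (1 / q) * T"
      using T0 q by (simp add: powr_mult powr_powr)
    also have "\<dots> \<le> 3 * T"
    proof -
      have "3 powr (1 / q) \<le> 3 powr (1::real)" using q by (intro powr_mono) auto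
      then show ?thesis using T0 by (intro mult_right_mono) auto
    qed
    also have "3 * T = 3 * 2 powr (2 * \<bar>e\<bar>) * D * 2 powr (real j * e) * X powr (1 / p)" by (simp add: T_def mult.assoc)
    finally show ?thesis unfolding L_def X_def by (simp add: ennreal_leI)
  qed
  show ?thesis
    by (intro exI[of _ "3 * 2 powr (2 * \<bar>e\<bar>) * D"] conjI allI impI)
      (use D main in \<open>auto simp: e_def\<close>)
qed

section \<open>Trigonometric polynomials: energy\<close>

lemma integral_cos_int:
  fixes k :: int
  shows "((\<lambda>x. cos (2 * pi * of_int k * x)) has_integral (if k = 0 then 1 else 0)) {0..1}"
proof (cases "k = 0")
  case False
  have "((\<lambda>x. cos (2 * pi * of_int k * x)) has_integral
      (sin (2 * pi * of_int k * 1) / (2 * pi * of_int k) - sin (2 * pi * of_int k * 0) / (2 * pi * of_int k))) {0..1}"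
    using False by (intro fundamental_theorem_of_calculus)
      (auto intro!: derivative_eq_intros simp: has_real_derivative_iff_has_vector_derivative[symmetric])
  moreover have "sin (2 * pi * of_int k * 1) = 0"
    using sin_int_2pin[of k] by (simp add: mult.commute)
  ultimately show ?thesis using False by simp
next
  case True
  then show ?thesis using has_integral_const_real[of "1::real" 0 1] by simp
qed

lemma integral_sin_int:
  fixes k :: int
  shows "((\<lambda>x. sin (2 * pi * of_int k * x)) has_integral 0) {0..1}"
proof (cases "k = 0")
  case False
  have "((\<lambda>x. sin (2 * pi * of_int k * x)) has_integral
      (- cos (2 * pi * of_int k * 1) / (2 * pi * of_int k) - - cos (2 * pi * of_int k * 0) / (2 * pi * of_int k))) {0..1}"
    using False by (intro fundamental_theorem_of_calculus)
      (auto intro!: derivative_eq_intros simp: has_real_derivative_iff_has_vector_derivative[symmetric])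
  moreover have "cos (2 * pi * of_int k * 1) = 1"
    using cos_int_2pin[of k] by (simp add: mult.commute)
  ultimately show ?thesis by simp
qed simp

text \<open>Product-to-sum leaves the frequencies \<open>l - k\<close> and \<open>l + k\<close>;
  \<open>0 \<notin> L\<close> keeps the latter away from 0, so only the diagonal survives.\<close>

lemma trig_poly_parseval:
  assumes L: "finite L" "0 \<notin> L"
  shows "((\<lambda>x. (trig_poly L a b x)\<^sup>2) has_integral (\<Sum>l\<in>L. ((a l)\<^sup>2 + (b l)\<^sup>2) / 2)) {0..1}"
proof -
  let ?h = "\<lambda>l x. a l * cos (2 * pi * real l * x) + b l * sin (2 * pi * real l * x)"
  have pair: "((\<lambda>x. ?h l x * ?h k x) has_integral (if l = k then ((a l)\<^sup>2 + (b l)\<^sup>2) / 2 else 0)) {0..1}"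
    if "l \<in> L" "k \<in> L" for l k
  proof -
    have nz: "int l + int k \<noteq> 0" using that L by (metis add_is_0 of_nat_0_eq_iff of_nat_add)
    let ?d = "int l - int k" and ?s = "int l + int k"
    have e: "?h l x * ?h k x =
      (a l * a k + b l * b k) / 2 * cos (2 * pi * of_int ?d * x) + (a l * a k - b l * b k) / 2 * cos (2 * pi * of_int ?s * x) +
      ((a l * b k + b l * a k) / 2 * sin (2 * pi * of_int ?s * x) + (b l * a k - a l * b k) / 2 * sin (2 * pi * of_int ?d * x))" for x
    proof -
      have "2 * pi * of_int ?d * x = 2 * pi * real l * x - 2 * pi * real k * x" "2 * pi * of_int ?s * x = 2 * pi * real l * x + 2 * pi * real k * x"
        by (simp_all add: algebra_simps)
      then show ?thesis by (simp only: cos_add cos_diff sin_add sin_diff) (simp add: field_simps)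
    qed
    have "((\<lambda>x. ?h l x * ?h k x) has_integral
       ((a l * a k + b l * b k) / 2 * (if ?d = 0 then 1 else 0) + (a l * a k - b l * b k) / 2 * (if ?s = 0 then 1 else 0) +
      ((a l * b k + b l * a k) / 2 * 0 + (b l * a k - a l * b k) / 2 * 0))) {0..1}"
      unfolding e by (intro has_integral_add has_integral_mult_right integral_cos_int integral_sin_int)
    moreover have "(a l * a k + b l * b k) / 2 * (if ?d = 0 then 1 else 0) + (a l * a k - b l * b k) / 2 * (if ?s = 0 then 1 else 0) +
      ((a l * b k + b l * a k) / 2 * 0 + (b l * a k - a l * b k) / 2 * 0) = (if l = k then ((a l)\<^sup>2 + (b l)\<^sup>2) / 2 else 0)"
      using nz by (auto simp: power2_eq_square)
    ultimately show ?thesis by simp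
  qed
  have "(\<lambda>x. (trig_poly L a b x)\<^sup>2) = (\<lambda>x. \<Sum>l\<in>L. \<Sum>k\<in>L. ?h l x * ?h k x)"
    by (simp add: fun_eq_iff trig_poly_def power2_eq_square sum_product)
  moreover have "((\<lambda>x. \<Sum>l\<in>L. \<Sum>k\<in>L. ?h l x * ?h k x) has_integral
      (\<Sum>l\<in>L. \<Sum>k\<in>L. if l = k then ((a l)\<^sup>2 + (b l)\<^sup>2) / 2 else 0)) {0..1}"
    using L by (intro has_integral_sum pair) auto
  moreover have "(\<Sum>l\<in>L. \<Sum>k\<in>L. if l = k then ((a l)\<^sup>2 + (b l)\<^sup>2) / 2 else 0) = (\<Sum>l\<in>L. ((a l)\<^sup>2 + (b l)\<^sup>2) / 2)"
    using L by (intro sum.cong) (auto simp: sum.delta')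
  ultimately show ?thesis by simp
qed

text \<open>Cauchy-Schwarz against the constant 1, obtained by expanding the integral of the squared
  deviation of \<open>h\<close> from its mean.\<close>

lemma integral_square_le:
  fixes h :: "real \<Rightarrow> real"
  assumes c: "continuous_on {\<alpha>..\<beta>} h" and ab: "\<alpha> < \<beta>"
  shows "(integral {\<alpha>..\<beta>} h)\<^sup>2 / (\<beta> - \<alpha>) \<le> integral {\<alpha>..\<beta>} (\<lambda>x. (h x)\<^sup>2)"
proof -
  define I where "I = integral {\<alpha>..\<beta>} h"
  define m where "m = I / (\<beta> - \<alpha>)"
  have "0 \<le> integral {\<alpha>..\<beta>} (\<lambda>x. (h x - m)\<^sup>2)"
    by (intro Henstock_Kurzweil_Integration.integral_nonneg integrable_continuous_interval continuous_intros c) auto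
  also have "(\<lambda>x. (h x - m)\<^sup>2) = (\<lambda>x. ((h x)\<^sup>2 - 2 * m * h x) + m\<^sup>2)"
    by (simp add: fun_eq_iff power2_diff algebra_simps)
  also have "integral {\<alpha>..\<beta>} \<dots> = (integral {\<alpha>..\<beta>} (\<lambda>x. (h x)\<^sup>2) - 2 * m * I) + m\<^sup>2 * (\<beta> - \<alpha>)"
  proof (rule integral_unique, intro has_integral_add has_integral_diff has_integral_mult_right)
    show "((\<lambda>x. (h x)\<^sup>2) has_integral integral {\<alpha>..\<beta>} (\<lambda>x. (h x)\<^sup>2)) {\<alpha>..\<beta>}"
      by (intro integrable_integral integrable_continuous_interval continuous_intros c)
    show "(h has_integral I) {\<alpha>..\<beta>}" unfolding I_def
      by (intro integrable_integral integrable_continuous_interval continuous_intros c)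
    show "((\<lambda>x. m\<^sup>2) has_integral m\<^sup>2 * (\<beta> - \<alpha>)) {\<alpha>..\<beta>}"
      using has_integral_const_real[of "m\<^sup>2" \<alpha> \<beta>] ab by (simp add: mult.commute)
  qed
  also have "\<dots> = integral {\<alpha>..\<beta>} (\<lambda>x. (h x)\<^sup>2) - I\<^sup>2 / (\<beta> - \<alpha>)"
  proof -
    have md: "m * (\<beta> - \<alpha>) = I" using ab by (simp add: m_def)
    have "m\<^sup>2 * (\<beta> - \<alpha>) = m * I" by (simp only: power2_eq_square mult.assoc md)
    moreover have "I\<^sup>2 / (\<beta> - \<alpha>) = m * I" by (simp add: m_def power2_eq_square)
    ultimately show ?thesis by simp
  qed
  finally show ?thesis by (simp add: I_def)
qed

text \<open>Supplies the hypothesis \<open>energy\<close> of \<open>shifted_wiener\<close>, by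
  \<open>integral_square_le\<close> on each interval of the partition.\<close>

lemma partition_energy_le:
  fixes h :: "real \<Rightarrow> real"
  assumes c: "continuous_on UNIV h" and \<tau>: "\<And>i. i \<le> m \<Longrightarrow> \<tau> i \<in> {0..1}" "\<And>i. i < m \<Longrightarrow> \<tau> i < \<tau> (Suc i)"
  shows "(\<Sum>i<m. (integral {0..\<tau> (Suc i)} h - integral {0..\<tau> i} h)\<^sup>2 / (\<tau> (Suc i) - \<tau> i)) \<le> integral {0..1} (\<lambda>x. (h x)\<^sup>2)"
proof -
  have c': "continuous_on A h" for A using c by (rule continuous_on_subset) auto
  have i: "h integrable_on {a..b}" "(\<lambda>x. (h x)\<^sup>2) integrable_on {a..b}" for a b
    by (intro integrable_continuous_interval continuous_intros c')+
  let ?g = "\<lambda>t. integral {0..t} (\<lambda>x. (h x)\<^sup>2)"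
  have "(\<Sum>i<m. (integral {0..\<tau> (Suc i)} h - integral {0..\<tau> i} h)\<^sup>2 / (\<tau> (Suc i) - \<tau> i)) \<le> (\<Sum>i<m. ?g (\<tau> (Suc i)) - ?g (\<tau> i))"
  proof (rule sum_mono)
    fix i' assume "i' \<in> {..<m}"
    then have t: "0 \<le> \<tau> i'" "\<tau> i' < \<tau> (Suc i')" using \<tau>(1)[of i'] \<tau>(2)[of i'] by auto
    have e: "integral {0..\<tau> (Suc i')} h - integral {0..\<tau> i'} h = integral {\<tau> i'..\<tau> (Suc i')} h"
      "?g (\<tau> (Suc i')) - ?g (\<tau> i') = integral {\<tau> i'..\<tau> (Suc i')} (\<lambda>x. (h x)\<^sup>2)"
      using Henstock_Kurzweil_Integration.integral_combine[of 0 "\<tau> i'" "\<tau> (Suc i')"] t i by (smt (verit))+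
    show "(integral {0..\<tau> (Suc i')} h - integral {0..\<tau> i'} h)\<^sup>2 / (\<tau> (Suc i') - \<tau> i') \<le> ?g (\<tau> (Suc i')) - ?g (\<tau> i')"
      unfolding e by (rule integral_square_le[OF c' t(2)])
  qed
  also have "\<dots> = ?g (\<tau> m) - ?g (\<tau> 0)" by (rule sum_lessThan_telescope[of "\<lambda>i. ?g (\<tau> i)"])
  also have "\<dots> \<le> ?g (\<tau> m)"
    using Henstock_Kurzweil_Integration.integral_nonneg[OF i(2)[of 0 "\<tau> 0"]] by simp
  also have "\<dots> \<le> ?g 1"
    using \<tau>(1)[of m] by (intro integral_subset_le i) auto
  finally show ?thesis .
qed

section \<open>The random filter\<close>

locale filter_model = prob_space M
  for M :: "'w measure" +
  fixes W Y :: "real \<Rightarrow> 'w \<Rightarrow> real" and \<sigma> x0 :: real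
  assumes W: "standard_wiener M W" and L2: "L2_process M Y" and indep: "indep_processes M W Y" and \<sigma>: "\<sigma> > 0"
begin

text \<open>Time is clamped to \<open>[0, 1]\<close>, where the process is known to be jointly measurable.\<close>

definition Yc :: "real \<Rightarrow> 'w \<Rightarrow> real" where
  "Yc s \<omega> = Y (max 0 (min 1 s)) \<omega>"

lemma Yc_eq: "s \<in> {0..1} \<Longrightarrow> Yc s \<omega> = Y s \<omega>"
  by (auto simp: Yc_def)

lemma measurable_Yc: "(\<lambda>p. Yc (snd p) (fst p)) \<in> borel_measurable (M \<Otimes>\<^sub>M borel)"
proof -
  have "(\<lambda>p. (fst p, max 0 (min 1 (snd p)))) \<in> measurable (M \<Otimes>\<^sub>M borel) (M \<Otimes>\<^sub>M restrict_space borel {0..1::real})"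
    by (intro measurable_Pair measurable_restrict_space2) auto
  moreover have "(\<lambda>(\<omega>, t). Y t \<omega>) \<in> borel_measurable (M \<Otimes>\<^sub>M restrict_space borel {0..1})"
    using L2 by (simp add: L2_process_def)
  ultimately have "(\<lambda>p. (\<lambda>(\<omega>, t). Y t \<omega>) (fst p, max 0 (min 1 (snd p)))) \<in> borel_measurable (M \<Otimes>\<^sub>M borel)"
    by (rule measurable_compose)
  then show ?thesis by (simp add: Yc_def)
qed

lemma measurable_Yc' [measurable]:
  "f \<in> measurable N M \<Longrightarrow> g \<in> borel_measurable N \<Longrightarrow> (\<lambda>x. Yc (g x) (f x)) \<in> borel_measurable N"
  using measurable_compose[OF measurable_Pair[of f N M g borel] measurable_Yc] by simp

text \<open>The information in the filter path, as a sigma-algebra on the sample space.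
  Measurability of each \<open>Y t\<close> is immediate; time integrals of \<open>Y\<close> need
  \<open>filter_integral_G\<close>.\<close>

definition G :: "'w measure" where
  "G = vimage_algebra (space M) (sample_path Y) (\<Pi>\<^sub>M t\<in>{0..1}. borel)"

lemma measurable_paths:
  "sample_path W \<in> measurable M (\<Pi>\<^sub>M t\<in>{0..1}. borel)" "sample_path Y \<in> measurable M (\<Pi>\<^sub>M t\<in>{0..1}. borel)"
  using indep indep_var_rv1 indep_var_rv2 unfolding indep_processes_def by blast+

lemma subalgebra_G: "subalgebra M G"
proof -
  have "sample_path Y \<in> space M \<rightarrow> space (\<Pi>\<^sub>M t\<in>{0..1}. borel)"
    using measurable_paths(2) by (auto dest: measurable_space)
  then show ?thesis
    unfolding subalgebra_def G_def using measurable_paths(2)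
    by (auto simp: sets_vimage_algebra2 intro: measurable_sets)
qed

lemma Y_measurable_G: "t \<in> {0..1} \<Longrightarrow> Y t \<in> borel_measurable G"
proof -
  assume t: "t \<in> {0..1}"
  have "sample_path Y \<in> space M \<rightarrow> space (\<Pi>\<^sub>M t\<in>{0..1}. borel)"
    using measurable_paths(2) by (auto dest: measurable_space)
  then have "sample_path Y \<in> measurable G (\<Pi>\<^sub>M t\<in>{0..1}. borel)"
    unfolding G_def by (rule measurable_vimage_algebra1)
  then have "(\<lambda>\<omega>. sample_path Y \<omega> t) \<in> borel_measurable G"
    using t by (rule measurable_compose[OF _ measurable_component_singleton])
  then show ?thesis using t by (simp add: sample_path_def)
qed

lemma indep_G:
  assumes S: "S \<in> sets (\<Pi>\<^sub>M t\<in>{0..1}. borel)" and D: "D \<in> sets G"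
  shows "prob (sample_path W -` S \<inter> D) = prob (sample_path W -` S \<inter> space M) * prob D"
proof -
  have "sample_path Y \<in> space M \<rightarrow> space (\<Pi>\<^sub>M t\<in>{0..1}. borel)"
    using measurable_paths(2) by (auto dest: measurable_space)
  then obtain A where A: "A \<in> sets (\<Pi>\<^sub>M t\<in>{0..1}. borel)" "D = sample_path Y -` A \<inter> space M"
    using D unfolding G_def by (auto simp: sets_vimage_algebra2)
  have "prob ((sample_path W -` S \<inter> space M) \<inter> D) = prob (sample_path W -` S \<inter> space M) * prob D"
    using indep S A unfolding indep_processes_def indep_var_eq indep_sets2_eq by blast
  moreover have "(sample_path W -` S \<inter> space M) \<inter> D = sample_path W -` S \<inter> D" using A(2) by auto
  ultimately show ?thesis by simp
qed

lemma AE_integrable: "AE \<omega> in M. set_integrable lborel {0..1} (\<lambda>s. Y s \<omega>)"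
proof -
  have "AE \<omega> in M. set_integrable lborel {0..1} (\<lambda>t. (Y t \<omega>)\<^sup>2)" using L2 by (simp add: L2_process_def)
  then show ?thesis using AE_space
  proof eventually_elim
    case (elim \<omega>)
    have [measurable]: "(\<lambda>s. Yc s \<omega>) \<in> borel_measurable borel" using elim by measurable
    have 1: "integrable lborel (\<lambda>s. indicator {0..1} s * (Y s \<omega>)\<^sup>2)"
      using elim(1) by (simp add: set_integrable_def)
    have 2: "integrable lborel (\<lambda>s::real. indicator {0..1} s :: real)"
      by (rule integrable_real_indicator) auto
    have "integrable lborel (\<lambda>s. indicator {0..1} s * Yc s \<omega>)"
    proof (rule Bochner_Integration.integrable_bound[OF Bochner_Integration.integrable_add[OF 1 2]])
      show "AE s in lborel. norm (indicator {0..1} s * Yc s \<omega>) \<le> norm (indicator {0..1} s * (Y s \<omega>)\<^sup>2 + indicator {0..1} s)"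
      proof (rule AE_I2)
        fix s :: real
        have "\<bar>Yc s \<omega>\<bar> \<le> (Yc s \<omega>)\<^sup>2 + 1"
          using zero_le_power2[of "\<bar>Yc s \<omega>\<bar> - 1/2"] by (simp add: power2_eq_square algebra_simps)
        then show "norm (indicator {0..1} s * Yc s \<omega>) \<le> norm (indicator {0..1} s * (Y s \<omega>)\<^sup>2 + indicator {0..1} s)"
          using Yc_eq[of s \<omega>] by (auto simp: indicator_def)
      qed
    qed measurable
    moreover have "(\<lambda>s. indicator {0..1} s * Yc s \<omega>) = (\<lambda>s. indicator {0..1} s * Y s \<omega>)"
      by (auto simp: fun_eq_iff indicator_def Yc_eq)
    ultimately show ?case by (simp add: set_integrable_def)
  qed
qed

lemma set_integral_Yc:
  "(LINT s:{0..1}|lborel. g s * Y s \<omega>) = (LINT s:{0..1}|lborel. g s * Yc s \<omega>)"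
  by (rule set_lebesgue_integral_cong) (auto simp: Yc_eq)

text \<open>The bounded variable \<open>X = \<integral>\<^sub>0\<^sup>1 g(s) Z\<^sub>s ds\<close> of a jointly measurable \<open>Z\<close> with \<open>G\<close>-measurable marginals
  agrees almost surely with its conditional expectation: by Fubini, \<open>D = X - E(X | G)\<close> is orthogonal to \<open>X\<close> because it is
  orthogonal to every \<open>Z\<^sub>s\<close>.\<close>

lemma bounded_filter_integral_G:
  fixes Z :: "real \<Rightarrow> 'w \<Rightarrow> real" and g :: "real \<Rightarrow> real"
  assumes Z: "(\<lambda>p. Z (snd p) (fst p)) \<in> borel_measurable (M \<Otimes>\<^sub>M borel)" and ZG: "\<And>s. Z s \<in> borel_measurable G"
    and Zb: "\<And>s \<omega>. \<bar>Z s \<omega>\<bar> \<le> K" and g[measurable]: "g \<in> borel_measurable borel" and gb: "\<And>s. \<bar>g s\<bar> \<le> m"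
  shows "AE \<omega> in M. real_cond_exp M G (\<lambda>\<omega>. LINT s:{0..1}|lborel. g s * Z s \<omega>) \<omega> = (LINT s:{0..1}|lborel. g s * Z s \<omega>)"
proof -
  interpret sigma_finite_subalgebra M G
    by (rule finite_measure_subalgebra_is_sigma_finite)
      (simp add: finite_measure_subalgebra_def finite_measure_subalgebra_axioms_def subalgebra_G finite_measure_axioms)
  have [measurable]: "(\<lambda>p. Z (snd p) (fst p)) \<in> borel_measurable (M \<Otimes>\<^sub>M lborel)"
    using Z by (simp cong: measurable_cong_sets)
  have [measurable]: "Z s \<in> borel_measurable M" for s using measurable_from_subalg[OF subalgebra_G ZG] .
  have m0: "m \<ge> 0" using order_trans[OF abs_ge_zero gb[of 0]] .
  have K0: "K \<ge> 0" using order_trans[OF abs_ge_zero Zb[of 0 undefined]] .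
  define X where "X \<omega> = (LINT s:{0..1}|lborel. g s * Z s \<omega>)" for \<omega>
  have X2: "X \<omega> = (LINT s|lborel. indicator {0..1} s * (g s * Z s \<omega>))" for \<omega>
    by (simp add: X_def set_lebesgue_integral_def)
  have [measurable]: "X \<in> borel_measurable M"
  proof -
    have "(\<lambda>p. indicator {0..1} (snd p) * (g (snd p) * Z (snd p) (fst p))) \<in> borel_measurable (M \<Otimes>\<^sub>M lborel)"
      by measurable
    then have "(\<lambda>\<omega>. LINT s|lborel. indicator {0..1} s * (g s * Z s \<omega>)) \<in> borel_measurable M"
      by (intro lborel.borel_measurable_lebesgue_integral) (simp add: case_prod_unfold)
    then show ?thesis by (simp add: X2[abs_def])
  qed
  have i01: "integrable lborel (\<lambda>s::real. indicator {0..1} s :: real)"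
    by (rule integrable_real_indicator) auto
  have bnd: "\<bar>indicator {0..1} s * (g s * Z s \<omega>)\<bar> \<le> indicator {0..1} s * (m * K)" for s \<omega>
    using mult_mono[OF gb[of s] Zb[of s \<omega>]] m0 by (auto simp: indicator_def abs_mult)
  have Xb: "\<bar>X \<omega>\<bar> \<le> m * K" if "\<omega> \<in> space M" for \<omega>
  proof -
    have 1: "integrable lborel (\<lambda>s::real. indicator {0..1} s * (m * K))"
      using i01 by (rule integrable_mult_left)
    have "(\<lambda>s. Z s \<omega>) \<in> borel_measurable lborel"
      using measurable_compose[OF measurable_Pair1'[OF that] , of "\<lambda>p. Z (snd p) (fst p)" lborel borel] by simp
    then have "(\<lambda>s. indicator {0..1} s * (g s * Z s \<omega>)) \<in> borel_measurable lborel" by measurable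
    then have 2: "integrable lborel (\<lambda>s. indicator {0..1} s * (g s * Z s \<omega>))"
      by (rule Bochner_Integration.integrable_bound[OF 1])
        (intro AE_I2, use order_trans[OF bnd abs_ge_self] in \<open>simp only: real_norm_def\<close>)
    have "norm (LINT s|lborel. indicator {0..1} s * (g s * Z s \<omega>)) \<le> (LINT s|lborel. norm (indicator {0..1} s * (g s * Z s \<omega>)))"
      by (rule integral_norm_bound)
    also have "\<dots> \<le> (LINT s::real|lborel. indicator {0..1} s * (m * K))"
    proof (rule integral_mono)
      show "integrable lborel (\<lambda>s. norm (indicator {0..1} s * (g s * Z s \<omega>)))" using 2 by (rule integrable_norm)
      show "norm (indicator {0..1} s * (g s * Z s \<omega>)) \<le> indicator {0..1} s * (m * K)" for s
        unfolding real_norm_def by (rule bnd)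
    qed (rule 1)
    also have "(LINT s::real|lborel. indicator {0..1} s * (m * K)) = m * K" by simp
    finally show ?thesis by (simp add: X2)
  qed
  have iX: "integrable M X"
    by (rule integrable_const_bound[where B="m * K"]) (use Xb in \<open>auto intro!: AE_I2\<close>)
  define R where "R = real_cond_exp M G X"
  have RG [measurable]: "R \<in> borel_measurable G" unfolding R_def by simp
  have [measurable]: "R \<in> borel_measurable M" using measurable_from_subalg[OF subalgebra_G RG] .
  have iR: "integrable M R" unfolding R_def using iX by (rule real_cond_exp_int(1))
  define D where "D \<omega> = X \<omega> - R \<omega>" for \<omega>
  have [measurable]: "D \<in> borel_measurable M" unfolding D_def by measurable
  have iD: "integrable M D" unfolding D_def using iX iR by (rule Bochner_Integration.integrable_diff)
  have iZX: "integrable M (\<lambda>\<omega>. Z s \<omega> * X \<omega>)" for s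
    by (rule integrable_const_bound[where B="K * (m * K)"])
      (auto intro!: AE_I2 mult_mono Zb Xb simp: abs_mult K0)
  \<comment> \<open>\<open>Z s\<close> is measurable for \<open>G\<close> and passes through the
    conditional expectation.\<close>
  have DZ: "(\<integral>\<omega>. D \<omega> * Z s \<omega> \<partial>M) = 0" for s
  proof -
    have "(\<integral>\<omega>. Z s \<omega> * R \<omega> \<partial>M) = (\<integral>\<omega>. Z s \<omega> * X \<omega> \<partial>M)" "integrable M (\<lambda>\<omega>. Z s \<omega> * R \<omega>)"
      unfolding R_def using real_cond_exp_intg[OF iZX ZG] by auto
    then show ?thesis using iZX[of s] by (simp add: D_def algebra_simps)
  qed
  interpret P: pair_sigma_finite M lborel ..
  have DX: "(\<integral>\<omega>. D \<omega> * X \<omega> \<partial>M) = 0"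
  proof -
    have b2: "\<bar>D \<omega> * (indicator {0..1} s * (g s * Z s \<omega>))\<bar> \<le> \<bar>D \<omega>\<bar> * (indicator {0..1} s * (m * K))" for s \<omega>
      unfolding abs_mult[of "D \<omega>"] by (rule mult_left_mono[OF bnd]) simp
    have int: "integrable (M \<Otimes>\<^sub>M lborel) (\<lambda>(\<omega>, s). D \<omega> * (indicator {0..1} s * (g s * Z s \<omega>)))"
    proof (rule Bochner_Integration.integrable_bound)
      show "integrable (M \<Otimes>\<^sub>M lborel) (\<lambda>(\<omega>, s :: real). \<bar>D \<omega>\<bar> * (indicator {0..1} s * (m * K)))"
      proof (rule P.Fubini_integrable)
        show "integrable M (\<lambda>x. LINT y|lborel. norm (case (x, y :: real) of (\<omega>, s) \<Rightarrow> \<bar>D \<omega>\<bar> * (indicator {0..1} s * (m * K))))"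
          using iD m0 K0 by (simp add: abs_mult)
        show "AE x in M. integrable lborel (\<lambda>y :: real. case (x, y) of (\<omega>, s) \<Rightarrow> \<bar>D \<omega>\<bar> * (indicator {0..1} s * (m * K)))"
          by (auto intro!: AE_I2 integrable_mult_left i01)
      qed measurable
      show "AE x in M \<Otimes>\<^sub>M lborel. norm (case x of (\<omega>, s) \<Rightarrow> D \<omega> * (indicator {0..1} s * (g s * Z s \<omega>))) \<le>
          norm (case x of (\<omega>, s) \<Rightarrow> \<bar>D \<omega>\<bar> * (indicator {0..1} s * (m * K)))"
        by (intro AE_I2) (auto intro!: order_trans[OF b2])
      show "(\<lambda>(\<omega>, s). D \<omega> * (indicator {0..1} s * (g s * Z s \<omega>))) \<in> borel_measurable (M \<Otimes>\<^sub>M lborel)"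
        unfolding case_prod_unfold by measurable
    qed
    have "(\<integral>\<omega>. D \<omega> * X \<omega> \<partial>M) = (\<integral>\<omega>. (LINT s|lborel. D \<omega> * (indicator {0..1} s * (g s * Z s \<omega>))) \<partial>M)"
      unfolding X2 by simp
    also have "\<dots> = (LINT s|lborel. (\<integral>\<omega>. D \<omega> * (indicator {0..1} s * (g s * Z s \<omega>)) \<partial>M))"
      by (rule P.Fubini_integral[OF int, symmetric])
    also have "\<dots> = (LINT s|lborel. indicator {0..1} s * g s * (\<integral>\<omega>. D \<omega> * Z s \<omega> \<partial>M))"
      by (intro Bochner_Integration.integral_cong refl) (simp flip: integral_mult_right_zero add: ac_simps)
    finally show ?thesis by (simp add: DZ)
  qed
  have iRX: "integrable M (\<lambda>\<omega>. R \<omega> * X \<omega>)"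
  proof (rule Bochner_Integration.integrable_bound)
    show "integrable M (\<lambda>\<omega>. R \<omega> * (m * K))" using iR by (rule integrable_mult_left)
    show "AE x in M. norm (R x * X x) \<le> norm (R x * (m * K))"
    proof (rule AE_I2)
      fix x assume "x \<in> space M"
      then have "\<bar>X x\<bar> \<le> \<bar>m * K\<bar>" using Xb[of x] by linarith
      then show "norm (R x * X x) \<le> norm (R x * (m * K))" by (simp only: real_norm_def abs_mult) (simp add: mult_left_mono abs_mult)
    qed
  qed measurable
  have RR: "(\<integral>\<omega>. R \<omega> * R \<omega> \<partial>M) = (\<integral>\<omega>. R \<omega> * X \<omega> \<partial>M)" "integrable M (\<lambda>\<omega>. R \<omega> * R \<omega>)"
    using real_cond_exp_intg[OF iRX RG] unfolding R_def by auto
  have iXX: "integrable M (\<lambda>\<omega>. X \<omega> * X \<omega>)"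
  proof (rule integrable_const_bound[where B="m * K * (m * K)"])
    show "AE \<omega> in M. norm (X \<omega> * X \<omega>) \<le> m * K * (m * K)"
    proof (rule AE_I2)
      fix \<omega> assume "\<omega> \<in> space M"
      then have "\<bar>X \<omega>\<bar> * \<bar>X \<omega>\<bar> \<le> m * K * (m * K)" using Xb m0 K0 by (intro mult_mono) auto
      then show "norm (X \<omega> * X \<omega>) \<le> m * K * (m * K)" by simp
    qed
  qed measurable
  \<comment> \<open>The square of \<open>D\<close> is \<open>D * X - D * R\<close>. The first part
    has integral 0 by \<open>DX\<close>, the second by \<open>RR\<close>, as \<open>R\<close> is
    measurable for \<open>G\<close>.\<close>
  have DD: "(\<lambda>\<omega>. (D \<omega>)\<^sup>2) = (\<lambda>\<omega>. D \<omega> * X \<omega> - (R \<omega> * X \<omega> - R \<omega> * R \<omega>))"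
    by (simp add: fun_eq_iff D_def power2_eq_square algebra_simps)
  have iDX: "integrable M (\<lambda>\<omega>. D \<omega> * X \<omega>)"
    using Bochner_Integration.integrable_diff[OF iXX iRX] by (simp add: D_def algebra_simps)
  have iDD: "integrable M (\<lambda>\<omega>. (D \<omega>)\<^sup>2)"
    unfolding DD by (intro Bochner_Integration.integrable_diff iDX iRX RR)
  have "(\<integral>\<omega>. (D \<omega>)\<^sup>2 \<partial>M) = 0"
    unfolding DD using iDX iRX RR DX by (simp add: Bochner_Integration.integrable_diff)
  then have "AE \<omega> in M. (D \<omega>)\<^sup>2 = 0"
    using integral_nonneg_eq_0_iff_AE[OF iDD] by simp
  then have "AE \<omega> in M. real_cond_exp M G X \<omega> = X \<omega>"
    by eventually_elim (simp add: D_def R_def)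
  then show ?thesis by (simp only: X_def[abs_def])
qed

text \<open>Truncating \<open>Y\<close> at level \<open>K\<close> makes
  \<open>bounded_filter_integral_G\<close> applicable, and dominated convergence recovers the
  integral for almost every path. The limit is taken over the conditional expectations, which are
  measurable for \<open>G\<close>; countably many null sets are discarded.\<close>

lemma filter_integral_G:
  assumes g[measurable]: "g \<in> borel_measurable borel" and gb: "\<And>s. \<bar>g s\<bar> \<le> m"
  shows "\<exists>C\<in>borel_measurable G. AE \<omega> in M. C \<omega> = (LINT s:{0..1}|lborel. g s * Y s \<omega>)"
proof -
  define Z where "Z K s \<omega> = max (- real K) (min (real K) (Yc s \<omega>))" for K s \<omega>
  define X where "X K \<omega> = (LINT s:{0..1}|lborel. g s * Z K s \<omega>)" for K \<omega>
  have YcG: "Yc s \<in> borel_measurable G" for s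
    using Y_measurable_G[of "max 0 (min 1 s)"] by (simp add: Yc_def[abs_def])
  have "AE \<omega> in M. real_cond_exp M G (X K) \<omega> = X K \<omega>" for K
    unfolding X_def[abs_def]
  proof (rule bounded_filter_integral_G[where K="real K" and m=m])
    show "(\<lambda>p. Z K (snd p) (fst p)) \<in> borel_measurable (M \<Otimes>\<^sub>M borel)" unfolding Z_def using measurable_Yc by measurable
    show "Z K s \<in> borel_measurable G" for s unfolding Z_def[abs_def] using YcG[of s] by measurable
  qed (use gb in \<open>auto simp: Z_def\<close>)
  then have ae: "AE \<omega> in M. \<forall>K. real_cond_exp M G (X K) \<omega> = X K \<omega>" by (simp add: AE_all_countable)
  define C where "C \<omega> = lim (\<lambda>K. real_cond_exp M G (X K) \<omega>)" for \<omega>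
  have "C \<in> borel_measurable G" unfolding C_def[abs_def]
    by (rule borel_measurable_lim_metric) simp
  moreover have "AE \<omega> in M. C \<omega> = (LINT s:{0..1}|lborel. g s * Y s \<omega>)"
    using ae AE_integrable AE_space
  proof eventually_elim
    case (elim \<omega>)
    have [measurable]: "(\<lambda>s. Yc s \<omega>) \<in> borel_measurable borel" using elim(3) by measurable
    have int: "integrable lborel (\<lambda>s. indicator {0..1} s * Y s \<omega>)" using elim(2) by (simp add: set_integrable_def)
    have "(\<lambda>K. X K \<omega>) \<longlonglongrightarrow> (LINT s:{0..1}|lborel. g s * Yc s \<omega>)"
      unfolding X_def set_lebesgue_integral_def
    proof (rule integral_dominated_convergence[where w="\<lambda>s. m * norm (indicator {0..1} s * Y s \<omega>)"])
      show "integrable lborel (\<lambda>s. m * norm (indicator {0..1} s * Y s \<omega>))"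
        using int by (intro integrable_mult_right integrable_norm)
      show "AE s in lborel. (\<lambda>K. indicator {0..1} s *\<^sub>R (g s * Z K s \<omega>)) \<longlonglongrightarrow> indicator {0..1} s *\<^sub>R (g s * Yc s \<omega>)"
      proof (rule AE_I2)
        fix s
        have "eventually (\<lambda>K. Z K s \<omega> = Yc s \<omega>) sequentially"
          using eventually_ge_at_top[of "nat \<lceil>\<bar>Yc s \<omega>\<bar>\<rceil>"]
        proof eventually_elim
          case (elim K)
          then have "\<bar>Yc s \<omega>\<bar> \<le> real K" by linarith
          then show ?case by (simp add: Z_def)
        qed
        then have "(\<lambda>K. Z K s \<omega>) \<longlonglongrightarrow> Yc s \<omega>" by (rule tendsto_eventually)
        then show "(\<lambda>K. indicator {0..1} s *\<^sub>R (g s * Z K s \<omega>)) \<longlonglongrightarrow> indicator {0..1} s *\<^sub>R (g s * Yc s \<omega>)"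
          by (intro tendsto_intros)
      qed
      show "AE s in lborel. norm (indicator {0..1} s *\<^sub>R (g s * Z K s \<omega>)) \<le> m * norm (indicator {0..1} s * Y s \<omega>)" for K
      proof (rule AE_I2)
        fix s
        have "\<bar>Z K s \<omega>\<bar> \<le> \<bar>Yc s \<omega>\<bar>" by (auto simp: Z_def)
        then have "\<bar>g s * Z K s \<omega>\<bar> \<le> m * \<bar>Yc s \<omega>\<bar>"
          using gb[of s] unfolding abs_mult by (intro mult_mono) auto
        then show "norm (indicator {0..1} s *\<^sub>R (g s * Z K s \<omega>)) \<le> m * norm (indicator {0..1} s * Y s \<omega>)"
          using Yc_eq[of s \<omega>] by (auto simp: indicator_def)
      qed
    qed (auto simp: Z_def)
    then show ?case using elim(1) set_integral_Yc[of g \<omega>] by (simp add: C_def limI)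
  qed
  ultimately show ?thesis by blast
qed

end

section \<open>Convolution with the filter and comparison of two hypotheses\<close>

context filter_model
begin

text \<open>With \<open>sinY\<close>, the real coordinates of the Fourier coefficient of the filter:
  for an integrable path it is \<open>cosY l - i * sinY l\<close>, with \<open>i\<close> the
  imaginary unit.\<close>

definition cosY :: "nat \<Rightarrow> 'w \<Rightarrow> real" where
  "cosY l \<omega> = (LINT s:{0..1}|lborel. cos (2 * pi * real l * s) * Y s \<omega>)"

definition sinY :: "nat \<Rightarrow> 'w \<Rightarrow> real" where
  "sinY l \<omega> = (LINT s:{0..1}|lborel. sin (2 * pi * real l * s) * Y s \<omega>)"

lemma set_integrable_bounded_mult:
  fixes y g :: "real \<Rightarrow> real"
  assumes y: "set_integrable lborel {0..1} y" and g: "g \<in> borel_measurable borel" "\<And>s. \<bar>g s\<bar> \<le> 1"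
  shows "set_integrable lborel {0..1} (\<lambda>s. g s * y s)"
proof -
  have y': "integrable lborel (\<lambda>s. indicator {0..1} s * y s)" using y by (simp add: set_integrable_def)
  have [measurable]: "(\<lambda>s. indicator {0..1} s * y s) \<in> borel_measurable lborel" using y' by (rule borel_measurable_integrable)
  have "integrable lborel (\<lambda>s. g s * (indicator {0..1} s * y s))"
  proof (rule Bochner_Integration.integrable_bound[OF y'])
    show "AE s in lborel. norm (g s * (indicator {0..1} s * y s)) \<le> norm (indicator {0..1} s * y s)"
    proof (rule AE_I2)
      fix s
      show "norm (g s * (indicator {0..1} s * y s)) \<le> norm (indicator {0..1} s * y s)"
        using mult_right_mono[OF g(2)[of s], of "\<bar>indicator {0..1} s * y s\<bar>"] by (simp add: abs_mult)
    qed
    show "(\<lambda>s. g s * (indicator {0..1} s * y s)) \<in> borel_measurable lborel"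
      using g(1) by measurable
  qed
  then show ?thesis by (simp add: set_integrable_def mult.left_commute)
qed

text \<open>Convolution multiplies each frequency by the Fourier coefficient of \<open>y\<close>; in
  real coordinates this is the product of \<open>A - i * B\<close> and
  \<open>c - i * d\<close>.\<close>

lemma convolve_trig_poly:
  assumes y: "set_integrable lborel {0..1} y" and L: "finite L"
  defines "c \<equiv> \<lambda>l. (LINT s:{0..1}|lborel. cos (2 * pi * real l * s) * y s)"
    and "d \<equiv> \<lambda>l. (LINT s:{0..1}|lborel. sin (2 * pi * real l * s) * y s)"
  shows "convolve (trig_poly L A B) y u = trig_poly L (\<lambda>l. A l * c l - B l * d l) (\<lambda>l. A l * d l + B l * c l) u"
proof -
  have ic: "set_integrable lborel {0..1} (\<lambda>s. cos (2 * pi * real l * s) * y s)"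
    and id: "set_integrable lborel {0..1} (\<lambda>s. sin (2 * pi * real l * s) * y s)" for l
    by (rule set_integrable_bounded_mult[OF y]; simp)+
  let ?c = "\<lambda>l. cos (2 * pi * real l * u)" and ?s = "\<lambda>l. sin (2 * pi * real l * u)"
  have e: "trig_poly L A B (u - s) * y s = (\<Sum>l\<in>L. (A l * ?c l + B l * ?s l) * (cos (2 * pi * real l * s) * y s) +
      (A l * ?s l - B l * ?c l) * (sin (2 * pi * real l * s) * y s))" for s
  proof -
    have "2 * pi * real l * (u - s) = 2 * pi * real l * u - 2 * pi * real l * s" for l by (simp add: algebra_simps)
    then show ?thesis
      unfolding trig_poly_def sum_distrib_right
      by (intro sum.cong refl) (simp only: cos_diff sin_diff, simp add: algebra_simps)
  qed
  have "convolve (trig_poly L A B) y u = (\<Sum>l\<in>L. (A l * ?c l + B l * ?s l) * c l + (A l * ?s l - B l * ?c l) * d l)"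
  proof -
    let ?C = "\<lambda>l s. indicator {0..1} s * (cos (2 * pi * real l * s) * y s)"
    let ?S = "\<lambda>l s. indicator {0..1} s * (sin (2 * pi * real l * s) * y s)"
    have ic': "integrable lborel (?C l)" and id': "integrable lborel (?S l)" for l
      using ic[of l] id[of l] by (simp_all add: set_integrable_def)
    have "convolve (trig_poly L A B) y u =
        (LINT s|lborel. (\<Sum>l\<in>L. (A l * ?c l + B l * ?s l) * ?C l s + (A l * ?s l - B l * ?c l) * ?S l s))"
      unfolding convolve_def set_lebesgue_integral_def e real_scaleR_def sum_distrib_left
      by (intro Bochner_Integration.integral_cong sum.cong refl) (simp only: distrib_left mult.left_commute)
    also have "\<dots> = (\<Sum>l\<in>L. LINT s|lborel. (A l * ?c l + B l * ?s l) * ?C l s + (A l * ?s l - B l * ?c l) * ?S l s)"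
      by (intro Bochner_Integration.integral_sum Bochner_Integration.integrable_add integrable_mult_right ic' id')
    also have "\<dots> = (\<Sum>l\<in>L. (A l * ?c l + B l * ?s l) * c l + (A l * ?s l - B l * ?c l) * d l)"
      unfolding c_def d_def set_lebesgue_integral_def real_scaleR_def
      by (intro sum.cong refl, subst Bochner_Integration.integral_add) (auto intro!: integrable_mult_right ic' id')
    finally show ?thesis .
  qed
  also have "\<dots> = trig_poly L (\<lambda>l. A l * c l - B l * d l) (\<lambda>l. A l * d l + B l * c l) u"
    unfolding trig_poly_def by (intro sum.cong refl) (simp add: algebra_simps)
  finally show ?thesis .
qed

lemma measurable_observation:
  assumes f: "continuous_on UNIV f"
  shows "observation W Y \<sigma> x0 n f \<in> measurable M observation_space"
proof -
  have [measurable]: "f \<in> borel_measurable borel" using f by (rule borel_measurable_continuous_onI)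
  have H: "(\<lambda>\<omega>. LINT u:{0..t}|lborel. convolve f (\<lambda>s. Y s \<omega>) u) \<in> borel_measurable M" for t
  proof -
    have c: "convolve f (\<lambda>s. Y s \<omega>) u = (LINT s|lborel. indicator {0..1} s * (f (u - s) * Yc s \<omega>))" for \<omega> u
      unfolding convolve_def set_integral_Yc by (simp add: set_lebesgue_integral_def)
    have "(\<lambda>q. indicator {0..1} (snd q) * (f (snd (fst q) - snd q) * Yc (snd q) (fst (fst q)))) \<in> borel_measurable ((M \<Otimes>\<^sub>M lborel) \<Otimes>\<^sub>M lborel)"
      by measurable
    then have "(\<lambda>p. LINT s|lborel. indicator {0..1} s * (f (snd p - s) * Yc s (fst p))) \<in> borel_measurable (M \<Otimes>\<^sub>M lborel)"
      by (intro lborel.borel_measurable_lebesgue_integral) (simp add: case_prod_unfold)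
    then have [measurable]: "(\<lambda>p. convolve f (\<lambda>s. Y s (fst p)) (snd p)) \<in> borel_measurable (M \<Otimes>\<^sub>M lborel)"
      unfolding c .
    have "(\<lambda>p. indicator {0..t} (snd p) * convolve f (\<lambda>s. Y s (fst p)) (snd p)) \<in> borel_measurable (M \<Otimes>\<^sub>M lborel)"
      by measurable
    then have "(\<lambda>\<omega>. LINT u|lborel. indicator {0..t} u * convolve f (\<lambda>s. Y s \<omega>) u) \<in> borel_measurable M"
      by (intro lborel.borel_measurable_lebesgue_integral) (simp add: case_prod_unfold)
    then show ?thesis by (simp add: set_lebesgue_integral_def)
  qed
  show ?thesis
    unfolding observation_def observation_space_def
  proof (rule measurable_restrict)
    fix t :: real assume t: "t \<in> {0..1}"
    then have [measurable]: "Y t \<in> borel_measurable M" "W t \<in> borel_measurable M"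
      using measurable_from_subalg[OF subalgebra_G Y_measurable_G] W unfolding standard_wiener_def by auto
    show "(\<lambda>\<omega>. (observed_process W Y \<sigma> x0 n f t \<omega>, Y t \<omega>)) \<in> borel_measurable M"
      unfolding observed_process_def using H[of t] by measurable
  qed
qed

lemma integral_Complex:
  fixes f g :: "real \<Rightarrow> real"
  assumes "integrable lborel f" "integrable lborel g"
  shows "(LINT t|lborel. complex_of_real (f t) - \<i> * complex_of_real (g t)) = Complex (LINT t|lborel. f t) (- (LINT t|lborel. g t))"
  using assms by (subst Bochner_Integration.integral_diff) (auto simp: complex_eq_iff)

lemma dyadic_energy_eq:
  assumes y: "set_integrable lborel {0..1} (\<lambda>s. Y s \<omega>)"
  shows "(\<Sum>l\<in>{2 ^ j..<2 ^ (j + 1)}. (cosY l \<omega>)\<^sup>2 + (sinY l \<omega>)\<^sup>2) = 2 ^ j * dyadic_energy (\<lambda>t. Y t \<omega>) j"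
proof -
  have fc: "(cmod (fourier_coeff (\<lambda>t. Y t \<omega>) (int l)))\<^sup>2 = (cosY l \<omega>)\<^sup>2 + (sinY l \<omega>)\<^sup>2" for l
  proof -
    have ic: "integrable lborel (\<lambda>s. indicator {0..1} s * (cos (2 * pi * real l * s) * Y s \<omega>))"
      and id: "integrable lborel (\<lambda>s. indicator {0..1} s * (sin (2 * pi * real l * s) * Y s \<omega>))"
      using set_integrable_bounded_mult[OF y, of "\<lambda>s. cos (2 * pi * real l * s)"]
        set_integrable_bounded_mult[OF y, of "\<lambda>s. sin (2 * pi * real l * s)"]
      by (auto simp: set_integrable_def)
    let ?h = "\<lambda>t. complex_of_real (indicator {0..1} t * (cos (2 * pi * real l * t) * Y t \<omega>)) -
        \<i> * complex_of_real (indicator {0..1} t * (sin (2 * pi * real l * t) * Y t \<omega>))"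
    have "fourier_coeff (\<lambda>t. Y t \<omega>) (int l) = (LINT t|lborel. ?h t)"
      unfolding fourier_coeff_def set_lebesgue_integral_def
      by (intro Bochner_Integration.integral_cong refl)
        (simp add: cis.ctr complex_eq_iff indicator_def mult.commute)
    also have "\<dots> = Complex (cosY l \<omega>) (- sinY l \<omega>)"
      unfolding cosY_def sinY_def set_lebesgue_integral_def real_scaleR_def by (rule integral_Complex[OF ic id])
    finally show ?thesis by (simp only: cmod_power2 complex.sel power2_minus)
  qed
  have "(\<Sum>l = 2 ^ j..2 ^ (j + 1) - 1. (cmod (fourier_coeff (\<lambda>t. Y t \<omega>) l))\<^sup>2) =
      (\<Sum>l\<in>{2 ^ j..<2 ^ (j + 1)}. (cmod (fourier_coeff (\<lambda>t. Y t \<omega>) (int l)))\<^sup>2)"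
  proof (rule sum.reindex_bij_witness[of _ int nat])
    fix l :: int assume l: "l \<in> {2 ^ j..2 ^ (j + 1) - 1}"
    then have l0: "l \<ge> 0" using zero_le_power[of "2::int" j] by (auto intro: order_trans)
    then show "int (nat l) = l" by simp
    have "int (2 ^ j) \<le> int (nat l)" "int (nat l) < int (2 ^ (j + 1))" using l l0 by auto
    then show "nat l \<in> {2 ^ j..<2 ^ (j + 1)}" by (simp only: of_nat_le_iff of_nat_less_iff) simp
    show "(cmod (fourier_coeff (\<lambda>t. Y t \<omega>) (int (nat l))))\<^sup>2 = (cmod (fourier_coeff (\<lambda>t. Y t \<omega>) l))\<^sup>2" using l0 by simp
  next
    fix l :: nat assume "l \<in> {2 ^ j..<2 ^ (j + 1)}"
    then have "int (2 ^ j) \<le> int l" "int l < int (2 ^ (j + 1))" by (simp_all only: of_nat_le_iff of_nat_less_iff) simp_all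
    then show "int l \<in> {2 ^ j..2 ^ (j + 1) - 1}" by simp
  qed simp_all
  then show ?thesis by (simp add: dyadic_energy_def fc)
qed

text \<open>The first term bounds, by Markov's inequality, the probability that the filter amplifies
  the difference of the hypotheses beyond the energy level \<open>b\<close>; the rest is
  \<open>prob_shifted_path_le\<close> on the complement.\<close>

lemma observation_test:
  assumes Clow: "\<And>j. (\<integral>\<^sup>+\<omega>. ennreal (dyadic_energy (\<lambda>t. Y t \<omega>) j) \<partial>M) \<le> ennreal (C * 2 powr (- 2 * \<nu> * real j))"
    and C: "C > 0" and n: "n > 0" and \<gamma>: "\<gamma> \<ge> 0"
    and diff: "\<And>l. l \<in> {2 ^ j..<2 ^ (j + 1)} \<Longrightarrow> (A l - A' l)\<^sup>2 + (B l - B' l)\<^sup>2 \<le> \<gamma>\<^sup>2"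
    and b: "b > 0" and \<theta>: "\<theta> > 0" and S: "S \<in> sets observation_space"
  shows "prob {\<omega>\<in>space M. observation W Y \<sigma> x0 n (trig_poly {2 ^ j..<2 ^ (j + 1)} A B) \<omega> \<in> S} \<le>
    \<gamma>\<^sup>2 * 2 ^ j * C * 2 powr (- 2 * \<nu> * real j) * real n / (2 * \<sigma>\<^sup>2 * b) + exp b / \<theta> +
    \<theta> * prob {\<omega>\<in>space M. observation W Y \<sigma> x0 n (trig_poly {2 ^ j..<2 ^ (j + 1)} A' B') \<omega> \<in> S}"
proof -
  define L where "L = {2 ^ j..<2 ^ (j + 1) :: nat}"
  have L: "finite L" "0 \<notin> L" by (auto simp: L_def)
  define \<kappa> where "\<kappa> = \<sigma> * real n powr (- 1 / 2)"
  have \<kappa>: "\<kappa> > 0" using \<sigma> n by (simp add: \<kappa>_def)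
  have \<kappa>2: "\<kappa>\<^sup>2 = \<sigma>\<^sup>2 / real n"
  proof -
    have "(real n powr (- 1 / 2))\<^sup>2 = real n powr (- 1)" using n by (simp add: power2_eq_square flip: powr_add)
    also have "\<dots> = 1 / real n" using n by (simp add: powr_minus_divide)
    finally show ?thesis unfolding \<kappa>_def power_mult_distrib by simp
  qed
  have "\<exists>c\<in>borel_measurable G. AE \<omega> in M. c \<omega> = cosY l \<omega>" for l
    unfolding cosY_def by (rule filter_integral_G[where m=1]) auto
  then obtain c where cG: "\<And>l. c l \<in> borel_measurable G" and cE: "\<And>l. AE \<omega> in M. c l \<omega> = cosY l \<omega>" by metis
  have "\<exists>c\<in>borel_measurable G. AE \<omega> in M. c \<omega> = sinY l \<omega>" for l
    unfolding sinY_def by (rule filter_integral_G[where m=1]) auto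
  then obtain d where dG: "\<And>l. d l \<in> borel_measurable G" and dE: "\<And>l. AE \<omega> in M. d l \<omega> = sinY l \<omega>" by metis
  have cd: "AE \<omega> in M. \<forall>l. c l \<omega> = cosY l \<omega> \<and> d l \<omega> = sinY l \<omega>"
    using cE dE by (simp add: AE_all_countable)
  \<comment> \<open>The drifts are built from the versions \<open>c\<close> and \<open>d\<close>,
    because \<open>shifted_wiener\<close> asks for drifts that are measurable for \<open>G\<close>
    and not only up to null sets.\<close>
  define h where "h A B \<omega> = trig_poly L (\<lambda>l. A l * c l \<omega> - B l * d l \<omega>) (\<lambda>l. A l * d l \<omega> + B l * c l \<omega>)" for A B \<omega>
  define H where "H A B t \<omega> = integral {0..t} (h A B \<omega>)" for A B t \<omega>
  define en where "en \<omega> = (\<Sum>l\<in>L. (c l \<omega>)\<^sup>2 + (d l \<omega>)\<^sup>2)" for \<omega>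
  \<comment> \<open>The factor 1/2 is the mean of a squared cosine, from
    \<open>trig_poly_parseval\<close>.\<close>
  define E where "E = {\<omega>\<in>space M. \<gamma>\<^sup>2 / 2 * en \<omega> \<le> \<kappa>\<^sup>2 * b}"
  have spG: "space G = space M" using subalgebra_G by (simp add: subalgebra_def)
  have enG: "en \<in> borel_measurable G" unfolding en_def[abs_def] using cG dG by measurable
  have EG: "E \<in> sets G" unfolding E_def spG[symmetric] using enG by measurable
  have HG: "H A B t \<in> borel_measurable G" for A B t
  proof -
    have eq: "H A B t = (\<lambda>\<omega>. \<Sum>l\<in>L. (A l * c l \<omega> - B l * d l \<omega>) * integral {0..t} (\<lambda>x. cos (2 * pi * real l * x)) +
       (A l * d l \<omega> + B l * c l \<omega>) * integral {0..t} (\<lambda>x. sin (2 * pi * real l * x)))"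
      unfolding H_def h_def trig_poly_def fun_eq_iff
      by (intro allI integral_unique has_integral_sum has_integral_add has_integral_mult_right integrable_integral
          integrable_continuous_interval continuous_intros L)
    note [measurable] = cG dG
    show ?thesis unfolding eq by measurable
  qed
  have ener: "(\<Sum>i<m. ((H A B (\<tau> (Suc i)) \<omega> - H A' B' (\<tau> (Suc i)) \<omega>) - (H A B (\<tau> i) \<omega> - H A' B' (\<tau> i) \<omega>))\<^sup>2 / (\<tau> (Suc i) - \<tau> i)) \<le> \<kappa>\<^sup>2 * b"
    if \<omega>: "\<omega> \<in> E" and \<tau>: "\<And>i. i \<le> m \<Longrightarrow> \<tau> i \<in> {0..1}" "\<And>i. i < m \<Longrightarrow> \<tau> i < \<tau> (Suc i)" for \<omega> \<tau> m
  proof -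
    let ?a = "\<lambda>l. (A l - A' l) * c l \<omega> - (B l - B' l) * d l \<omega>" and ?b = "\<lambda>l. (A l - A' l) * d l \<omega> + (B l - B' l) * c l \<omega>"
    let ?h = "trig_poly L ?a ?b"
    have hd: "H A B t \<omega> - H A' B' t \<omega> = integral {0..t} ?h" for t
    proof -
      have "integral {0..t} (\<lambda>x. h A B \<omega> x - h A' B' \<omega> x) = H A B t \<omega> - H A' B' t \<omega>"
        unfolding H_def h_def
        by (intro Henstock_Kurzweil_Integration.integral_diff integrable_continuous_interval continuous_trig_poly)
      moreover have "(\<lambda>x. h A B \<omega> x - h A' B' \<omega> x) = ?h"
        by (simp add: fun_eq_iff h_def trig_poly_def sum_subtractf[symmetric] algebra_simps)
      ultimately show ?thesis by simp
    qed
    have "(\<Sum>i<m. ((H A B (\<tau> (Suc i)) \<omega> - H A' B' (\<tau> (Suc i)) \<omega>) - (H A B (\<tau> i) \<omega> - H A' B' (\<tau> i) \<omega>))\<^sup>2 / (\<tau> (Suc i) - \<tau> i)) \<le>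
        integral {0..1} (\<lambda>x. (?h x)\<^sup>2)"
      unfolding hd using \<tau> by (intro partition_energy_le continuous_trig_poly) auto
    also have "\<dots> = (\<Sum>l\<in>L. ((?a l)\<^sup>2 + (?b l)\<^sup>2) / 2)"
      by (rule integral_unique[OF trig_poly_parseval[OF L]])
    also have "\<dots> \<le> (\<Sum>l\<in>L. \<gamma>\<^sup>2 / 2 * ((c l \<omega>)\<^sup>2 + (d l \<omega>)\<^sup>2))"
    proof (rule sum_mono)
      fix l assume l: "l \<in> L"
      \<comment> \<open>The modulus of a product of complex numbers: coefficient difference times
        filter coefficient.\<close>
      have "(?a l)\<^sup>2 + (?b l)\<^sup>2 = ((A l - A' l)\<^sup>2 + (B l - B' l)\<^sup>2) * ((c l \<omega>)\<^sup>2 + (d l \<omega>)\<^sup>2)"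
        by (simp add: power2_eq_square algebra_simps)
      also have "\<dots> \<le> \<gamma>\<^sup>2 * ((c l \<omega>)\<^sup>2 + (d l \<omega>)\<^sup>2)"
        using diff[of l] l by (intro mult_right_mono) (auto simp: L_def)
      finally show "((?a l)\<^sup>2 + (?b l)\<^sup>2) / 2 \<le> \<gamma>\<^sup>2 / 2 * ((c l \<omega>)\<^sup>2 + (d l \<omega>)\<^sup>2)" by simp
    qed
    also have "\<dots> = \<gamma>\<^sup>2 / 2 * en \<omega>" by (simp add: en_def sum_distrib_left)
    also have "\<dots> \<le> \<kappa>\<^sup>2 * b" using \<omega> by (simp add: E_def)
    finally show ?thesis .
  qed
  interpret shifted_wiener M W G Y "H A B" "H A' B'" x0 \<kappa> b \<theta> E
  proof
    show "sample_path W \<in> measurable M (\<Pi>\<^sub>M t\<in>{0..1}. borel)" by (rule measurable_paths(1))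
  qed (use W subalgebra_G indep_G Y_measurable_G HG EG ener \<kappa> \<theta> in \<open>auto simp: H_def\<close>)
  have obs: "AE \<omega> in M. observation W Y \<sigma> x0 n (trig_poly L A B) \<omega> = shifted_path (H A B) \<omega>" for A B
    using cd AE_integrable
  proof eventually_elim
    case (elim \<omega>)
    have cv: "convolve (trig_poly L A B) (\<lambda>s. Y s \<omega>) = h A B \<omega>"
      using convolve_trig_poly[OF elim(2) L(1), of A B] elim(1) by (simp add: fun_eq_iff h_def cosY_def sinY_def)
    have "(LINT u:{0..t}|lborel. h A B \<omega> u) = integral {0..t} (h A B \<omega>)" for t
      unfolding h_def by (intro set_borel_integral_eq_integral borel_integrable_atLeastAtMost' continuous_trig_poly)
    then show ?case
      unfolding observation_def observed_process_def cv \<kappa>_def[symmetric]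
      by (simp add: shifted_path_def fun_eq_iff H_def)
  qed
  have mobs: "observation W Y \<sigma> x0 n (trig_poly L A B) \<in> measurable M observation_space" for A B
    by (rule measurable_observation[OF continuous_trig_poly])
  have mpath: "shifted_path (H A B) \<in> measurable M observation_space" for A B
    by (rule measurable_shifted_path[OF HG])
  have peq: "prob {\<omega>\<in>space M. observation W Y \<sigma> x0 n (trig_poly L A B) \<omega> \<in> S} = prob {\<omega>\<in>space M. shifted_path (H A B) \<omega> \<in> S}" for A B
  proof (rule measure_eq_AE)
    show "AE \<omega> in M. (\<omega> \<in> {\<omega>\<in>space M. observation W Y \<sigma> x0 n (trig_poly L A B) \<omega> \<in> S}) = (\<omega> \<in> {\<omega>\<in>space M. shifted_path (H A B) \<omega> \<in> S})"
      using obs[of A B] by eventually_elim auto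
    show "{\<omega>\<in>space M. observation W Y \<sigma> x0 n (trig_poly L A B) \<omega> \<in> S} \<in> sets M"
      using measurable_sets[OF mobs S, of A B] by (simp add: vimage_def Int_def conj_commute)
    show "{\<omega>\<in>space M. shifted_path (H A B) \<omega> \<in> S} \<in> sets M"
      using measurable_sets[OF mpath S, of A B] by (simp add: vimage_def Int_def conj_commute)
  qed
  have EM: "E \<in> sets M" using EG subalgebra_G by (auto simp: subalgebra_def)
  have enM: "en \<in> borel_measurable M" using measurable_from_subalg[OF subalgebra_G enG] .
  have en_int: "(\<integral>\<^sup>+\<omega>. ennreal (en \<omega>) \<partial>M) \<le> ennreal (2 ^ j * (C * 2 powr (- 2 * \<nu> * real j)))"
  proof -
    have "(\<integral>\<^sup>+\<omega>. ennreal (en \<omega>) \<partial>M) = (\<integral>\<^sup>+\<omega>. ennreal (2 ^ j) * ennreal (en \<omega> / 2 ^ j) \<partial>M)"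
      by (intro nn_integral_cong) (simp add: ennreal_mult'[symmetric])
    also have "\<dots> = ennreal (2 ^ j) * (\<integral>\<^sup>+\<omega>. ennreal (en \<omega> / 2 ^ j) \<partial>M)"
      by (intro nn_integral_cmult measurable_compose[OF _ measurable_ennreal] borel_measurable_divide enM borel_measurable_const)
    also have "(\<integral>\<^sup>+\<omega>. ennreal (en \<omega> / 2 ^ j) \<partial>M) = (\<integral>\<^sup>+\<omega>. ennreal (dyadic_energy (\<lambda>t. Y t \<omega>) j) \<partial>M)"
    proof (rule nn_integral_cong_AE)
      show "AE \<omega> in M. ennreal (en \<omega> / 2 ^ j) = ennreal (dyadic_energy (\<lambda>t. Y t \<omega>) j)"
        using cd AE_integrable
      proof eventually_elim
        case (elim \<omega>)
        then show ?case using dyadic_energy_eq[OF elim(2), of j] by (simp add: en_def L_def)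
      qed
    qed
    also have "ennreal (2 ^ j) * (\<integral>\<^sup>+\<omega>. ennreal (dyadic_energy (\<lambda>t. Y t \<omega>) j) \<partial>M) \<le> ennreal (2 ^ j) * ennreal (C * 2 powr (- 2 * \<nu> * real j))"
      by (intro mult_left_mono Clow) simp
    finally show ?thesis using C by (simp add: ennreal_mult')
  qed
  have PE: "prob (space M - E) \<le> \<gamma>\<^sup>2 * 2 ^ j * C * 2 powr (- 2 * \<nu> * real j) * real n / (2 * \<sigma>\<^sup>2 * b)"
  proof -
    have kb: "\<kappa>\<^sup>2 * b > 0" using \<kappa> b by simp
    have "ennreal (prob (space M - E)) = emeasure M (space M - E)" by (simp add: emeasure_eq_measure)
    also have "\<dots> \<le> emeasure M {\<omega>\<in>space M. 1 \<le> ennreal (\<gamma>\<^sup>2 / 2 / (\<kappa>\<^sup>2 * b)) * ennreal (en \<omega>)}"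
    proof (rule emeasure_mono)
      show "space M - E \<subseteq> {\<omega>\<in>space M. 1 \<le> ennreal (\<gamma>\<^sup>2 / 2 / (\<kappa>\<^sup>2 * b)) * ennreal (en \<omega>)}"
      proof safe
        fix \<omega> assume "\<omega> \<in> space M" "\<omega> \<notin> E"
        then have "\<gamma>\<^sup>2 / 2 * en \<omega> \<ge> \<kappa>\<^sup>2 * b" by (simp add: E_def)
        then have "1 \<le> \<gamma>\<^sup>2 / 2 / (\<kappa>\<^sup>2 * b) * en \<omega>" using kb by (simp add: pos_le_divide_eq)
        then have "ennreal 1 \<le> ennreal (\<gamma>\<^sup>2 / 2 / (\<kappa>\<^sup>2 * b) * en \<omega>)" by (rule ennreal_leI)
        then show "1 \<le> ennreal (\<gamma>\<^sup>2 / 2 / (\<kappa>\<^sup>2 * b)) * ennreal (en \<omega>)"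
          using kb by (simp add: ennreal_mult'[symmetric])
      qed
    qed (use enM in measurable)
    also have "\<dots> \<le> ennreal (\<gamma>\<^sup>2 / 2 / (\<kappa>\<^sup>2 * b)) * (\<integral>\<^sup>+\<omega>. ennreal (en \<omega>) * indicator (space M) \<omega> \<partial>M)"
      by (rule nn_integral_Markov_inequality) (use enM in auto)
    also have "(\<integral>\<^sup>+\<omega>. ennreal (en \<omega>) * indicator (space M) \<omega> \<partial>M) = (\<integral>\<^sup>+\<omega>. ennreal (en \<omega>) \<partial>M)"
      by (intro nn_integral_cong) simp
    also have "ennreal (\<gamma>\<^sup>2 / 2 / (\<kappa>\<^sup>2 * b)) * (\<integral>\<^sup>+\<omega>. ennreal (en \<omega>) \<partial>M) \<le> ennreal (\<gamma>\<^sup>2 / 2 / (\<kappa>\<^sup>2 * b)) * ennreal (2 ^ j * (C * 2 powr (- 2 * \<nu> * real j)))"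
      by (intro mult_left_mono en_int) simp
    also have "\<dots> = ennreal (\<gamma>\<^sup>2 / 2 / (\<kappa>\<^sup>2 * b) * (2 ^ j * (C * 2 powr (- 2 * \<nu> * real j))))"
      using kb by (intro ennreal_mult'[symmetric]) (auto intro!: divide_nonneg_pos)
    finally have "prob (space M - E) \<le> \<gamma>\<^sup>2 / 2 / (\<kappa>\<^sup>2 * b) * (2 ^ j * (C * 2 powr (- 2 * \<nu> * real j)))"
      using kb C by (subst (asm) ennreal_le_iff) auto
    then show ?thesis unfolding \<kappa>2 using n by (simp add: field_simps)
  qed
  have mS: "{\<omega>\<in>space M. shifted_path (H A B) \<omega> \<in> S} \<in> sets M"
    using measurable_sets[OF mpath S, of A B] by (simp add: vimage_def Int_def conj_commute)
  have sub: "{\<omega>\<in>space M. shifted_path (H A B) \<omega> \<in> S} \<subseteq> (space M - E) \<union> {\<omega>\<in>E. shifted_path (H A B) \<omega> \<in> S}" by auto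
  have eq: "{\<omega>\<in>E. shifted_path (H A B) \<omega> \<in> S} = E \<inter> {\<omega>\<in>space M. shifted_path (H A B) \<omega> \<in> S}" by (auto simp: E_def)
  have m2: "{\<omega>\<in>E. shifted_path (H A B) \<omega> \<in> S} \<in> sets M" unfolding eq using EM mS by (rule sets.Int)
  have "prob {\<omega>\<in>space M. shifted_path (H A B) \<omega> \<in> S} \<le> prob ((space M - E) \<union> {\<omega>\<in>E. shifted_path (H A B) \<omega> \<in> S})"
    using EM m2 by (intro finite_measure_mono[OF sub]) auto
  also have "\<dots> \<le> prob (space M - E) + prob {\<omega>\<in>E. shifted_path (H A B) \<omega> \<in> S}"
    using EM m2 by (intro measure_Un_le) auto
  also have "\<dots> \<le> prob (space M - E) + (exp b / \<theta> + \<theta> * prob {\<omega>\<in>space M. shifted_path (H A' B') \<omega> \<in> S})"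
    using prob_shifted_path_le[OF S] by simp
  finally show ?thesis
    unfolding L_def[symmetric] peq using PE by linarith
qed

end

section \<open>Modulated Fejer kernels\<close>

text \<open>The squared modulus of the geometric sum of \<open>cis (2 * pi * a * x)\<close> over
  \<open>a < r\<close>, divided by \<open>r\<close>; in this form nonnegativity is evident.\<close>

definition fejer :: "nat \<Rightarrow> real \<Rightarrow> real" where
  "fejer r x = ((\<Sum>a<r. cos (2 * pi * real a * x))\<^sup>2 + (\<Sum>a<r. sin (2 * pi * real a * x))\<^sup>2) / real r"

text \<open>The Fejer kernel of order \<open>2\<^sup>j / 2\<close> modulated by the frequency \<open>3 \<cdot> 2\<^sup>j / 2\<close>; its frequencies fill the dyadic
  block \<open>[2\<^sup>j, 2\<^sup>j\<^sup>+\<^sup>1)\<close>.\<close>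

definition bump :: "nat \<Rightarrow> real \<Rightarrow> real" where
  "bump j x = cos (2 * pi * real (3 * 2 ^ (j - 1)) * x) * fejer (2 ^ (j - 1)) x"

text \<open>The phase \<alpha> is free: \<alpha> = 0 gives the Fejer kernel, the modulating
  frequency gives the bump.\<close>

lemma modulated_fejer_expand:
  "cos \<alpha> * ((\<Sum>a<r. cos (2 * pi * real a * x))\<^sup>2 + (\<Sum>a<r. sin (2 * pi * real a * x))\<^sup>2) =
   (\<Sum>a<r. \<Sum>b<r. cos (\<alpha> + 2 * pi * real a * x - 2 * pi * real b * x))" for r :: nat
proof -
  let ?c = "\<lambda>a. cos (2 * pi * real a * x)" and ?s = "\<lambda>a. sin (2 * pi * real a * x)"
  have "(\<Sum>a<r. \<Sum>b<r. cos (\<alpha> + 2 * pi * real a * x - 2 * pi * real b * x)) =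
    (\<Sum>a<r. \<Sum>b<r. cos \<alpha> * (?c a * ?c b) + cos \<alpha> * (?s a * ?s b) - (sin \<alpha> * (?s a * ?c b) - sin \<alpha> * (?c a * ?s b)))"
    by (intro sum.cong refl) (simp only: cos_add cos_diff sin_add sin_diff, simp add: algebra_simps)
  also have "\<dots> = cos \<alpha> * ((\<Sum>a<r. ?c a) * (\<Sum>b<r. ?c b)) + cos \<alpha> * ((\<Sum>a<r. ?s a) * (\<Sum>b<r. ?s b)) -
     (sin \<alpha> * ((\<Sum>a<r. ?s a) * (\<Sum>b<r. ?c b)) - sin \<alpha> * ((\<Sum>a<r. ?c a) * (\<Sum>b<r. ?s b)))"
    by (simp only: sum.distrib sum_subtractf sum_distrib_left[symmetric] sum_product)
  also have "\<dots> = cos \<alpha> * ((\<Sum>a<r. ?c a)\<^sup>2 + (\<Sum>a<r. ?s a)\<^sup>2)" by (simp add: power2_eq_square algebra_simps)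
  finally show ?thesis by simp
qed

lemma fejer_nonneg: "fejer r x \<ge> 0"
  by (simp add: fejer_def)

lemma fejer_eq: "fejer r x = (\<Sum>a<r. \<Sum>b<r. cos (2 * pi * of_int (int a - int b) * x)) / real r"
  unfolding fejer_def using modulated_fejer_expand[of 0 x r]
  by (simp add: algebra_simps)

lemma bump_le_fejer: "\<bar>bump j x\<bar> \<le> fejer (2 ^ (j - 1)) x"
  unfolding bump_def abs_mult using mult_right_mono[OF abs_cos_le_one fejer_nonneg]
  by (simp add: fejer_nonneg)

lemma fejer_has_integral:
  assumes "r > 0"
  shows "((\<lambda>x. fejer r (x - t)) has_integral 1) {0..1}"
proof -
  have c: "((\<lambda>x. cos (2 * pi * of_int d * (x - t))) has_integral (if d = 0 then 1 else 0)) {0..1}" for d :: int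
  proof -
    have e: "cos (2 * pi * of_int d * (x - t)) = cos (2 * pi * of_int d * t) * cos (2 * pi * of_int d * x) + sin (2 * pi * of_int d * t) * sin (2 * pi * of_int d * x)" for x
      using cos_diff[of "2 * pi * of_int d * x" "2 * pi * of_int d * t"] by (simp add: algebra_simps)
    have "((\<lambda>x. cos (2 * pi * of_int d * (x - t))) has_integral (cos (2 * pi * of_int d * t) * (if d = 0 then 1 else 0) + sin (2 * pi * of_int d * t) * 0)) {0..1}"
      unfolding e by (intro has_integral_add has_integral_mult_right integral_cos_int integral_sin_int)
    then show ?thesis by (cases "d = 0") simp_all
  qed
  have "((\<lambda>x. fejer r (x - t)) has_integral ((\<Sum>a<r. \<Sum>b<r. (if int a - int b = 0 then 1 else 0)) / real r)) {0..1}"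
    unfolding fejer_eq by (intro has_integral_divide has_integral_sum c) auto
  also have "(\<Sum>a<r. \<Sum>b<r. (if int a - int b = 0 then 1 else 0)) = real r"
    by (simp add: sum.delta)
  finally show ?thesis using assms by simp
qed

text \<open>Multiplication by \<open>2 * sin \<delta>\<close>, with \<delta> half the phase step
  between neighbours, makes the sum telescope; over a full period of the grid the two ends
  agree.\<close>

lemma sum_shifted_cos:
  fixes d :: int
  assumes N: "N > 0" and d: "d \<noteq> 0" "\<bar>d\<bar> < int N"
  shows "(\<Sum>k<N. cos (2 * pi * of_int d * (x - real k / real N))) = 0"
proof -
  define \<delta> where "\<delta> = pi * of_int d / real N"
  define y where "y = 2 * pi * of_int d * x"
  have e: "2 * pi * of_int d * (x - real k / real N) = y - 2 * real k * \<delta>" for k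
    by (simp add: y_def \<delta>_def algebra_simps)
  have "2 * sin \<delta> * cos (y - 2 * real k * \<delta>) = (\<lambda>k. - sin (y - 2 * real k * \<delta> + \<delta>)) (Suc k) - (\<lambda>k. - sin (y - 2 * real k * \<delta> + \<delta>)) k" for k
  proof -
    have "y - 2 * real (Suc k) * \<delta> + \<delta> = (y - 2 * real k * \<delta>) - \<delta>" by (simp add: algebra_simps)
    moreover have "2 * sin \<delta> * cos Z = - sin (Z - \<delta>) - (- sin (Z + \<delta>))" for Z
      by (simp add: sin_add sin_diff)
    ultimately show ?thesis by (simp only:)
  qed
  then have "(\<Sum>k<N. 2 * sin \<delta> * cos (y - 2 * real k * \<delta>)) =
      (\<Sum>k<N. (\<lambda>k. - sin (y - 2 * real k * \<delta> + \<delta>)) (Suc k) - (\<lambda>k. - sin (y - 2 * real k * \<delta> + \<delta>)) k)"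
    by (simp only:)
  also have "\<dots> = - sin (y - 2 * real N * \<delta> + \<delta>) - (- sin (y - 2 * real 0 * \<delta> + \<delta>))"
    by (rule sum_lessThan_telescope)
  also have "y - 2 * real N * \<delta> + \<delta> = (y + \<delta>) - of_int d * (2 * pi)" using N by (simp add: \<delta>_def)
  also have "sin ((y + \<delta>) - of_int d * (2 * pi)) = sin (y + \<delta>)"
    using sin_int_2pin[of d] cos_int_2pin[of d] by (simp add: sin_diff mult.commute)
  finally have "2 * sin \<delta> * (\<Sum>k<N. cos (y - 2 * real k * \<delta>)) = 0" by (simp add: sum_distrib_left)
  \<comment> \<open>Here \<open>0 < \<bar>d\<bar> < N\<close> puts \<delta> strictly between 0 and
    pi in absolute value.\<close>
  moreover have "sin \<delta> \<noteq> 0"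
  proof -
    define t where "t = \<bar>of_int d\<bar> / real N"
    have \<delta>: "\<bar>\<delta>\<bar> = pi * t" by (simp add: \<delta>_def t_def abs_mult)
    have t: "t < 1" "t > 0" using d N by (auto simp: field_simps t_def)
    have "0 < \<bar>\<delta>\<bar>" "\<bar>\<delta>\<bar> < pi"
      unfolding \<delta> using t mult_strict_left_mono[of t 1 pi] by auto
    then have "sin \<bar>\<delta>\<bar> > 0" by (rule sin_gt_zero)
    then show ?thesis by (cases "\<delta> \<ge> 0") auto
  qed
  ultimately show ?thesis unfolding e by simp
qed

text \<open>The differences \<open>a - b\<close> are below \<open>r \<le> N\<close> in absolute
  value, so summation over the grid kills all but the diagonal.\<close>

lemma sum_fejer:
  assumes r: "0 < r" "r \<le> N"
  shows "(\<Sum>k<N. fejer r (x - real k / real N)) = real N"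
proof -
  have c: "(\<Sum>k<N. cos (2 * pi * of_int (int a - int b) * (x - real k / real N))) = (if a = b then real N else 0)" if "a < r" "b < r" for a b
  proof (cases "a = b")
    case False
    then show ?thesis using sum_shifted_cos[of N "int a - int b" x] that r by auto
  qed simp
  have "(\<Sum>k<N. fejer r (x - real k / real N)) = (\<Sum>k<N. \<Sum>a<r. \<Sum>b<r. cos (2 * pi * of_int (int a - int b) * (x - real k / real N))) / real r"
    unfolding fejer_eq sum_divide_distrib ..
  also have "(\<Sum>k<N. \<Sum>a<r. \<Sum>b<r. cos (2 * pi * of_int (int a - int b) * (x - real k / real N))) =
      (\<Sum>a<r. \<Sum>b<r. \<Sum>k<N. cos (2 * pi * of_int (int a - int b) * (x - real k / real N)))"
    by (subst sum.swap) (intro sum.cong refl sum.swap)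
  also have "\<dots> = (\<Sum>a<r. \<Sum>b<r. if a = b then real N else 0)"
    using c by (intro sum.cong refl) auto
  also have "\<dots> = real r * real N" by (simp add: sum.delta')
  finally show ?thesis using r by simp
qed

lemma bump_expand:
  assumes j: "j \<ge> 1"
  shows "bump j x = (\<Sum>p\<in>{..<2 ^ (j - 1)} \<times> {..<2 ^ (j - 1)}. cos (2 * pi * real (3 * 2 ^ (j - 1) + fst p - snd p) * x)) / 2 ^ (j - 1)"
proof -
  let ?r = "2 ^ (j - 1) :: nat" and ?m = "3 * 2 ^ (j - 1) :: nat"
  have "bump j x = (\<Sum>a<?r. \<Sum>b<?r. cos (2 * pi * real ?m * x + 2 * pi * real a * x - 2 * pi * real b * x)) / 2 ^ (j - 1)"
    unfolding bump_def fejer_def using modulated_fejer_expand[of "2 * pi * real ?m * x" x ?r] by simp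
  also have "(\<Sum>a<?r. \<Sum>b<?r. cos (2 * pi * real ?m * x + 2 * pi * real a * x - 2 * pi * real b * x)) =
     (\<Sum>a<?r. \<Sum>b<?r. cos (2 * pi * real (?m + a - b) * x))"
  proof (intro sum.cong refl)
    fix a b assume "a \<in> {..<?r}" "b \<in> {..<?r}"
    then have "b \<le> ?m + a" by auto
    then have "2 * pi * real ?m * x + 2 * pi * real a * x - 2 * pi * real b * x = 2 * pi * real (?m + a - b) * x"
      by (simp add: of_nat_diff algebra_simps)
    then show "cos (2 * pi * real ?m * x + 2 * pi * real a * x - 2 * pi * real b * x) = cos (2 * pi * real (?m + a - b) * x)" by simp
  qed
  finally show ?thesis by (simp only: sum.cartesian_product case_prod_unfold)
qed

text \<open>With \<open>r = 2 ^ (j - 1)\<close> the frequency is \<open>3 * r\<close> plus a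
  difference of absolute value below \<open>r\<close>, hence strictly between \<open>2 * r\<close>
  and \<open>4 * r\<close>; the natural subtraction never truncates.\<close>

lemma bump_frequency:
  assumes j: "j \<ge> 1" and p: "p \<in> {..<2 ^ (j - 1)} \<times> {..<2 ^ (j - 1)}"
  shows "3 * 2 ^ (j - 1) + fst p - snd p \<in> {2 ^ j..<2 ^ (j + 1) :: nat}"
proof -
  define r where "r = (2::nat) ^ (j - 1)"
  have "2 ^ j = 2 * r" using j by (cases j) (auto simp: r_def)
  then have "(2::nat) ^ (j + 1) = 4 * r" "(2::nat) ^ j = 2 * r" by auto
  moreover have "fst p < r" "snd p < r" using p by (auto simp: r_def)
  ultimately show ?thesis unfolding atLeastLessThan_iff r_def[symmetric] by linarith
qed

text \<open>The triangular Fejer weight at the frequency \<open>l\<close>, as a count of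
  pairs.\<close>

definition bump_coeff :: "nat \<Rightarrow> nat \<Rightarrow> real" where
  "bump_coeff j l = real (card {p \<in> {..<2 ^ (j - 1)} \<times> {..<2 ^ (j - 1)}. 3 * 2 ^ (j - 1) + fst p - snd p = l}) / 2 ^ (j - 1)"

lemma bump_coeff_bounds: "0 \<le> bump_coeff j l" "bump_coeff j l \<le> 1"
proof -
  let ?r = "2 ^ (j - 1) :: nat"
  let ?P = "{p \<in> {..<?r} \<times> {..<?r}. 3 * ?r + fst p - snd p = l}"
  \<comment> \<open>For fixed \<open>l\<close> the first entry of a pair determines the second, so
    at most \<open>2 ^ (j - 1)\<close> pairs are counted.\<close>
  have "inj_on fst ?P"
  proof (rule inj_onI)
    fix p q assume "p \<in> ?P" "q \<in> ?P" "fst p = fst q"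
    then have "snd p = snd q" by auto
    then show "p = q" using \<open>fst p = fst q\<close> by (simp add: prod_eq_iff)
  qed
  moreover have "fst ` ?P \<subseteq> {..<?r}" by auto
  ultimately have "card ?P \<le> card {..<?r}" by (intro card_inj_on_le) auto
  then have "card ?P \<le> ?r" by simp
  then have "real (card ?P) \<le> real ?r" by (simp only: of_nat_le_iff)
  then show "bump_coeff j l \<le> 1" by (simp add: bump_coeff_def)
qed (simp add: bump_coeff_def)

lemma bump_trig_poly:
  assumes j: "j \<ge> 1"
  shows "bump j (x - t) = trig_poly {2 ^ j..<2 ^ (j + 1)} (\<lambda>l. bump_coeff j l * cos (2 * pi * real l * t))
     (\<lambda>l. bump_coeff j l * sin (2 * pi * real l * t)) x"
proof -
  let ?r = "2 ^ (j - 1) :: nat" and ?L = "{2 ^ j..<2 ^ (j + 1) :: nat}"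
  let ?P = "{..<?r} \<times> {..<?r}" and ?g = "\<lambda>p. 3 * 2 ^ (j - 1) + fst p - snd p :: nat"
  have "(\<Sum>p\<in>?P. cos (2 * pi * real (?g p) * (x - t))) = (\<Sum>l\<in>?L. \<Sum>p\<in>{p\<in>?P. ?g p = l}. cos (2 * pi * real (?g p) * (x - t)))"
    using bump_frequency[OF j] by (intro sum.group[symmetric]) blast+
  also have "\<dots> = (\<Sum>l\<in>?L. \<Sum>p\<in>{p\<in>?P. ?g p = l}. cos (2 * pi * real l * (x - t)))"
    by (intro sum.cong refl) auto
  also have "\<dots> = (\<Sum>l\<in>?L. real (card {p\<in>?P. ?g p = l}) * cos (2 * pi * real l * (x - t)))"
    by simp
  finally have "bump j (x - t) = (\<Sum>l\<in>?L. real (card {p\<in>?P. ?g p = l}) * cos (2 * pi * real l * (x - t))) / 2 ^ (j - 1)"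
    using bump_expand[OF j] by simp
  also have "\<dots> = (\<Sum>l\<in>?L. bump_coeff j l * cos (2 * pi * real l * (x - t)))"
    by (simp add: bump_coeff_def sum_divide_distrib)
  also have "\<dots> = trig_poly ?L (\<lambda>l. bump_coeff j l * cos (2 * pi * real l * t)) (\<lambda>l. bump_coeff j l * sin (2 * pi * real l * t)) x"
    unfolding trig_poly_def
  proof (intro sum.cong refl)
    fix l
    have "2 * pi * real l * (x - t) = 2 * pi * real l * x - 2 * pi * real l * t" by (simp add: algebra_simps)
    then show "bump_coeff j l * cos (2 * pi * real l * (x - t)) = bump_coeff j l * cos (2 * pi * real l * t) * cos (2 * pi * real l * x) +
      bump_coeff j l * sin (2 * pi * real l * t) * sin (2 * pi * real l * x)"
      by (simp only: cos_diff) (simp add: algebra_simps)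
  qed
  finally show ?thesis .
qed

text \<open>All frequencies are below \<open>2 ^ (j + 1)\<close>, so on this interval every cosine
  has its argument within \<open>pi / 3\<close> and is at least 1/2: the origin of the constant 12.
  There are \<open>r * r\<close> terms, divided by \<open>r = 2 ^ (j - 1)\<close>.\<close>

lemma bump_ge:
  assumes j: "j \<ge> 1" and x: "\<bar>x\<bar> \<le> 1 / (12 * 2 ^ j)"
  shows "bump j x \<ge> 2 ^ j / 4"
proof -
  let ?r = "2 ^ (j - 1) :: nat"
  let ?P = "{..<?r} \<times> {..<?r}" and ?g = "\<lambda>p. 3 * 2 ^ (j - 1) + fst p - snd p :: nat"
  have half: "cos (2 * pi * real (?g p) * x) \<ge> 1 / 2" if "p \<in> ?P" for p
  proof -
    have "?g p < 2 ^ (j + 1)" using bump_frequency[OF j that] by simp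
    then have "real (?g p) \<le> real (2 ^ (j + 1))" by (simp only: of_nat_le_iff less_imp_le)
    then have "real (?g p) * \<bar>x\<bar> \<le> real (2 ^ (j + 1)) * (1 / (12 * 2 ^ j))"
      using x by (intro mult_mono) auto
    then have "real (?g p) * \<bar>x\<bar> \<le> 1 / 6" by simp
    then have "2 * pi * (real (?g p) * \<bar>x\<bar>) \<le> 2 * pi * (1 / 6)" by (intro mult_left_mono) auto
    then have "\<bar>2 * pi * real (?g p) * x\<bar> \<le> pi / 3" by (simp add: abs_mult mult.assoc)
    then have "cos (pi / 3) \<le> cos \<bar>2 * pi * real (?g p) * x\<bar>" by (intro cos_monotone_0_pi_le) auto
    then show ?thesis by (simp add: cos_60)
  qed
  have "real (card ?P) * (1 / 2) \<le> (\<Sum>p\<in>?P. cos (2 * pi * real (?g p) * x))"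
    using sum_bounded_below[of ?P "1/2" "\<lambda>p. cos (2 * pi * real (?g p) * x)"] half by simp
  moreover have "real (card ?P) = 2 ^ (j - 1) * 2 ^ (j - 1)" by (simp add: card_cartesian_product)
  ultimately have "2 ^ (j - 1) * 2 ^ (j - 1) / 2 / 2 ^ (j - 1) \<le> bump j x"
    unfolding bump_expand[OF j] by (intro divide_right_mono) auto
  moreover have "2 ^ (j - 1) * 2 ^ (j - 1) / 2 / 2 ^ (j - 1) = (2::real) ^ j / 4"
    using j by (cases j) auto
  ultimately show ?thesis by simp
qed

section \<open>The hypotheses\<close>

definition hypothesis_cos :: "nat \<Rightarrow> real \<Rightarrow> nat set \<Rightarrow> nat \<Rightarrow> real" where
  "hypothesis_cos j \<gamma> S l = (\<Sum>k\<in>S. \<gamma> * (bump_coeff j l * cos (2 * pi * real l * (real k / 2 ^ j))))"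

definition hypothesis_sin :: "nat \<Rightarrow> real \<Rightarrow> nat set \<Rightarrow> nat \<Rightarrow> real" where
  "hypothesis_sin j \<gamma> S l = (\<Sum>k\<in>S. \<gamma> * (bump_coeff j l * sin (2 * pi * real l * (real k / 2 ^ j))))"

text \<open>Given by its coefficients, the form in which \<open>observation_test\<close> and
  \<open>besov_norm_trig_poly\<close> take functions; \<open>hypothesis_eq\<close> recovers the sum
  of bumps.\<close>

definition hypothesis :: "nat \<Rightarrow> real \<Rightarrow> nat set \<Rightarrow> real \<Rightarrow> real" where
  "hypothesis j \<gamma> S = trig_poly {2 ^ j..<2 ^ (j + 1)} (hypothesis_cos j \<gamma> S) (hypothesis_sin j \<gamma> S)"

lemma hypothesis_eq:
  assumes j: "j \<ge> 1"
  shows "hypothesis j \<gamma> S x = (\<Sum>k\<in>S. \<gamma> * bump j (x - real k / 2 ^ j))"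
proof -
  let ?L = "{2 ^ j..<2 ^ (j + 1) :: nat}"
  let ?f = "\<lambda>k l. \<gamma> * (bump_coeff j l * cos (2 * pi * real l * (real k / 2 ^ j)) * cos (2 * pi * real l * x) +
      bump_coeff j l * sin (2 * pi * real l * (real k / 2 ^ j)) * sin (2 * pi * real l * x))"
  have "(\<Sum>k\<in>S. \<gamma> * bump j (x - real k / 2 ^ j)) = (\<Sum>k\<in>S. \<Sum>l\<in>?L. ?f k l)"
    by (simp only: bump_trig_poly[OF j] trig_poly_def sum_distrib_left)
  also have "\<dots> = (\<Sum>l\<in>?L. \<Sum>k\<in>S. ?f k l)" by (rule sum.swap)
  also have "\<dots> = hypothesis j \<gamma> S x"
    unfolding hypothesis_def trig_poly_def hypothesis_cos_def hypothesis_sin_def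
    by (intro sum.cong refl) (simp only: sum_distrib_right sum.distrib[symmetric] distrib_left mult.assoc)
  finally show ?thesis by simp
qed

lemma continuous_hypothesis: "continuous_on X (hypothesis j \<gamma> S)"
  unfolding hypothesis_def by (rule continuous_trig_poly)

text \<open>Bumps oscillate, but their Fejer majorants are nonnegative, so \<open>S\<close> may be
  enlarged to all translates, whose majorants have a constant sum.\<close>

lemma hypothesis_bound:
  assumes j: "j \<ge> 1" and S: "S \<subseteq> {..<2 ^ j}" and \<gamma>: "\<gamma> \<ge> 0"
  shows "\<bar>hypothesis j \<gamma> S x\<bar> \<le> \<gamma> * 2 ^ j"
proof -
  have "\<bar>hypothesis j \<gamma> S x\<bar> \<le> (\<Sum>k\<in>S. \<bar>\<gamma> * bump j (x - real k / 2 ^ j)\<bar>)"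
    unfolding hypothesis_eq[OF j] by (rule sum_abs)
  also have "\<dots> \<le> (\<Sum>k\<in>S. \<gamma> * fejer (2 ^ (j - 1)) (x - real k / 2 ^ j))"
    using \<gamma> bump_le_fejer by (intro sum_mono) (simp add: abs_mult mult_left_mono)
  also have "\<dots> \<le> (\<Sum>k<2 ^ j. \<gamma> * fejer (2 ^ (j - 1)) (x - real k / 2 ^ j))"
    using S \<gamma> fejer_nonneg by (intro sum_mono2) auto
  also have "\<dots> = \<gamma> * 2 ^ j"
    using sum_fejer[of "2 ^ (j - 1)" "2 ^ j" x] by (simp add: sum_distrib_left[symmetric])
  finally show ?thesis .
qed

text \<open>Smaller than the sup bound by the factor \<open>2 ^ j\<close>, as one Fejer kernel has
  integral 1. This gain permits the larger amplitude of the sparse case.\<close>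

lemma hypothesis_singleton_integral:
  assumes j: "j \<ge> 1" and \<gamma>: "\<gamma> \<ge> 0"
  shows "integral {0..1} (\<lambda>x. \<bar>hypothesis j \<gamma> {k} x\<bar>) \<le> \<gamma>"
proof -
  have i: "((\<lambda>x. \<gamma> * fejer (2 ^ (j - 1)) (x - real k / 2 ^ j)) has_integral \<gamma> * 1) {0..1}"
    by (intro has_integral_mult_right fejer_has_integral) simp
  have "integral {0..1} (\<lambda>x. \<bar>hypothesis j \<gamma> {k} x\<bar>) \<le> integral {0..1} (\<lambda>x. \<gamma> * fejer (2 ^ (j - 1)) (x - real k / 2 ^ j))"
  proof (rule integral_le)
    show "(\<lambda>x. \<bar>hypothesis j \<gamma> {k} x\<bar>) integrable_on {0..1}"
      by (intro integrable_continuous_interval continuous_intros continuous_hypothesis)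
    show "(\<lambda>x. \<gamma> * fejer (2 ^ (j - 1)) (x - real k / 2 ^ j)) integrable_on {0..1}" using i by blast
    show "\<bar>hypothesis j \<gamma> {k} x\<bar> \<le> \<gamma> * fejer (2 ^ (j - 1)) (x - real k / 2 ^ j)" for x
      unfolding hypothesis_eq[OF j] using \<gamma> bump_le_fejer by (simp add: abs_mult mult_left_mono)
  qed
  then show ?thesis by (simp only: integral_unique[OF i] mult_1_right)
qed

lemma hypothesis_integral:
  assumes j: "j \<ge> 1" and S: "S \<subseteq> {..<2 ^ j}" and \<gamma>: "\<gamma> \<ge> 0"
  shows "integral {0..1} (\<lambda>x. \<bar>hypothesis j \<gamma> S x\<bar>) \<le> \<gamma> * 2 ^ j"
proof -
  have "integral {0..1} (\<lambda>x. \<bar>hypothesis j \<gamma> S x\<bar>) \<le> integral {0..1} (\<lambda>x :: real. \<gamma> * 2 ^ j)"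
  proof (rule integral_le)
    show "(\<lambda>x. \<bar>hypothesis j \<gamma> S x\<bar>) integrable_on {0..1}"
      by (intro integrable_continuous_interval continuous_intros continuous_hypothesis)
    show "\<bar>hypothesis j \<gamma> S x\<bar> \<le> \<gamma> * 2 ^ j" for x by (rule hypothesis_bound[OF assms])
  qed (intro integrable_continuous_interval continuous_intros)
  then show ?thesis by simp
qed

text \<open>Translating a bump only rotates its coefficient pair, whose modulus is \<gamma> times a
  weight of at most 1.\<close>

lemma hypothesis_coeff_diff:
  assumes "finite S" "k \<notin> S"
  shows "(hypothesis_cos j \<gamma> (insert k S) l - hypothesis_cos j \<gamma> S l)\<^sup>2 + (hypothesis_sin j \<gamma> (insert k S) l - hypothesis_sin j \<gamma> S l)\<^sup>2 \<le> \<gamma>\<^sup>2"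
proof -
  let ?c = "bump_coeff j l" and ?t = "2 * pi * real l * (real k / 2 ^ j)"
  have d: "hypothesis_cos j \<gamma> (insert k S) l - hypothesis_cos j \<gamma> S l = \<gamma> * (?c * cos ?t)"
    "hypothesis_sin j \<gamma> (insert k S) l - hypothesis_sin j \<gamma> S l = \<gamma> * (?c * sin ?t)"
    using assms by (simp_all add: hypothesis_cos_def hypothesis_sin_def)
  have "(\<gamma> * (?c * cos ?t))\<^sup>2 + (\<gamma> * (?c * sin ?t))\<^sup>2 = \<gamma>\<^sup>2 * (?c\<^sup>2 * ((sin ?t)\<^sup>2 + (cos ?t)\<^sup>2))"
    by (simp only: power_mult_distrib distrib_left add.commute)
  also have "\<dots> = \<gamma>\<^sup>2 * ?c\<^sup>2" by (simp only: sin_cos_squared_add mult_1_right)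
  also have "\<dots> \<le> \<gamma>\<^sup>2 * 1"
    using bump_coeff_bounds[of j l] by (intro mult_left_mono power_le_one) auto
  finally show ?thesis unfolding d by simp
qed

lemma Lspace_continuous:
  assumes "continuous_on UNIV f" "\<And>x. f (x + 1) = f x" "p > 0"
  shows "f \<in> Lspace p"
proof -
  have m [measurable]: "f \<in> borel_measurable borel" using assms(1) by (rule borel_measurable_continuous_onI)
  have c: "continuous_on {0..1} f" using assms(1) by (rule continuous_on_subset) auto
  obtain B where B: "\<And>x. x \<in> {0..1} \<Longrightarrow> \<bar>f x\<bar> \<le> B"
    using compact_imp_bounded[OF compact_continuous_image[OF c compact_Icc]] unfolding bounded_iff by fastforce
  have "(\<integral>\<^sup>+x\<in>{0..1}. ennreal (\<bar>f x\<bar> powr p) \<partial>lborel) \<le> (\<integral>\<^sup>+x. ennreal (B powr p) * indicator {0..1::real} x \<partial>lborel)"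
    using B assms(3) by (intro nn_integral_mono) (auto simp: indicator_def intro!: ennreal_leI powr_mono2)
  also have "\<dots> < \<infinity>" by (simp add: nn_integral_cmult ennreal_mult_less_top)
  finally have "(\<integral>\<^sup>+x\<in>{0..1}. ennreal (\<bar>f x\<bar> powr p) \<partial>lborel) < \<infinity>" .
  then show ?thesis using assms m by (simp add: Lspace_def Lnorm_def ennreal_powr_def)
qed

text \<open>For an amplitude \<open>g\<close>, take \<open>a = g\<close> in
  \<open>besov_norm_trig_poly\<close>, with \<open>b = g * 2 ^ j\<close> for a set of bumps and
  \<open>b = g\<close> for a single one. The norm is then at most
  \<open>C * g * 2 powr (j * (s + 1))\<close>, respectively with \<open>s + 1 - 1/p\<close> in place
  of \<open>s + 1\<close>; the two amplitudes cancel these powers.\<close>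

lemma hypothesis_in_besov_ball:
  fixes s p q R :: real
  assumes m: "meyer_transition v" and p: "p > 1" and q: "q > 1" and R: "R > 0"
  shows "\<exists>c0>0. \<forall>c. 0 < c \<and> c \<le> c0 \<longrightarrow>
    (\<forall>j\<ge>1. \<forall>S\<subseteq>{..<2 ^ j}. hypothesis j (c * 2 powr (- (real j * (s + 1)))) S \<in> besov_ball v s p q R) \<and>
    (\<forall>j\<ge>1. \<forall>k<2 ^ j. hypothesis j (c * 2 powr (- (real j * (s + 1 - 1/p)))) {k} \<in> besov_ball v s p q R)"
proof -
  obtain C where C: "C > 0" "\<And>j A B a b. (\<And>x. \<bar>trig_poly {2 ^ j..<2 ^ (j + 1)} A B x\<bar> \<le> a * 2 ^ j) \<Longrightarrow>
     integral {0..1} (\<lambda>x. \<bar>trig_poly {2 ^ j..<2 ^ (j + 1)} A B x\<bar>) \<le> b \<Longrightarrow>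
     besov_norm v s p q (trig_poly {2 ^ j..<2 ^ (j + 1)} A B) \<le>
       ennreal (C * 2 powr (real j * (s + 1/2 - 1/p)) * ((a * 2 powr (real j / 2)) powr (p - 1) * (b * 2 powr (real j / 2))) powr (1 / p))"
    using besov_norm_trig_poly[OF m p q, of s] by blast
  have c0: "R / C > 0" using C R by simp
  have mem: "hypothesis j \<gamma> S \<in> besov_ball v s p q R"
    if "besov_norm v s p q (hypothesis j \<gamma> S) \<le> ennreal R" for j \<gamma> S
  proof -
    have "hypothesis j \<gamma> S \<in> Lspace p"
      using p by (intro Lspace_continuous continuous_hypothesis) (auto simp: hypothesis_def trig_poly_periodic)
    then show ?thesis
      using that by (auto simp: besov_ball_def besov_space_def continuous_hypothesis intro: le_less_trans)
  qed
  have "hypothesis j (c * 2 powr (- (real j * (s + 1)))) S \<in> besov_ball v s p q R"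
    if c: "c > 0" "c \<le> R / C" and j: "j \<ge> 1" and S: "S \<subseteq> {..<2 ^ j}" for c j S
  proof (rule mem)
    let ?g = "c * 2 powr (- (real j * (s + 1)))"
    have "besov_norm v s p q (hypothesis j ?g S) \<le>
       ennreal (C * 2 powr (real j * (s + 1/2 - 1/p)) * ((?g * 2 powr (real j / 2)) powr (p - 1) * (?g * 2 ^ j * 2 powr (real j / 2))) powr (1 / p))"
      unfolding hypothesis_def using c hypothesis_bound[OF j S, of ?g] hypothesis_integral[OF j S, of ?g]
      by (intro C(2)) (auto simp: hypothesis_def)
    also have "(?g * 2 powr (real j / 2)) powr (p - 1) * (?g * 2 ^ j * 2 powr (real j / 2)) = (?g * 2 powr (real j / 2)) powr p * 2 powr (real j)"
    proof -
      have "(?g * 2 powr (real j / 2)) powr p = (?g * 2 powr (real j / 2)) powr (p - 1) * (?g * 2 powr (real j / 2))"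
        using powr_mult_base[of "?g * 2 powr (real j / 2)" "p - 1"] c by (simp add: mult.commute)
      then show ?thesis by (simp add: powr_realpow)
    qed
    also have "\<dots> powr (1 / p) = ?g * 2 powr (real j / 2) * 2 powr (real j / p)"
      using p c by (simp add: powr_mult powr_powr)
    also have "C * 2 powr (real j * (s + 1/2 - 1/p)) * (?g * 2 powr (real j / 2) * 2 powr (real j / p)) =
       C * c * (2 powr (real j * (s + 1/2 - 1/p)) * 2 powr (- (real j * (s + 1))) * 2 powr (real j / 2) * 2 powr (real j / p))"
      by (simp only: mult.assoc mult.left_commute)
    also have "2 powr (real j * (s + 1/2 - 1/p)) * 2 powr (- (real j * (s + 1))) * 2 powr (real j / 2) * 2 powr (real j / p) = 2 powr 0"
      unfolding powr_add[symmetric] by (rule arg_cong[where f="\<lambda>x. 2 powr x"]) (simp add: algebra_simps)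
    finally show "besov_norm v s p q (hypothesis j ?g S) \<le> ennreal R"
      using C c by (simp add: field_simps) (erule order_trans, rule ennreal_leI, simp)
  qed
  moreover have "hypothesis j (c * 2 powr (- (real j * (s + 1 - 1/p)))) {k} \<in> besov_ball v s p q R"
    if c: "c > 0" "c \<le> R / C" and j: "j \<ge> 1" and k: "k < 2 ^ j" for c j k
  proof (rule mem)
    let ?g = "c * 2 powr (- (real j * (s + 1 - 1/p)))"
    have "besov_norm v s p q (hypothesis j ?g {k}) \<le>
       ennreal (C * 2 powr (real j * (s + 1/2 - 1/p)) * ((?g * 2 powr (real j / 2)) powr (p - 1) * (?g * 2 powr (real j / 2))) powr (1 / p))"
      unfolding hypothesis_def using c k hypothesis_bound[OF j, of "{k}" ?g] hypothesis_singleton_integral[OF j, of ?g k]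
      by (intro C(2)) (auto simp: hypothesis_def)
    also have "(?g * 2 powr (real j / 2)) powr (p - 1) * (?g * 2 powr (real j / 2)) = (?g * 2 powr (real j / 2)) powr p"
      using powr_mult_base[of "?g * 2 powr (real j / 2)" "p - 1"] c by (simp add: mult.commute)
    also have "\<dots> powr (1 / p) = ?g * 2 powr (real j / 2)"
      using p c by (simp add: powr_powr)
    also have "C * 2 powr (real j * (s + 1/2 - 1/p)) * (?g * 2 powr (real j / 2)) =
       C * c * (2 powr (real j * (s + 1/2 - 1/p)) * 2 powr (- (real j * (s + 1 - 1/p))) * 2 powr (real j / 2))"
      by (simp only: mult.assoc mult.left_commute)
    also have "2 powr (real j * (s + 1/2 - 1/p)) * 2 powr (- (real j * (s + 1 - 1/p))) * 2 powr (real j / 2) = 2 powr 0"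
      unfolding powr_add[symmetric] by (rule arg_cong[where f="\<lambda>x. 2 powr x"]) (simp add: algebra_simps)
    finally show "besov_norm v s p q (hypothesis j ?g {k}) \<le> ennreal R"
      using C c by (simp add: field_simps) (erule order_trans, rule ennreal_leI, simp)
  qed
  ultimately show ?thesis using c0 by blast
qed

section \<open>Lower bound in the regular case\<close>

text \<open>Integrating \<open>\<bar>g\<bar> \<le> a + \<bar>g\<bar>\<^sup>\<rho> a\<^sup>1\<^sup>-\<^sup>\<rho>\<close> with \<open>a\<close> the \<open>L\<^sup>\<rho>\<close> norm costs a factor \<open>2\<close> compared with Jensen's inequality.\<close>

lemma nn_integral_abs_le_Lnorm:
  assumes g [measurable]: "g \<in> borel_measurable borel" and \<rho>: "\<rho> > 1"
  shows "(\<integral>\<^sup>+x\<in>{0..1}. ennreal \<bar>g x\<bar> \<partial>lborel) \<le> 2 * Lnorm \<rho> g"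
proof -
  define I where "I = (\<integral>\<^sup>+x\<in>{0..1}. ennreal (\<bar>g x\<bar> powr \<rho>) \<partial>lborel)"
  show ?thesis
  proof (cases "I = \<infinity>")
    case True
    then show ?thesis by (simp add: Lnorm_def ennreal_powr_def I_def[symmetric] ennreal_mult_top)
  next
    case False
    define a where "a = enn2real I powr (1 / \<rho>)"
    have L: "Lnorm \<rho> g = ennreal a" using False by (simp add: Lnorm_def ennreal_powr_def I_def[symmetric] a_def)
    have a\<rho>: "a powr \<rho> = enn2real I" using \<rho> by (simp add: a_def powr_powr)
    have I: "I = ennreal (a powr \<rho>)" using False by (simp add: a\<rho> less_top)
    show ?thesis
    proof (cases "a = 0")
      case True
      then have "I = 0" using I \<rho> by simp
      then have "AE x in lborel. ennreal (\<bar>g x\<bar> powr \<rho>) * indicator {0..1} x = 0"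
        unfolding I_def by (subst (asm) nn_integral_0_iff_AE) auto
      then have "AE x in lborel. ennreal \<bar>g x\<bar> * indicator {0..1} x = 0"
        by eventually_elim (auto simp: indicator_def split: if_splits)
      then have "(\<integral>\<^sup>+x\<in>{0..1}. ennreal \<bar>g x\<bar> \<partial>lborel) = 0"
        by (subst nn_integral_0_iff_AE) auto
      then show ?thesis by simp
    next
      case False
      then have a: "a > 0" by (simp add: a_def)
      have pt: "\<bar>g x\<bar> \<le> a + \<bar>g x\<bar> powr \<rho> * a powr (1 - \<rho>)" for x
      proof (cases "\<bar>g x\<bar> \<le> a")
        case False
        have "\<bar>g x\<bar> = \<bar>g x\<bar> powr \<rho> * \<bar>g x\<bar> powr (1 - \<rho>)" using False a by (simp flip: powr_add)
        also have "\<dots> \<le> \<bar>g x\<bar> powr \<rho> * a powr (1 - \<rho>)"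
          using False a \<rho> by (intro mult_left_mono powr_mono2') auto
        finally show ?thesis using a by linarith
      qed (simp add: add_increasing2)
      have "(\<integral>\<^sup>+x\<in>{0..1}. ennreal \<bar>g x\<bar> \<partial>lborel) \<le>
          (\<integral>\<^sup>+x. ennreal a * indicator {0..1} x + ennreal (a powr (1 - \<rho>)) * (ennreal (\<bar>g x\<bar> powr \<rho>) * indicator {0..1} x) \<partial>lborel)"
      proof (rule nn_integral_mono)
        fix x
        have "ennreal \<bar>g x\<bar> \<le> ennreal a + ennreal (a powr (1 - \<rho>)) * ennreal (\<bar>g x\<bar> powr \<rho>)"
          using ennreal_leI[OF pt[of x]] a by (simp add: ennreal_plus ennreal_mult' mult.commute)
        then show "ennreal \<bar>g x\<bar> * indicator {0..1} x \<le> ennreal a * indicator {0..1} x + ennreal (a powr (1 - \<rho>)) * (ennreal (\<bar>g x\<bar> powr \<rho>) * indicator {0..1} x)"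
          by (auto simp: indicator_def)
      qed
      also have "\<dots> = ennreal a + ennreal (a powr (1 - \<rho>)) * I"
        unfolding I_def by (simp add: nn_integral_add nn_integral_cmult)
      also have "\<dots> = ennreal (a + a powr (1 - \<rho>) * a powr \<rho>)"
        unfolding I using a by (simp add: ennreal_plus ennreal_mult')
      also have "a + a powr (1 - \<rho>) * a powr \<rho> = 2 * a" using a by (simp flip: powr_add)
      finally show ?thesis unfolding L by (simp add: ennreal_mult')
    qed
  qed
qed

lemma Lnorm_ge:
  assumes "ennreal t \<le> (\<integral>\<^sup>+x\<in>{0..1}. ennreal (\<bar>g x\<bar> powr \<rho>) \<partial>lborel)" "t \<ge> 0" "\<rho> > 0"
  shows "ennreal (t powr (1 / \<rho>)) \<le> Lnorm \<rho> g"
proof -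
  define I where "I = (\<integral>\<^sup>+x\<in>{0..1}. ennreal (\<bar>g x\<bar> powr \<rho>) \<partial>lborel)"
  show ?thesis
  proof (cases "I = \<infinity>")
    case False
    then have "t \<le> enn2real I" using assms(1,2) enn2real_mono[of "ennreal t" I] by (simp add: I_def[symmetric] less_top)
    then show ?thesis using False assms
      by (auto simp: Lnorm_def ennreal_powr_def I_def[symmetric] intro!: ennreal_leI powr_mono2)
  qed (simp add: Lnorm_def ennreal_powr_def I_def[symmetric])
qed

text \<open>Starts at the centre of the translate \<open>k\<close> and has the length on which
  \<open>bump_ge\<close> applies. As this is shorter than the spacing of the translates, cells are
  disjoint.\<close>

definition cell :: "nat \<Rightarrow> nat \<Rightarrow> real set" where
  "cell j k = {real k / 2 ^ j..real k / 2 ^ j + 1 / (12 * 2 ^ j)}"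

lemma cell_measurable [measurable]: "cell j k \<in> sets borel"
  by (simp add: cell_def)

lemma emeasure_cell: "emeasure lborel (cell j k) = ennreal (1 / (12 * 2 ^ j))"
  by (simp add: cell_def)

lemma sum_indicator_cell_le:
  assumes K: "K \<subseteq> {..<2 ^ j}"
  shows "(\<Sum>k\<in>K. indicator (cell j k) x) \<le> (indicator {0..1} x :: ennreal)"
proof -
  have fin: "finite K" using K by (rule finite_subset) simp
  have step: "(y :: real) \<notin> cell j k'" if "y \<in> cell j k" "k < k'" for y k k'
  proof
    assume "y \<in> cell j k'"
    then have "real k' / 2 ^ j \<le> real k / 2 ^ j + 1 / (12 * 2 ^ j)" using that by (auto simp: cell_def)
    then have "real k' \<le> real k + 1 / 12" by (simp add: field_simps)
    then show False using that by linarith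
  qed
  have "disjoint_family_on (cell j) K"
    unfolding disjoint_family_on_def using step by (metis disjoint_iff linorder_neqE_nat)
  then have "(\<Sum>k\<in>K. indicator (cell j k) x) = (indicator (\<Union>k\<in>K. cell j k) x :: ennreal)"
    using fin by (intro indicator_UN_disjoint[symmetric])
  moreover have "(\<Union>k\<in>K. cell j k) \<subseteq> {0..1}"
  proof safe
    fix k and y :: real assume k: "k \<in> K" and y: "y \<in> cell j k"
    have "k < 2 ^ j" using k K by auto
    then have "real (k + 1) \<le> real (2 ^ j)" by (simp only: of_nat_le_iff)
    then have k1: "real k + 1 \<le> 2 ^ j" by simp
    have "y \<le> real k / 2 ^ j + 1 / (12 * 2 ^ j)" using y by (simp add: cell_def)
    also have "\<dots> = (real k + 1 / 12) / 2 ^ j" by (simp add: field_simps)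
    also have "\<dots> \<le> 1" using k1 by (simp add: field_simps)
    finally have "y \<le> 1" .
    moreover have "0 \<le> y" using y unfolding cell_def by (auto intro: order_trans[rotated])
    ultimately show "y \<in> {0..1}" by simp
  qed
  ultimately show ?thesis by (auto simp: indicator_def)
qed

lemma bump_on_cell:
  assumes "j \<ge> 1" "x \<in> cell j k"
  shows "bump j (x - real k / 2 ^ j) \<ge> 2 ^ j / 4"
  using assms by (intro bump_ge) (auto simp: cell_def)

text \<open>Used twice: to compare localized losses with the global one, and to bound the number of
  bumps near a single function.\<close>

lemma sum_nn_integral_cell_le:
  assumes K: "K \<subseteq> {..<2 ^ j}" and g [measurable]: "g \<in> borel_measurable borel"
  shows "(\<Sum>k\<in>K. \<integral>\<^sup>+x\<in>cell j k. g x \<partial>lborel) \<le> (\<integral>\<^sup>+x\<in>{0..1}. g x \<partial>lborel)"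
proof -
  have "(\<Sum>k\<in>K. \<integral>\<^sup>+x\<in>cell j k. g x \<partial>lborel) = (\<integral>\<^sup>+x. (\<Sum>k\<in>K. g x * indicator (cell j k) x) \<partial>lborel)"
    by (rule nn_integral_sum[symmetric]) measurable
  also have "\<dots> \<le> (\<integral>\<^sup>+x\<in>{0..1}. g x \<partial>lborel)"
    unfolding sum_distrib_left[symmetric]
    by (intro nn_integral_mono mult_left_mono sum_indicator_cell_le[OF K]) simp
  finally show ?thesis .
qed

lemma estimator_measurable:
  assumes "T \<in> estimators" "z \<in> space observation_space"
  shows "T z \<in> borel_measurable borel"
  using measurable_compose[OF measurable_Pair1'[OF assms(2)], of "\<lambda>(z, x). T z x" borel borel] assms(1)
  by (simp add: estimators_def)

lemma estimator_loss_measurable: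
  assumes T: "T \<in> estimators" and [measurable]: "f \<in> borel_measurable borel" "A \<in> sets borel" "h \<in> borel_measurable borel"
  shows "(\<lambda>z. \<integral>\<^sup>+x\<in>A. ennreal (h \<bar>T z x - f x\<bar>) \<partial>lborel) \<in> borel_measurable observation_space"
proof -
  have [measurable]: "(\<lambda>p. T (fst p) (snd p)) \<in> borel_measurable (observation_space \<Otimes>\<^sub>M lborel)"
    using T by (simp add: estimators_def case_prod_unfold cong: measurable_cong_sets)
  have "(\<lambda>p. ennreal (h \<bar>T (fst p) (snd p) - f (snd p)\<bar>) * indicator A (snd p)) \<in> borel_measurable (observation_space \<Otimes>\<^sub>M lborel)"
    by measurable
  then show ?thesis
    by (intro lborel.borel_measurable_nn_integral) (simp add: case_prod_unfold)
qed

lemma hypothesis_measurable [measurable]: "hypothesis j \<gamma> S \<in> borel_measurable borel"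
  by (rule borel_measurable_continuous_onI[OF continuous_hypothesis])

text \<open>Pairs each subset without \<open>k\<close> with its partner containing \<open>k\<close>,
  for Assouad's averaging.\<close>

lemma sum_Pow_split:
  fixes e :: "nat set \<Rightarrow> ennreal"
  assumes k: "k \<in> A" and A: "finite A"
  shows "(\<Sum>S\<in>Pow A. e S) = (\<Sum>S\<in>Pow (A - {k}). e S + e (insert k S))"
proof -
  have eq: "Pow A = Pow (A - {k}) \<union> insert k ` Pow (A - {k})"
    using k Pow_insert[of k "A - {k}"] by (simp add: insert_absorb)
  have inj: "inj_on (insert k) (Pow (A - {k}))" by (rule inj_onI) (metis Diff_insert_absorb Pow_iff subset_Diff_insert)
  have "(\<Sum>S\<in>Pow A. e S) = (\<Sum>S\<in>Pow (A - {k}). e S) + (\<Sum>S\<in>insert k ` Pow (A - {k}). e S)"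
    unfolding eq using A by (intro sum.union_disjoint) auto
  also have "(\<Sum>S\<in>insert k ` Pow (A - {k}). e S) = (\<Sum>S\<in>Pow (A - {k}). e (insert k S))"
    using inj by (simp add: sum.reindex)
  finally show ?thesis by (simp add: sum.distrib)
qed

section \<open>Assouad's argument over all subsets of translates\<close>

context filter_model
begin

lemma observation_event_measurable:
  assumes "A \<in> sets observation_space"
  shows "{\<omega>\<in>space M. observation W Y \<sigma> x0 n (hypothesis j \<gamma> S) \<omega> \<in> A} \<in> sets M"
  using measurable_sets[OF measurable_observation[OF continuous_hypothesis[of UNIV j \<gamma> S]] assms, of n]
  by (simp add: vimage_def Int_def conj_commute)

text \<open>Flipping \<open>k\<close> changes the function by \<open>\<gamma> / 48\<close> in
  \<open>L\<^sup>1(cell j k)\<close> but barely changes the law of the observation.\<close>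

lemma flip_risk:
  assumes Clow: "\<And>j. (\<integral>\<^sup>+\<omega>. ennreal (dyadic_energy (\<lambda>t. Y t \<omega>) j) \<partial>M) \<le> ennreal (C * 2 powr (- 2 * \<nu> * real j))"
    and C: "C > 0" and T: "T \<in> estimators" and j: "j \<ge> 1" and n: "n > 0" and \<gamma>: "\<gamma> > 0"
    and energy: "\<gamma>\<^sup>2 * 2 ^ j * C * 2 powr (- 2 * \<nu> * real j) * real n / (2 * \<sigma>\<^sup>2) \<le> 1 / 8"
    and S: "finite S" "k \<notin> S"
  defines "e \<equiv> \<lambda>S. \<integral>\<^sup>+\<omega>. (\<integral>\<^sup>+x\<in>cell j k. ennreal \<bar>T (observation W Y \<sigma> x0 n (hypothesis j \<gamma> S) \<omega>) x - hypothesis j \<gamma> S x\<bar> \<partial>lborel) \<partial>M"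
  shows "ennreal (\<gamma> / (1024 * exp 1)) \<le> e S + e (insert k S)"
proof -
  let ?S' = "insert k S"
  \<comment> \<open>Half of the height \<open>\<gamma> * 2 ^ j / 4\<close> times the cell length
    \<open>1 / (12 * 2 ^ j)\<close>.\<close>
  define d where "d = \<gamma> / 96"
  \<comment> \<open>At energy level 1 this makes \<open>exp 1 / \<theta>\<close> equal to
    1/8.\<close>
  define \<theta> :: real where "\<theta> = 8 * exp 1"
  have \<theta>: "\<theta> \<ge> 1" using exp_ge_add_one_self[of 1] by (simp add: \<theta>_def)
  define loc where "loc S z = (\<integral>\<^sup>+x\<in>cell j k. ennreal \<bar>T z x - hypothesis j \<gamma> S x\<bar> \<partial>lborel)" for S z
  define obs where "obs S = observation W Y \<sigma> x0 n (hypothesis j \<gamma> S)" for S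
  have mobs [measurable]: "obs S \<in> measurable M observation_space" for S
    unfolding obs_def by (rule measurable_observation[OF continuous_hypothesis])
  have mloc [measurable]: "loc S \<in> borel_measurable observation_space" for S
    unfolding loc_def by (rule estimator_loss_measurable[where h="\<lambda>y. y", OF T]) auto
  \<comment> \<open>The event that the estimate is far from the hypothesis \<open>S\<close>; off
    this event it is far from the other one, by \<open>sep\<close>.\<close>
  define A where "A = {z\<in>space observation_space. ennreal d \<le> loc S z}"
  have A [measurable]: "A \<in> sets observation_space" unfolding A_def by measurable
  have sep: "ennreal (2 * d) \<le> loc S z + loc ?S' z" if z: "z \<in> space observation_space" for z
  proof -
    have [measurable]: "T z \<in> borel_measurable borel" by (rule estimator_measurable[OF T z])
    have "ennreal (2 * d) = (\<integral>\<^sup>+x\<in>cell j k. ennreal (\<gamma> * (2 ^ j / 4)) \<partial>lborel)"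
      using \<gamma> by (simp add: nn_integral_cmult_indicator emeasure_cell d_def ennreal_mult'[symmetric])
    also have "\<dots> \<le> (\<integral>\<^sup>+x. ennreal \<bar>T z x - hypothesis j \<gamma> S x\<bar> * indicator (cell j k) x +
        ennreal \<bar>T z x - hypothesis j \<gamma> ?S' x\<bar> * indicator (cell j k) x \<partial>lborel)"
    proof (rule nn_integral_mono)
      fix x
      have "\<gamma> * (2 ^ j / 4) \<le> \<bar>T z x - hypothesis j \<gamma> S x\<bar> + \<bar>T z x - hypothesis j \<gamma> ?S' x\<bar>" if x: "x \<in> cell j k"
      proof -
        have "\<gamma> * (2 ^ j / 4) \<le> \<gamma> * bump j (x - real k / 2 ^ j)"
          using \<gamma> bump_on_cell[OF j x] by (intro mult_left_mono) auto
        also have "\<dots> = hypothesis j \<gamma> ?S' x - hypothesis j \<gamma> S x"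
          using S by (simp add: hypothesis_eq[OF j])
        finally show ?thesis by linarith
      qed
      then show "ennreal (\<gamma> * (2 ^ j / 4)) * indicator (cell j k) x \<le> ennreal \<bar>T z x - hypothesis j \<gamma> S x\<bar> * indicator (cell j k) x +
        ennreal \<bar>T z x - hypothesis j \<gamma> ?S' x\<bar> * indicator (cell j k) x"
        by (cases "x \<in> cell j k") (simp_all add: ennreal_leI flip: ennreal_plus)
    qed
    also have "\<dots> = loc S z + loc ?S' z" unfolding loc_def by (rule nn_integral_add) measurable
    finally show ?thesis .
  qed
  have d0: "d \<ge> 0" using \<gamma> by (simp add: d_def)
  have mA: "{\<omega>\<in>space M. obs S \<omega> \<in> A} \<in> sets M" for S unfolding obs_def by (rule observation_event_measurable[OF A])
  have e1: "ennreal (d * prob {\<omega>\<in>space M. obs S \<omega> \<in> A}) \<le> e S"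
  proof -
    have "ennreal (d * prob {\<omega>\<in>space M. obs S \<omega> \<in> A}) = (\<integral>\<^sup>+\<omega>. ennreal d * indicator {\<omega>\<in>space M. obs S \<omega> \<in> A} \<omega> \<partial>M)"
      using d0 mA by (simp add: nn_integral_cmult_indicator emeasure_eq_measure ennreal_mult')
    also have "\<dots> \<le> (\<integral>\<^sup>+\<omega>. loc S (obs S \<omega>) \<partial>M)"
      by (intro nn_integral_mono) (auto simp: indicator_def A_def)
    finally show ?thesis by (simp add: e_def loc_def obs_def)
  qed
  have e2: "ennreal (d * (1 - prob {\<omega>\<in>space M. obs ?S' \<omega> \<in> A})) \<le> e ?S'"
  proof -
    have c: "space M - {\<omega>\<in>space M. obs ?S' \<omega> \<in> A} \<in> sets M" using mA by auto
    have "ennreal (d * (1 - prob {\<omega>\<in>space M. obs ?S' \<omega> \<in> A})) = ennreal (d * prob (space M - {\<omega>\<in>space M. obs ?S' \<omega> \<in> A}))"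
      using prob_compl[OF mA] by simp
    also have "\<dots> = (\<integral>\<^sup>+\<omega>. ennreal d * indicator (space M - {\<omega>\<in>space M. obs ?S' \<omega> \<in> A}) \<omega> \<partial>M)"
      using d0 c by (simp add: nn_integral_cmult_indicator emeasure_eq_measure ennreal_mult')
    also have "\<dots> \<le> (\<integral>\<^sup>+\<omega>. loc ?S' (obs ?S' \<omega>) \<partial>M)"
    proof (rule nn_integral_mono)
      fix \<omega> assume \<omega>: "\<omega> \<in> space M"
      have z: "obs ?S' \<omega> \<in> space observation_space" using measurable_space[OF mobs \<omega>] .
      have "ennreal d \<le> loc ?S' (obs ?S' \<omega>)" if "obs ?S' \<omega> \<notin> A"
      proof (rule ccontr)
        assume "\<not> ennreal d \<le> loc ?S' (obs ?S' \<omega>)"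
        moreover have "loc S (obs ?S' \<omega>) < ennreal d" using that z by (simp add: A_def not_le)
        ultimately have "loc S (obs ?S' \<omega>) + loc ?S' (obs ?S' \<omega>) < ennreal d + ennreal d"
          by (intro add_strict_mono) (auto simp: not_le)
        also have "\<dots> = ennreal (2 * d)" using d0 by (simp flip: ennreal_plus)
        finally show False using sep[OF z] by simp
      qed
      then show "ennreal d * indicator (space M - {\<omega>\<in>space M. obs ?S' \<omega> \<in> A}) \<omega> \<le> loc ?S' (obs ?S' \<omega>)"
        using \<omega> by (auto simp: indicator_def)
    qed
    finally show ?thesis by (simp add: e_def loc_def obs_def)
  qed
  have test: "prob {\<omega>\<in>space M. obs ?S' \<omega> \<in> A} \<le> 1 / 8 + exp 1 / \<theta> + \<theta> * prob {\<omega>\<in>space M. obs S \<omega> \<in> A}"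
  proof -
    have "prob {\<omega>\<in>space M. obs ?S' \<omega> \<in> A} \<le> \<gamma>\<^sup>2 * 2 ^ j * C * 2 powr (- 2 * \<nu> * real j) * real n / (2 * \<sigma>\<^sup>2 * 1) + exp 1 / \<theta> +
        \<theta> * prob {\<omega>\<in>space M. obs S \<omega> \<in> A}"
      unfolding obs_def hypothesis_def
      using hypothesis_coeff_diff[OF S] \<gamma> \<theta> A by (intro observation_test[OF Clow C n]) auto
    then show ?thesis using energy unfolding mult_1_right by linarith
  qed
  have "exp 1 / \<theta> = 1 / 8" by (simp add: \<theta>_def)
  then have "3 / 4 \<le> \<theta> * prob {\<omega>\<in>space M. obs S \<omega> \<in> A} + (1 - prob {\<omega>\<in>space M. obs ?S' \<omega> \<in> A})" using test by linarith
  also have "\<dots> \<le> \<theta> * prob {\<omega>\<in>space M. obs S \<omega> \<in> A} + \<theta> * (1 - prob {\<omega>\<in>space M. obs ?S' \<omega> \<in> A})"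
    using \<theta> prob_le_1[of "{\<omega>\<in>space M. obs ?S' \<omega> \<in> A}"] mult_right_mono[of 1 \<theta> "1 - prob {\<omega>\<in>space M. obs ?S' \<omega> \<in> A}"] by simp
  finally have "3 / (4 * \<theta>) \<le> prob {\<omega>\<in>space M. obs S \<omega> \<in> A} + (1 - prob {\<omega>\<in>space M. obs ?S' \<omega> \<in> A})"
    using \<theta> by (simp add: field_simps)
  then have "d * (3 / (4 * \<theta>)) \<le> d * prob {\<omega>\<in>space M. obs S \<omega> \<in> A} + d * (1 - prob {\<omega>\<in>space M. obs ?S' \<omega> \<in> A})"
    using d0 by (simp only: distrib_left[symmetric] mult_left_mono)
  \<comment> \<open>The constant is \<open>96 * 4 * 8 / 3 = 1024\<close>, times
    \<open>exp 1\<close>.\<close>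
  moreover have "d * (3 / (4 * \<theta>)) = \<gamma> / (1024 * exp 1)" by (simp add: d_def \<theta>_def)
  ultimately have "ennreal (\<gamma> / (1024 * exp 1)) \<le> ennreal (d * prob {\<omega>\<in>space M. obs S \<omega> \<in> A} + d * (1 - prob {\<omega>\<in>space M. obs ?S' \<omega> \<in> A}))"
    by (intro ennreal_leI) simp
  also have "\<dots> = ennreal (d * prob {\<omega>\<in>space M. obs S \<omega> \<in> A}) + ennreal (d * (1 - prob {\<omega>\<in>space M. obs ?S' \<omega> \<in> A}))"
    using d0 prob_le_1 by (intro ennreal_plus) auto
  also have "\<dots> \<le> e S + e ?S'" by (intro add_mono e1 e2)
  finally show ?thesis .
qed

text \<open>Summing \<open>flip_risk\<close> over the pairs of subsets that differ at
  \<open>k\<close>, and then over \<open>k\<close>, bounds the total of the cell losses from below;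
  disjointness of the cells bounds it by twice the total risk. Hence the risk cannot be small at
  every subset.\<close>

lemma risk_regular:
  assumes Clow: "\<And>j. (\<integral>\<^sup>+\<omega>. ennreal (dyadic_energy (\<lambda>t. Y t \<omega>) j) \<partial>M) \<le> ennreal (C * 2 powr (- 2 * \<nu> * real j))"
    and C: "C > 0" and T: "T \<in> estimators" and j: "j \<ge> 1" and n: "n > 0" and \<gamma>: "\<gamma> > 0"
    and energy: "\<gamma>\<^sup>2 * 2 ^ j * C * 2 powr (- 2 * \<nu> * real j) * real n / (2 * \<sigma>\<^sup>2) \<le> 1 / 8"
    and \<rho>: "\<rho> > 1"
  shows "\<exists>S\<subseteq>{..<2 ^ j}. ennreal (\<gamma> * 2 ^ j / (8192 * exp 1)) \<le>
     (\<integral>\<^sup>+\<omega>. Lnorm \<rho> (\<lambda>x. T (observation W Y \<sigma> x0 n (hypothesis j \<gamma> S) \<omega>) x - hypothesis j \<gamma> S x) \<partial>M)"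
proof (rule ccontr)
  assume neg: "\<not> ?thesis"
  let ?N = "2 ^ j :: nat"
  \<comment> \<open>\<open>8192 = 1024 * 2 * 2 * 2\<close>: subsets come in pairs,
    \<open>nn_integral_abs_le_Lnorm\<close> costs a factor 2, and the last 2 leaves room for a
    strict contradiction.\<close>
  define r where "r = \<gamma> * 2 ^ j / (8192 * exp 1)"
  define risk where "risk S = (\<integral>\<^sup>+\<omega>. Lnorm \<rho> (\<lambda>x. T (observation W Y \<sigma> x0 n (hypothesis j \<gamma> S) \<omega>) x - hypothesis j \<gamma> S x) \<partial>M)" for S
  define loss where "loss S \<omega> x = ennreal \<bar>T (observation W Y \<sigma> x0 n (hypothesis j \<gamma> S) \<omega>) x - hypothesis j \<gamma> S x\<bar>" for S \<omega> x
  define e where "e k S = (\<integral>\<^sup>+\<omega>. (\<integral>\<^sup>+x\<in>cell j k. loss S \<omega> x \<partial>lborel) \<partial>M)" for k S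
  have r0: "r > 0" using \<gamma> by (simp add: r_def)
  have le: "risk S \<le> ennreal r" if "S \<subseteq> {..<?N}" for S using neg that by (auto simp: risk_def r_def not_le intro: less_imp_le)
  have up: "(\<Sum>k<?N. e k S) \<le> 2 * risk S" for S
  proof -
    have mobs: "observation W Y \<sigma> x0 n (hypothesis j \<gamma> S) \<in> measurable M observation_space"
      by (rule measurable_observation[OF continuous_hypothesis])
    have me: "(\<lambda>\<omega>. \<integral>\<^sup>+x\<in>cell j k. loss S \<omega> x \<partial>lborel) \<in> borel_measurable M" for k
      unfolding loss_def
      by (rule measurable_compose[OF mobs estimator_loss_measurable[where h="\<lambda>y. y", OF T]]) auto
    have "(\<Sum>k<?N. e k S) = (\<integral>\<^sup>+\<omega>. (\<Sum>k<?N. \<integral>\<^sup>+x\<in>cell j k. loss S \<omega> x \<partial>lborel) \<partial>M)"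
      unfolding e_def by (rule nn_integral_sum[symmetric]) (rule me)
    also have "\<dots> \<le> (\<integral>\<^sup>+\<omega>. 2 * Lnorm \<rho> (\<lambda>x. T (observation W Y \<sigma> x0 n (hypothesis j \<gamma> S) \<omega>) x - hypothesis j \<gamma> S x) \<partial>M)"
    proof (rule nn_integral_mono)
      fix \<omega> assume "\<omega> \<in> space M"
      then have [measurable]: "T (observation W Y \<sigma> x0 n (hypothesis j \<gamma> S) \<omega>) \<in> borel_measurable borel"
        by (intro estimator_measurable[OF T] measurable_space[OF mobs])
      have "(\<Sum>k<?N. \<integral>\<^sup>+x\<in>cell j k. loss S \<omega> x \<partial>lborel) \<le> (\<integral>\<^sup>+x\<in>{0..1}. loss S \<omega> x \<partial>lborel)"
        unfolding loss_def by (rule sum_nn_integral_cell_le) auto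
      also have "\<dots> \<le> 2 * Lnorm \<rho> (\<lambda>x. T (observation W Y \<sigma> x0 n (hypothesis j \<gamma> S) \<omega>) x - hypothesis j \<gamma> S x)"
        unfolding loss_def by (rule nn_integral_abs_le_Lnorm[OF _ \<rho>]) measurable
      finally show "(\<Sum>k<?N. \<integral>\<^sup>+x\<in>cell j k. loss S \<omega> x \<partial>lborel) \<le> 2 * Lnorm \<rho> (\<lambda>x. T (observation W Y \<sigma> x0 n (hypothesis j \<gamma> S) \<omega>) x - hypothesis j \<gamma> S x)" .
    qed
    also have "\<dots> = 2 * risk S"
    proof -
      have mL: "(\<lambda>\<omega>. Lnorm \<rho> (\<lambda>x. T (observation W Y \<sigma> x0 n (hypothesis j \<gamma> S) \<omega>) x - hypothesis j \<gamma> S x)) \<in> borel_measurable M"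
      proof -
        have "(\<lambda>\<omega>. \<integral>\<^sup>+x\<in>{0..1}. ennreal (\<bar>T (observation W Y \<sigma> x0 n (hypothesis j \<gamma> S) \<omega>) x - hypothesis j \<gamma> S x\<bar> powr \<rho>) \<partial>lborel) \<in> borel_measurable M"
          by (rule measurable_compose[OF mobs estimator_loss_measurable[where h="\<lambda>y. y powr \<rho>", OF T]]) auto
        then show ?thesis unfolding Lnorm_def ennreal_powr_def by measurable
      qed
      show ?thesis unfolding risk_def by (rule nn_integral_cmult[OF mL])
    qed
    finally show ?thesis .
  qed
  have low: "ennreal (2 ^ (?N - 1) * (\<gamma> / (1024 * exp 1))) \<le> (\<Sum>S\<in>Pow {..<?N}. e k S)" if k: "k < ?N" for k
  proof -
    have c: "card (Pow ({..<?N} - {k})) = 2 ^ (?N - 1)" using k by (simp add: card_Pow)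
    have "ennreal (2 ^ (?N - 1) * (\<gamma> / (1024 * exp 1))) = of_nat (card (Pow ({..<?N} - {k}))) * ennreal (\<gamma> / (1024 * exp 1))"
      unfolding c using \<gamma> by (simp add: ennreal_mult'[symmetric] ennreal_of_nat_eq_real_of_nat)
    also have "\<dots> = (\<Sum>S\<in>Pow ({..<?N} - {k}). ennreal (\<gamma> / (1024 * exp 1)))" by simp
    also have "\<dots> \<le> (\<Sum>S\<in>Pow ({..<?N} - {k}). e k S + e k (insert k S))"
      unfolding e_def loss_def
      by (intro sum_mono flip_risk[OF Clow C T j n \<gamma> energy]) (auto intro: finite_subset)
    also have "\<dots> = (\<Sum>S\<in>Pow {..<?N}. e k S)" using k by (intro sum_Pow_split[symmetric]) auto
    finally show ?thesis .
  qed
  have "ennreal (real ?N * (2 ^ (?N - 1) * (\<gamma> / (1024 * exp 1)))) = (\<Sum>k<?N. ennreal (2 ^ (?N - 1) * (\<gamma> / (1024 * exp 1))))"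
    unfolding sum_constant card_lessThan ennreal_of_nat_eq_real_of_nat by (rule ennreal_mult') simp
  also have "\<dots> \<le> (\<Sum>k<?N. \<Sum>S\<in>Pow {..<?N}. e k S)" by (intro sum_mono low) auto
  also have "\<dots> = (\<Sum>S\<in>Pow {..<?N}. \<Sum>k<?N. e k S)" by (rule sum.swap)
  also have "\<dots> \<le> (\<Sum>S\<in>Pow {..<?N}. ennreal (2 * r))"
  proof (rule sum_mono)
    fix S assume "S \<in> Pow {..<?N}"
    then have "2 * risk S \<le> 2 * ennreal r" by (intro mult_left_mono le) auto
    then show "(\<Sum>k<?N. e k S) \<le> ennreal (2 * r)" using up[of S] by (simp add: ennreal_mult')
  qed
  also have "\<dots> = ennreal (2 ^ ?N * (2 * r))"
  proof -
    have "real (card (Pow {..<?N})) = 2 ^ ?N" by (simp add: card_Pow)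
    then show ?thesis
      unfolding sum_constant ennreal_of_nat_eq_real_of_nat by (simp only:) (rule ennreal_mult'[symmetric], simp)
  qed
  finally have "real ?N * (2 ^ (?N - 1) * (\<gamma> / (1024 * exp 1))) \<le> 2 ^ ?N * (2 * r)"
    using r0 by (subst (asm) ennreal_le_iff) auto
  moreover have "(2::real) ^ ?N = 2 * 2 ^ (?N - 1)" by (simp flip: power_Suc)
  ultimately have "2 ^ (?N - 1) * (real ?N * (\<gamma> / (1024 * exp 1))) \<le> 2 ^ (?N - 1) * (4 * r)"
    by (simp only: mult.left_commute)
  then have "real ?N * (\<gamma> / (1024 * exp 1)) \<le> 4 * r" by (rule mult_left_le_imp_le) simp
  then show False using \<gamma> by (simp add: r_def field_simps)
qed

end

section \<open>Lower bound in the sparse case\<close>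

lemma powr_triangle:
  fixes a b :: real
  assumes "\<rho> > 0"
  shows "\<bar>a\<bar> powr \<rho> \<le> 2 powr \<rho> * (\<bar>b\<bar> powr \<rho> + \<bar>b - a\<bar> powr \<rho>)"
proof -
  have "\<bar>a\<bar> \<le> \<bar>b\<bar> + \<bar>b - a\<bar>" by linarith
  moreover have "\<bar>b\<bar> \<le> max \<bar>b\<bar> \<bar>b - a\<bar>" "\<bar>b - a\<bar> \<le> max \<bar>b\<bar> \<bar>b - a\<bar>" by simp_all
  ultimately have "\<bar>a\<bar> \<le> 2 * max \<bar>b\<bar> \<bar>b - a\<bar>" by linarith
  then have "\<bar>a\<bar> powr \<rho> \<le> (2 * max \<bar>b\<bar> \<bar>b - a\<bar>) powr \<rho>" using assms by (intro powr_mono2) auto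
  also have "\<dots> = 2 powr \<rho> * (max \<bar>b\<bar> \<bar>b - a\<bar>) powr \<rho>" by (rule powr_mult)
  also have "(max \<bar>b\<bar> \<bar>b - a\<bar>) powr \<rho> \<le> \<bar>b\<bar> powr \<rho> + \<bar>b - a\<bar> powr \<rho>" by (simp add: max_def)
  finally show ?thesis by simp
qed

lemma nn_integral_powr_triangle:
  fixes f g :: "real \<Rightarrow> real"
  assumes [measurable]: "f \<in> borel_measurable borel" "g \<in> borel_measurable borel" "A \<in> sets borel" and \<rho>: "\<rho> > 0"
  shows "(\<integral>\<^sup>+x\<in>A. ennreal (\<bar>f x\<bar> powr \<rho>) \<partial>lborel) \<le> ennreal (2 powr \<rho>) *
     ((\<integral>\<^sup>+x\<in>A. ennreal (\<bar>g x\<bar> powr \<rho>) \<partial>lborel) + (\<integral>\<^sup>+x\<in>A. ennreal (\<bar>g x - f x\<bar> powr \<rho>) \<partial>lborel))"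
proof -
  have "(\<integral>\<^sup>+x\<in>A. ennreal (\<bar>f x\<bar> powr \<rho>) \<partial>lborel) \<le>
     (\<integral>\<^sup>+x. ennreal (2 powr \<rho>) * (ennreal (\<bar>g x\<bar> powr \<rho>) * indicator A x + ennreal (\<bar>g x - f x\<bar> powr \<rho>) * indicator A x) \<partial>lborel)"
  proof (rule nn_integral_mono)
    fix x
    have "ennreal (\<bar>f x\<bar> powr \<rho>) \<le> ennreal (2 powr \<rho>) * (ennreal (\<bar>g x\<bar> powr \<rho>) + ennreal (\<bar>g x - f x\<bar> powr \<rho>))"
      using ennreal_leI[OF powr_triangle[OF \<rho>, of "f x" "g x"]] by (simp add: ennreal_mult')
    then show "ennreal (\<bar>f x\<bar> powr \<rho>) * indicator A x \<le> ennreal (2 powr \<rho>) * (ennreal (\<bar>g x\<bar> powr \<rho>) * indicator A x + ennreal (\<bar>g x - f x\<bar> powr \<rho>) * indicator A x)"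
      by (auto simp: indicator_def)
  qed
  then show ?thesis by (simp add: nn_integral_cmult nn_integral_add)
qed

text \<open>How many pieces of mass \<open>t\<close>, the value of \<open>sparse_radius\<close>, fit
  into a function within that radius of one bump. With \<open>J = 2 powr (\<rho> + 1) * t\<close>
  the bump has mass at most \<open>12 * 4 powr \<rho> * J\<close>, the distance adds
  \<open>t\<close>, and \<open>2 powr \<rho>\<close> is the triangle constant.\<close>

definition sparse_overlap :: "real \<Rightarrow> real" where
  "sparse_overlap \<rho> = 2 powr \<rho> * (1 + 12 * 4 powr \<rho> * 2 powr (\<rho> + 1))"

text \<open>The \<rho>-th power of a distance. The second factor, \<open>J\<close>, is the mass of a
  bump guaranteed on its cell, and the radius \<open>t\<close> satisfies
  \<open>J = 2 powr \<rho> * (t + t)\<close>: two functions with mass below \<open>t\<close> on the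
  cell cannot combine to the bump.\<close>

definition sparse_radius :: "real \<Rightarrow> nat \<Rightarrow> real \<Rightarrow> real" where
  "sparse_radius \<rho> j \<gamma> = 2 powr (- \<rho> - 1) * ((\<gamma> * (2 ^ j / 4)) powr \<rho> * (1 / (12 * 2 ^ j)))"

text \<open>Interpolation between the sup norm and the \<open>L^1\<close> norm. The bound is written
  as a constant multiple of the mass guaranteed on the cell of the bump.\<close>

lemma hypothesis_singleton_powr_integral:
  assumes j: "j \<ge> 1" and k: "k < 2 ^ j" and \<gamma>: "\<gamma> > 0" and \<rho>: "\<rho> > 1"
  shows "(\<integral>\<^sup>+x\<in>{0..1}. ennreal (\<bar>hypothesis j \<gamma> {k} x\<bar> powr \<rho>) \<partial>lborel) \<le>
    ennreal (12 * 4 powr \<rho> * ((\<gamma> * (2 ^ j / 4)) powr \<rho> * (1 / (12 * 2 ^ j))))"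
proof -
  let ?f = "hypothesis j \<gamma> {k}"
  have i: "set_integrable lborel {0..1} (\<lambda>x. \<bar>?f x\<bar>)"
    by (intro borel_integrable_atLeastAtMost' continuous_intros continuous_hypothesis)
  have "(\<integral>\<^sup>+x\<in>{0..1}. ennreal (\<bar>?f x\<bar> powr \<rho>) \<partial>lborel) \<le> (\<integral>\<^sup>+x. ennreal ((\<gamma> * 2 ^ j) powr (\<rho> - 1)) * ennreal (indicator {0..1} x * \<bar>?f x\<bar>) \<partial>lborel)"
  proof (rule nn_integral_mono)
    fix x
    have "\<bar>?f x\<bar> powr \<rho> = \<bar>?f x\<bar> powr (\<rho> - 1) * \<bar>?f x\<bar>"
      using powr_mult_base[of "\<bar>?f x\<bar>" "\<rho> - 1"] by (simp add: mult.commute)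
    also have "\<dots> \<le> (\<gamma> * 2 ^ j) powr (\<rho> - 1) * \<bar>?f x\<bar>"
      using hypothesis_bound[OF j, of "{k}" \<gamma> x] k \<gamma> \<rho> by (intro mult_right_mono powr_mono2) auto
    finally show "ennreal (\<bar>?f x\<bar> powr \<rho>) * indicator {0..1} x \<le> ennreal ((\<gamma> * 2 ^ j) powr (\<rho> - 1)) * ennreal (indicator {0..1} x * \<bar>?f x\<bar>)"
      by (auto simp: indicator_def ennreal_mult'[symmetric] intro!: ennreal_leI)
  qed
  also have "\<dots> = ennreal ((\<gamma> * 2 ^ j) powr (\<rho> - 1)) * (\<integral>\<^sup>+x. ennreal (indicator {0..1} x * \<bar>?f x\<bar>) \<partial>lborel)"
    by (rule nn_integral_cmult) measurable
  also have "(\<integral>\<^sup>+x. ennreal (indicator {0..1} x * \<bar>?f x\<bar>) \<partial>lborel) = ennreal (LINT x:{0..1}|lborel. \<bar>?f x\<bar>)"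
    using i unfolding set_integrable_def set_lebesgue_integral_def by (intro nn_integral_eq_integral[THEN trans]) auto
  also have "(LINT x:{0..1}|lborel. \<bar>?f x\<bar>) = integral {0..1} (\<lambda>x. \<bar>?f x\<bar>)"
    using i by (rule set_borel_integral_eq_integral)
  also have "ennreal ((\<gamma> * 2 ^ j) powr (\<rho> - 1)) * ennreal (integral {0..1} (\<lambda>x. \<bar>?f x\<bar>)) \<le> ennreal ((\<gamma> * 2 ^ j) powr (\<rho> - 1)) * ennreal \<gamma>"
    using hypothesis_singleton_integral[OF j, of \<gamma> k] \<gamma> by (intro mult_left_mono ennreal_leI) auto
  also have "\<dots> = ennreal ((\<gamma> * 2 ^ j) powr (\<rho> - 1) * \<gamma>)" by (simp add: ennreal_mult')
  also have "(\<gamma> * 2 ^ j) powr (\<rho> - 1) * \<gamma> = (\<gamma> * 2 ^ j) powr \<rho> / 2 ^ j"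
    using \<gamma> powr_mult_base[of "\<gamma> * 2 ^ j" "\<rho> - 1"] by (simp add: field_simps)
  also have "\<dots> = 12 * 4 powr \<rho> * ((\<gamma> * (2 ^ j / 4)) powr \<rho> * (1 / (12 * 2 ^ j)))"
    using \<gamma> powr_mult[of 4 "\<gamma> * (2 ^ j / 4)" \<rho>] by (simp add: field_simps)
  finally show ?thesis .
qed

lemma hypothesis_singleton_cell_integral:
  assumes j: "j \<ge> 1" and \<gamma>: "\<gamma> > 0" and \<rho>: "\<rho> > 1"
  shows "ennreal ((\<gamma> * (2 ^ j / 4)) powr \<rho> * (1 / (12 * 2 ^ j))) \<le> (\<integral>\<^sup>+x\<in>cell j k. ennreal (\<bar>hypothesis j \<gamma> {k} x\<bar> powr \<rho>) \<partial>lborel)"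
proof -
  have "ennreal ((\<gamma> * (2 ^ j / 4)) powr \<rho> * (1 / (12 * 2 ^ j))) = (\<integral>\<^sup>+x. ennreal ((\<gamma> * (2 ^ j / 4)) powr \<rho>) * indicator (cell j k) x \<partial>lborel)"
    by (simp add: nn_integral_cmult_indicator emeasure_cell ennreal_mult'[symmetric])
  also have "\<dots> \<le> (\<integral>\<^sup>+x\<in>cell j k. ennreal (\<bar>hypothesis j \<gamma> {k} x\<bar> powr \<rho>) \<partial>lborel)"
  proof (rule nn_integral_mono)
    fix x
    have "(\<gamma> * (2 ^ j / 4)) powr \<rho> \<le> \<bar>hypothesis j \<gamma> {k} x\<bar> powr \<rho>" if x: "x \<in> cell j k"
    proof -
      have "\<gamma> * (2 ^ j / 4) \<le> \<gamma> * bump j (x - real k / 2 ^ j)"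
        using \<gamma> bump_on_cell[OF j x] by (intro mult_left_mono) auto
      also have "\<dots> \<le> \<bar>hypothesis j \<gamma> {k} x\<bar>" unfolding hypothesis_eq[OF j] by simp
      finally show ?thesis using \<gamma> \<rho> by (intro powr_mono2) auto
    qed
    then show "ennreal ((\<gamma> * (2 ^ j / 4)) powr \<rho>) * indicator (cell j k) x \<le> ennreal (\<bar>hypothesis j \<gamma> {k} x\<bar> powr \<rho>) * indicator (cell j k) x"
      by (auto simp: indicator_def intro: ennreal_leI)
  qed
  finally show ?thesis .
qed

text \<open>A function close to many of the bumps would have to be large on as many disjoint cells, while closeness to
  one of them already bounds its norm.\<close>

lemma few_close_hypotheses:
  assumes j: "j \<ge> 1" and \<gamma>: "\<gamma> > 0" and \<rho>: "\<rho> > 1" and h [measurable]: "h \<in> borel_measurable borel"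
  defines "K \<equiv> {k. k < 2 ^ j \<and> (\<integral>\<^sup>+x\<in>{0..1}. ennreal (\<bar>h x - hypothesis j \<gamma> {k} x\<bar> powr \<rho>) \<partial>lborel) < ennreal (sparse_radius \<rho> j \<gamma>)}"
  shows "real (card K) \<le> sparse_overlap \<rho>"
proof (cases "K = {}")
  case True
  then show ?thesis by (simp add: sparse_overlap_def)
next
  case False
  define J where "J = (\<gamma> * (2 ^ j / 4)) powr \<rho> * (1 / (12 * 2 ^ j))"
  define t where "t = sparse_radius \<rho> j \<gamma>"
  have J: "J > 0" using \<gamma> by (simp add: J_def)
  have tJ: "t = 2 powr (- \<rho> - 1) * J" by (simp add: t_def sparse_radius_def J_def)
  have t: "t > 0" using J by (simp add: tJ)
  have Jt: "J = 2 powr \<rho> * (t + t)" unfolding tJ by (simp add: powr_diff powr_minus field_simps)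
  have Ksub: "K \<subseteq> {..<2 ^ j}" by (auto simp: K_def)
  let ?n = "\<lambda>A. \<integral>\<^sup>+x\<in>A. ennreal (\<bar>h x\<bar> powr \<rho>) \<partial>lborel"
  have low: "ennreal t \<le> ?n (cell j k)" if k: "k \<in> K" for k
  proof (rule ccontr)
    assume "\<not> ennreal t \<le> ?n (cell j k)"
    then have 1: "?n (cell j k) < ennreal t" by simp
    have "(\<integral>\<^sup>+x\<in>cell j k. ennreal (\<bar>h x - hypothesis j \<gamma> {k} x\<bar> powr \<rho>) \<partial>lborel) \<le> (\<integral>\<^sup>+x\<in>{0..1}. ennreal (\<bar>h x - hypothesis j \<gamma> {k} x\<bar> powr \<rho>) \<partial>lborel)"
      using sum_nn_integral_cell_le[of "{k}" j "\<lambda>x. ennreal (\<bar>h x - hypothesis j \<gamma> {k} x\<bar> powr \<rho>)"] k Ksub by auto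
    also have "\<dots> < ennreal t" using k by (simp add: K_def t_def)
    finally have "?n (cell j k) + (\<integral>\<^sup>+x\<in>cell j k. ennreal (\<bar>h x - hypothesis j \<gamma> {k} x\<bar> powr \<rho>) \<partial>lborel) < ennreal t + ennreal t"
      using 1 by (intro add_strict_mono)
    then have "ennreal (2 powr \<rho>) * (?n (cell j k) + (\<integral>\<^sup>+x\<in>cell j k. ennreal (\<bar>h x - hypothesis j \<gamma> {k} x\<bar> powr \<rho>) \<partial>lborel)) <
        ennreal (2 powr \<rho>) * (ennreal t + ennreal t)"
      by (intro ennreal_mult_strict_left_mono) auto
    also have "\<dots> = ennreal J" unfolding Jt by (subst ennreal_mult', simp, subst ennreal_plus) (use t in auto)
    finally show False
      using hypothesis_singleton_cell_integral[OF j \<gamma> \<rho>, of k]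
        nn_integral_powr_triangle[of "hypothesis j \<gamma> {k}" h "cell j k" \<rho>] \<rho>
      unfolding J_def[symmetric] by (simp add: not_le[symmetric])
  qed
  obtain k0 where k0: "k0 \<in> K" using False by auto
  have k0': "k0 < 2 ^ j" using k0 Ksub by auto
  have "of_nat (card K) * ennreal t \<le> (\<Sum>k\<in>K. ?n (cell j k))"
    using sum_mono[of K "\<lambda>_. ennreal t" "\<lambda>k. ?n (cell j k)"] low by simp
  also have "\<dots> \<le> ?n {0..1}" by (rule sum_nn_integral_cell_le[OF Ksub]) measurable
  also have "\<dots> \<le> ennreal (2 powr \<rho>) * ((\<integral>\<^sup>+x\<in>{0..1}. ennreal (\<bar>hypothesis j \<gamma> {k0} x\<bar> powr \<rho>) \<partial>lborel) +
      (\<integral>\<^sup>+x\<in>{0..1}. ennreal (\<bar>hypothesis j \<gamma> {k0} x - h x\<bar> powr \<rho>) \<partial>lborel))"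
    using \<rho> by (intro nn_integral_powr_triangle) auto
  also have "\<dots> \<le> ennreal (2 powr \<rho>) * (ennreal (12 * 4 powr \<rho> * J) + ennreal t)"
    using hypothesis_singleton_powr_integral[OF j k0' \<gamma> \<rho>] k0
    by (intro mult_left_mono add_mono) (auto simp: J_def K_def t_def abs_minus_commute less_imp_le)
  also have "\<dots> = ennreal (2 powr \<rho> * (12 * 4 powr \<rho> * J + t))"
    using J t by (simp add: ennreal_mult' ennreal_plus)
  also have "2 powr \<rho> * (12 * 4 powr \<rho> * J + t) = sparse_overlap \<rho> * t"
    unfolding Jt sparse_overlap_def by (simp add: powr_add algebra_simps)
  finally have "ennreal (real (card K) * t) \<le> ennreal (sparse_overlap \<rho> * t)"
    using t by (simp add: ennreal_of_nat_eq_real_of_nat ennreal_mult')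
  then have "real (card K) * t \<le> sparse_overlap \<rho> * t"
    using t by (subst (asm) ennreal_le_iff) (auto simp: sparse_overlap_def)
  then show ?thesis using t by simp
qed

context filter_model
begin

text \<open>Under the hypothesis 0 the expected number of bumps close to the estimate is at most a
  constant, so on average each of the \<open>2 ^ j\<close> bumps is selected with probability of
  order \<open>2 powr (- j)\<close>; a likelihood factor \<open>2 powr (j / 2)\<close> cannot make
  up for this.\<close>

lemma risk_sparse:
  assumes Clow: "\<And>j. (\<integral>\<^sup>+\<omega>. ennreal (dyadic_energy (\<lambda>t. Y t \<omega>) j) \<partial>M) \<le> ennreal (C * 2 powr (- 2 * \<nu> * real j))"
    and C: "C > 0" and T: "T \<in> estimators" and j: "j \<ge> 1" and n: "n > 0" and \<gamma>: "\<gamma> > 0"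
    and energy: "\<gamma>\<^sup>2 * 2 ^ j * C * 2 powr (- 2 * \<nu> * real j) * real n / (2 * \<sigma>\<^sup>2 * (real j * ln 2 / 4)) \<le> 1 / 8"
    and \<rho>: "\<rho> > 1" and large: "2 powr (- real j / 4) \<le> 1 / 8" "sparse_overlap \<rho> * 2 powr (- real j / 2) \<le> 1 / 8"
  shows "\<exists>k<2 ^ j. ennreal (sparse_radius \<rho> j \<gamma> powr (1 / \<rho>) / 2) \<le>
     (\<integral>\<^sup>+\<omega>. Lnorm \<rho> (\<lambda>x. T (observation W Y \<sigma> x0 n (hypothesis j \<gamma> {k}) \<omega>) x - hypothesis j \<gamma> {k} x) \<partial>M)"
proof -
  let ?N = "2 ^ j :: nat"
  define obs where "obs S = observation W Y \<sigma> x0 n (hypothesis j \<gamma> S)" for S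
  define t where "t = sparse_radius \<rho> j \<gamma>"
  have t0: "t \<ge> 0" by (simp add: t_def sparse_radius_def)
  have mobs [measurable]: "obs S \<in> measurable M observation_space" for S
    unfolding obs_def by (rule measurable_observation[OF continuous_hypothesis])
  define g where "g k z = (\<integral>\<^sup>+x\<in>{0..1}. ennreal (\<bar>T z x - hypothesis j \<gamma> {k} x\<bar> powr \<rho>) \<partial>lborel)" for k z
  have mg [measurable]: "g k \<in> borel_measurable observation_space" for k
    unfolding g_def by (rule estimator_loss_measurable[where h="\<lambda>y. y powr \<rho>", OF T]) auto
  define A where "A k = {z\<in>space observation_space. g k z < ennreal t}" for k
  have A [measurable]: "A k \<in> sets observation_space" for k unfolding A_def by measurable
  have mA: "{\<omega>\<in>space M. obs S \<omega> \<in> A k} \<in> sets M" for S k unfolding obs_def by (rule observation_event_measurable[OF A])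
  define P where "P S k = prob {\<omega>\<in>space M. obs S \<omega> \<in> A k}" for S k
  \<comment> \<open>The empty set of bumps is the hypothesis 0. The number of bumps near the
    estimate is bounded pointwise by \<open>few_close_hypotheses\<close>.\<close>
  have P0: "(\<Sum>k<?N. P {} k) \<le> sparse_overlap \<rho>"
  proof -
    have "ennreal (\<Sum>k<?N. P {} k) = (\<Sum>k<?N. emeasure M {\<omega>\<in>space M. obs {} \<omega> \<in> A k})"
      by (simp add: P_def emeasure_eq_measure sum_ennreal)
    also have "\<dots> = (\<Sum>k<?N. \<integral>\<^sup>+\<omega>. indicator {\<omega>\<in>space M. obs {} \<omega> \<in> A k} \<omega> \<partial>M)"
      using mA by simp
    also have "\<dots> = (\<integral>\<^sup>+\<omega>. (\<Sum>k<?N. indicator {\<omega>\<in>space M. obs {} \<omega> \<in> A k} \<omega>) \<partial>M)"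
      using mA by (intro nn_integral_sum[symmetric]) auto
    also have "\<dots> \<le> (\<integral>\<^sup>+\<omega>. ennreal (sparse_overlap \<rho>) \<partial>M)"
    proof (rule nn_integral_mono)
      fix \<omega> assume \<omega>: "\<omega> \<in> space M"
      have z: "obs {} \<omega> \<in> space observation_space" using measurable_space[OF mobs \<omega>] .
      let ?K = "{k. k < ?N \<and> g k (obs {} \<omega>) < ennreal t}"
      have "(\<Sum>k<?N. indicator {\<omega>\<in>space M. obs {} \<omega> \<in> A k} \<omega>) = (\<Sum>k<?N. if k \<in> ?K then 1 else 0 :: ennreal)"
        using \<omega> z by (intro sum.cong refl) (auto simp: A_def indicator_def)
      also have "\<dots> = (\<Sum>k\<in>{..<?N} \<inter> ?K. 1)" by (rule sum.inter_restrict[symmetric]) simp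
      also have "\<dots> = of_nat (card ({..<?N} \<inter> ?K))" by simp
      also have "{..<?N} \<inter> ?K = ?K" by auto
      also have "of_nat (card ?K) \<le> ennreal (sparse_overlap \<rho>)"
        using few_close_hypotheses[OF j \<gamma> \<rho> estimator_measurable[OF T z]]
        by (simp add: g_def t_def ennreal_of_nat_eq_real_of_nat ennreal_leI)
      finally show "(\<Sum>k<?N. indicator {\<omega>\<in>space M. obs {} \<omega> \<in> A k} \<omega>) \<le> ennreal (sparse_overlap \<rho>)" .
    qed
    also have "\<dots> = ennreal (sparse_overlap \<rho>)" by (simp add: emeasure_space_1)
    finally show ?thesis by (subst (asm) ennreal_le_iff) (simp add: sparse_overlap_def)
  qed
  \<comment> \<open>Here \<open>exp b\<close> is \<open>2 powr (j / 4)\<close>, small against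
    \<theta>. An energy level proportional to \<open>j\<close> is the origin of the logarithm in the
    rate.\<close>
  define b where "b = real j * ln 2 / 4"
  define \<theta> where "\<theta> = 2 powr (real j / 2)"
  have b: "b > 0" using j by (simp add: b_def)
  have eb: "exp b / \<theta> = 2 powr (- real j / 4)"
  proof -
    have "exp b = 2 powr (real j / 4)" by (simp add: powr_def b_def)
    then have "exp b / \<theta> = 2 powr (real j / 4 - real j / 2)" by (simp only: \<theta>_def powr_diff)
    then show ?thesis by simp
  qed
  have test: "P {k} k \<le> 1 / 8 + 1 / 8 + \<theta> * P {} k" for k
  proof -
    have "P {k} k \<le> \<gamma>\<^sup>2 * 2 ^ j * C * 2 powr (- 2 * \<nu> * real j) * real n / (2 * \<sigma>\<^sup>2 * b) + exp b / \<theta> + \<theta> * P {} k"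
      unfolding P_def obs_def hypothesis_def
      using hypothesis_coeff_diff[of "{}" k] \<gamma> A b by (intro observation_test[OF Clow C n]) (auto simp: \<theta>_def)
    then show ?thesis using energy large(1) unfolding b_def[symmetric] eb by linarith
  qed
  \<comment> \<open>Otherwise averaging over \<open>k\<close> would give
    \<open>1 / 2 \<le> 1 / 4 + 1 / 8\<close>.\<close>
  have "\<exists>k<?N. P {k} k \<le> 1 / 2"
  proof (rule ccontr)
    assume "\<not> ?thesis"
    then have "1 / 2 \<le> P {k} k" if "k < ?N" for k using that by (auto simp: not_le intro: less_imp_le)
    then have "(\<Sum>k<?N. 1 / 2) \<le> (\<Sum>k<?N. P {k} k)" by (intro sum_mono) auto
    also have "\<dots> \<le> (\<Sum>k<?N. 1 / 8 + 1 / 8 + \<theta> * P {} k)" by (intro sum_mono test)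
    also have "\<dots> = real ?N * (1 / 4) + \<theta> * (\<Sum>k<?N. P {} k)" by (simp add: sum.distrib sum_distrib_left)
    also have "\<theta> * (\<Sum>k<?N. P {} k) \<le> \<theta> * sparse_overlap \<rho>" using P0 by (intro mult_left_mono) (auto simp: \<theta>_def)
    also have "\<theta> * sparse_overlap \<rho> = real ?N * (sparse_overlap \<rho> * 2 powr (- real j / 2))"
    proof -
      have "real ?N * 2 powr (- real j / 2) = 2 powr (real j + - real j / 2)" unfolding powr_add by (simp add: powr_realpow)
      also have "real j + - real j / 2 = real j / 2" by simp
      finally have "\<theta> = real ?N * 2 powr (- real j / 2)" by (simp add: \<theta>_def)
      then show ?thesis by (simp only: ac_simps)
    qed
    also have "\<dots> \<le> real ?N * (1 / 8)" using large(2) by (intro mult_left_mono) auto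
    finally have "real ?N * (1 / 2) \<le> real ?N * (1 / 4) + real ?N * (1 / 8)" by simp
    moreover have "real ?N > 0" by simp
    ultimately show False by linarith
  qed
  then obtain k where k: "k < ?N" "P {k} k \<le> 1 / 2" by blast
  have c: "space M - {\<omega>\<in>space M. obs {k} \<omega> \<in> A k} \<in> sets M" using mA by auto
  have "ennreal (t powr (1 / \<rho>) / 2) \<le> ennreal (t powr (1 / \<rho>) * prob (space M - {\<omega>\<in>space M. obs {k} \<omega> \<in> A k}))"
  proof (rule ennreal_leI)
    have "1 / 2 \<le> prob (space M - {\<omega>\<in>space M. obs {k} \<omega> \<in> A k})" using k(2) prob_compl[OF mA, of "{k}" k] by (simp add: P_def)
    then have "t powr (1 / \<rho>) * (1 / 2) \<le> t powr (1 / \<rho>) * prob (space M - {\<omega>\<in>space M. obs {k} \<omega> \<in> A k})" by (intro mult_left_mono) auto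
    then show "t powr (1 / \<rho>) / 2 \<le> t powr (1 / \<rho>) * prob (space M - {\<omega>\<in>space M. obs {k} \<omega> \<in> A k})" by simp
  qed
  also have "\<dots> = (\<integral>\<^sup>+\<omega>. ennreal (t powr (1 / \<rho>)) * indicator (space M - {\<omega>\<in>space M. obs {k} \<omega> \<in> A k}) \<omega> \<partial>M)"
    using c by (simp add: nn_integral_cmult_indicator emeasure_eq_measure ennreal_mult')
  also have "\<dots> \<le> (\<integral>\<^sup>+\<omega>. Lnorm \<rho> (\<lambda>x. T (obs {k} \<omega>) x - hypothesis j \<gamma> {k} x) \<partial>M)"
  proof (rule nn_integral_mono)
    fix \<omega> assume \<omega>: "\<omega> \<in> space M"
    have z: "obs {k} \<omega> \<in> space observation_space" using measurable_space[OF mobs \<omega>] .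
    have "ennreal (t powr (1 / \<rho>)) \<le> Lnorm \<rho> (\<lambda>x. T (obs {k} \<omega>) x - hypothesis j \<gamma> {k} x)" if "obs {k} \<omega> \<notin> A k"
      using that z t0 \<rho> by (intro Lnorm_ge) (auto simp: A_def g_def not_less)
    then show "ennreal (t powr (1 / \<rho>)) * indicator (space M - {\<omega>\<in>space M. obs {k} \<omega> \<in> A k}) \<omega> \<le> Lnorm \<rho> (\<lambda>x. T (obs {k} \<omega>) x - hypothesis j \<gamma> {k} x)"
      using \<omega> by (auto simp: indicator_def)
  qed
  finally show ?thesis using k(1) unfolding t_def obs_def by blast
qed

end

section \<open>Rates of convergence\<close>

lemma minimax_risk_ge:
  assumes "\<And>T. T \<in> estimators \<Longrightarrow> \<exists>f\<in>F. r \<le> (\<integral>\<^sup>+\<omega>. Lnorm \<rho> (\<lambda>x. T (observation W Y \<sigma> x0 n f \<omega>) x - f x) \<partial>M)"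
  shows "r \<le> minimax_risk M W Y \<sigma> x0 \<rho> F n"
  unfolding minimax_risk_def
proof (rule INF_greatest)
  fix T :: "(real \<Rightarrow> real \<times> real) \<Rightarrow> real \<Rightarrow> real" assume "T \<in> estimators"
  then obtain f where "f \<in> F" "r \<le> (\<integral>\<^sup>+\<omega>. Lnorm \<rho> (\<lambda>x. T (observation W Y \<sigma> x0 n f \<omega>) x - f x) \<partial>M)"
    using assms by blast
  then show "r \<le> (SUP f\<in>F. \<integral>\<^sup>+\<omega>. Lnorm \<rho> (\<lambda>x. T (observation W Y \<sigma> x0 n f \<omega>) x - f x) \<partial>M)"
    using order_trans SUP_upper[of f F "\<lambda>f. \<integral>\<^sup>+\<omega>. Lnorm \<rho> (\<lambda>x. T (observation W Y \<sigma> x0 n f \<omega>) x - f x) \<partial>M"] by blast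
qed

text \<open>The least \<open>j\<close> with the first inequality; \<open>n \<ge> 2\<close> excludes
  \<open>j = 0\<close>, and minimality gives the second inequality.\<close>

lemma regular_level:
  fixes D :: real
  assumes D: "D > 0" and n: "n \<ge> (2::nat)"
  obtains j :: nat where "j \<ge> 1" "real n \<le> 2 powr (real j * D)" "2 powr (real (j - 1) * D) \<le> real n"
proof -
  have ex: "\<exists>j::nat. real n \<le> 2 powr (real j * D)"
  proof -
    obtain j :: nat where "real j > log 2 (real n) / D" using reals_Archimedean2 by blast
    then have "log 2 (real n) \<le> real j * D" using D by (simp add: field_simps)
    then have "2 powr log 2 (real n) \<le> 2 powr (real j * D)" by (intro powr_mono) auto
    then show ?thesis using n by auto
  qed
  define j where "j = (LEAST j::nat. real n \<le> 2 powr (real j * D))"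
  have 1: "real n \<le> 2 powr (real j * D)" unfolding j_def using ex by (rule LeastI_ex)
  have "j \<noteq> 0" using 1 n by (cases "j = 0") auto
  then have "\<not> real n \<le> 2 powr (real (j - 1) * D)" using not_less_Least[of "j - 1" "\<lambda>j. real n \<le> 2 powr (real j * D)"] by (simp add: j_def)
  then show thesis using that[of j] 1 \<open>j \<noteq> 0\<close> by simp
qed

text \<open>The least \<open>j \<ge> j0\<close> with the first inequality. Minimality bounds
  \<open>j * 2 powr (j * D)\<close> by a multiple of \<open>n\<close>, and the first inequality
  bounds \<open>ln n\<close> by a multiple of \<open>j\<close>; together they replace
  \<open>j\<close> by the logarithm.\<close>

lemma sparse_level:
  fixes D :: real and j0 :: nat
  assumes D: "D > 0" and j0: "j0 \<ge> 1"
  shows "\<exists>K>0. \<forall>n\<ge>2::nat. \<exists>j\<ge>j0. real n \<le> real j * 2 powr (real j * D) \<and> 2 powr (real j * D) \<le> K * (real n / ln (real n))"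
proof -
  \<comment> \<open>The first summand covers \<open>j = j0\<close>, where minimality says nothing
    and \<open>n / ln n \<ge> 1\<close> is used; the second covers \<open>j > j0\<close>.\<close>
  define K where "K = 2 powr (real j0 * D) + 2 powr D * (2 * (1 + D))"
  have K: "K > 0" using D by (simp add: K_def add_pos_pos)
  have "\<exists>j\<ge>j0. real n \<le> real j * 2 powr (real j * D) \<and> 2 powr (real j * D) \<le> K * (real n / ln (real n))" if n: "n \<ge> 2" for n :: nat
  proof -
    let ?P = "\<lambda>j. j0 \<le> j \<and> real n \<le> real j * 2 powr (real j * D)"
    have "?P (max n j0)"
    proof -
      have "1 \<le> 2 powr (real (max n j0) * D)" using D by (intro ge_one_powr_ge_zero) auto
      then have "real (max n j0) * 1 \<le> real (max n j0) * 2 powr (real (max n j0) * D)" by (intro mult_left_mono) auto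
      then show ?thesis by simp
    qed
    then have ex: "\<exists>j. ?P j" by blast
    define j where "j = (LEAST j. ?P j)"
    have j: "?P j" unfolding j_def using ex by (rule LeastI_ex)
    have ln: "ln (real n) > 0" "ln (real n) \<le> real n" using n ln_le_minus_one[of "real n"] by auto
    have r1: "1 \<le> real n / ln (real n)" using ln by simp
    have "2 powr (real j * D) \<le> K * (real n / ln (real n))"
    proof (cases "j = j0")
      case True
      have "2 powr (real j * D) \<le> K * 1" using True D by (simp add: K_def)
      also have "\<dots> \<le> K * (real n / ln (real n))" using K r1 by (intro mult_left_mono) auto
      finally show ?thesis .
    next
      case False
      then have j1: "j > j0" using j by simp
      then have "\<not> ?P (j - 1)" using not_less_Least[of "j - 1" ?P] by (simp add: j_def)
      then have low: "real (j - 1) * 2 powr (real (j - 1) * D) < real n" using j1 by auto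
      \<comment> \<open>Here \<open>j \<ge> 2\<close>, because
        \<open>j > j0 \<ge> 1\<close>.\<close>
      have half: "real j / 2 \<le> real (j - 1)" using j1 j0 by auto
      have "real n \<le> 2 powr real j * 2 powr (real j * D)"
      proof -
        have "real j \<le> 2 powr real j" using of_nat_less_two_power[of j, where 'a=real] by (simp add: powr_realpow)
        then have "real j * 2 powr (real j * D) \<le> 2 powr real j * 2 powr (real j * D)" by (intro mult_right_mono) auto
        moreover have "real n \<le> real j * 2 powr (real j * D)" using j by simp
        ultimately show ?thesis by (rule order_trans[rotated])
      qed
      also have "\<dots> = 2 powr (real j * (1 + D))" by (simp add: powr_add[symmetric] algebra_simps)
      finally have "ln (real n) \<le> ln (2 powr (real j * (1 + D)))" using n by (subst ln_le_cancel_iff) auto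
      also have "\<dots> = real j * (1 + D) * ln 2" by (simp add: ln_powr)
      also have "\<dots> \<le> real j * (1 + D) * 1" using D ln_2_less_1 by (intro mult_left_mono) auto
      finally have lnj: "ln (real n) \<le> real j * (1 + D)" by simp
      have "real j / 2 * 2 powr (real (j - 1) * D) \<le> real n"
        by (rule order_trans[OF mult_right_mono[OF half] less_imp_le[OF low]]) simp
      moreover have "2 powr (real j * D) = 2 powr D * 2 powr (real (j - 1) * D)"
        using j1 by (simp add: powr_add[symmetric] of_nat_diff algebra_simps)
      ultimately have "real j * 2 powr (real j * D) \<le> 2 powr D * (2 * real n)"
        using mult_left_mono[of "real j / 2 * 2 powr (real (j - 1) * D)" "real n" "2 powr D * 2"] by (simp add: algebra_simps)
      then have "(1 + D) * (real j * 2 powr (real j * D)) \<le> (1 + D) * (2 powr D * (2 * real n))"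
        using D by (intro mult_left_mono) auto
      moreover have "ln (real n) * 2 powr (real j * D) \<le> real j * (1 + D) * 2 powr (real j * D)"
        using lnj by (intro mult_right_mono) auto
      ultimately have "ln (real n) * 2 powr (real j * D) \<le> 2 powr D * (2 * (1 + D)) * real n" by (simp add: algebra_simps)
      then have "2 powr (real j * D) \<le> 2 powr D * (2 * (1 + D)) * (real n / ln (real n))"
        using ln by (simp add: field_simps)
      also have "\<dots> \<le> K * (real n / ln (real n))"
        using ln by (intro mult_right_mono) (auto simp: K_def)
      finally show ?thesis .
    qed
    then show ?thesis using j by blast
  qed
  then show ?thesis using K by blast
qed

text \<open>The exponents of 2 come from the amplitude, the height of a bump and the length of a
  cell: \<open>- (s + 1 - 1/p) + 1 - 1/\<rho>\<close>, times \<open>j\<close>.\<close>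

lemma sparse_radius_powr:
  assumes \<rho>: "\<rho> > 1" and c: "c > 0"
  shows "sparse_radius \<rho> j (c * 2 powr (- (real j * (s + 1 - 1 / p)))) powr (1 / \<rho>) / 2 =
     c * ((2 powr (- \<rho> - 1) / 12) powr (1 / \<rho>) / 8) * 2 powr (- (real j * (s - 1 / p + 1 / \<rho>)))"
proof -
  let ?g = "c * 2 powr (- (real j * (s + 1 - 1 / p)))"
  have "sparse_radius \<rho> j ?g = (2 powr (- \<rho> - 1) / 12) * ((?g * (2 ^ j / 4)) powr \<rho> * 2 powr (- real j))"
    by (simp add: sparse_radius_def powr_minus powr_realpow field_simps)
  then have "sparse_radius \<rho> j ?g powr (1 / \<rho>) =
      (2 powr (- \<rho> - 1) / 12) powr (1 / \<rho>) * (((?g * (2 ^ j / 4)) powr \<rho>) powr (1 / \<rho>) * (2 powr (- real j)) powr (1 / \<rho>))"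
    by (simp only: powr_mult)
  also have "((?g * (2 ^ j / 4)) powr \<rho>) powr (1 / \<rho>) = ?g * (2 ^ j / 4)"
    using c \<rho> by (simp add: powr_powr)
  also have "(2 powr (- real j)) powr (1 / \<rho>) = 2 powr (- real j / \<rho>)" by (simp add: powr_powr)
  finally have X: "sparse_radius \<rho> j ?g powr (1 / \<rho>) = (2 powr (- \<rho> - 1) / 12) powr (1 / \<rho>) * (?g * (2 ^ j / 4) * 2 powr (- real j / \<rho>))" .
  have "sparse_radius \<rho> j ?g powr (1 / \<rho>) / 2 = c * ((2 powr (- \<rho> - 1) / 12) powr (1 / \<rho>) / 8) *
      (2 powr (- (real j * (s + 1 - 1 / p))) * 2 powr real j * 2 powr (- real j / \<rho>))"
    unfolding X by (simp add: powr_realpow)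
  also have "2 powr (- (real j * (s + 1 - 1 / p))) * 2 powr real j * 2 powr (- real j / \<rho>) = 2 powr (- (real j * (s - 1 / p + 1 / \<rho>)))"
    unfolding powr_add[symmetric] by (rule arg_cong[where f="\<lambda>x. 2 powr x"]) (simp add: algebra_simps)
  finally show ?thesis .
qed

theorem theorem1:
  fixes M :: "'w measure" and W Y :: "real \<Rightarrow> 'w \<Rightarrow> real"
    and v :: "real \<Rightarrow> real"
    and \<sigma> x0 \<rho> R p q s \<nu> \<epsilon> :: real
  assumes "prob_space M"
    and "standard_wiener M W"
    and "L2_process M Y"
    and "indep_processes M W Y"
    and "\<sigma> > 0"
    and "meyer_transition v"
    and "\<rho> > 1" and "R > 0" and "p > 1" and "q > 1" and "s > 1 / p"
    and "\<nu> \<ge> 0"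
    and "C_low M Y \<nu>"
    and "\<epsilon> = (2 * s + 2 * \<nu> + 1) / \<rho> - (2 * \<nu> + 1) / p"
  shows "\<exists>c0>0. \<forall>n\<ge>2::nat.
    (\<epsilon> > 0 \<longrightarrow>
       minimax_risk M W Y \<sigma> x0 \<rho> (besov_ball v s p q R) n
         \<ge> ennreal (c0 * (1 / real n) powr (s / (2 * s + 2 * \<nu> + 1)))) \<and>
    (\<epsilon> \<le> 0 \<longrightarrow>
       minimax_risk M W Y \<sigma> x0 \<rho> (besov_ball v s p q R) n
         \<ge> ennreal (c0 * (ln (real n) / real n) powr ((s - 1 / p + 1 / \<rho>) / (2 * s + 2 * \<nu> + 1 - 2 / p))))"
proof -
  interpret filter_model M W Y \<sigma> x0
    by (intro filter_model.intro filter_model_axioms.intro assms)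
  note \<rho> = \<open>\<rho> > 1\<close> and p = \<open>p > 1\<close>
  obtain C where C: "C > 0" and Clow: "\<And>j. (\<integral>\<^sup>+\<omega>. ennreal (dyadic_energy (\<lambda>t. Y t \<omega>) j) \<partial>M) \<le> ennreal (C * 2 powr (- 2 * \<nu> * real j))"
    using \<open>C_low M Y \<nu>\<close> unfolding C_low_def by blast
  obtain cB where cB: "cB > 0" and ball: "\<forall>c. 0 < c \<and> c \<le> cB \<longrightarrow>
    (\<forall>j\<ge>1. \<forall>S\<subseteq>{..<2 ^ j}. hypothesis j (c * 2 powr (- (real j * (s + 1)))) S \<in> besov_ball v s p q R) \<and>
    (\<forall>j\<ge>1. \<forall>k<2 ^ j. hypothesis j (c * 2 powr (- (real j * (s + 1 - 1/p)))) {k} \<in> besov_ball v s p q R)"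
    using hypothesis_in_besov_ball[OF \<open>meyer_transition v\<close> p \<open>q > 1\<close> \<open>R > 0\<close>, of s] by (elim exE conjE)
  have ballS: "hypothesis j (c * 2 powr (- (real j * (s + 1)))) S \<in> besov_ball v s p q R"
    if "0 < c" "c \<le> cB" "j \<ge> 1" "S \<subseteq> {..<2 ^ j}" for c j S
    using ball[rule_format, OF conjI[OF that(1,2)]] that(3,4) by simp
  have ballk: "hypothesis j (c * 2 powr (- (real j * (s + 1 - 1/p)))) {k} \<in> besov_ball v s p q R"
    if "0 < c" "c \<le> cB" "j \<ge> 1" "k < 2 ^ j" for c j k
    using ball[rule_format, OF conjI[OF that(1,2)]] that(3,4) by simp
  \<comment> \<open>Chosen so that the energy term of \<open>risk_sparse\<close> comes out as at
    most 1/8; the regular one is then at most \<open>ln 2 / 32\<close>.\<close>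
  define c where "c = min cB (sqrt (\<sigma>\<^sup>2 * ln 2 / (16 * C)))"
  have c: "c > 0" "c \<le> cB" using cB C \<sigma> by (auto simp: c_def)
  have c2: "c\<^sup>2 \<le> \<sigma>\<^sup>2 * ln 2 / (16 * C)"
  proof -
    have "c\<^sup>2 \<le> (sqrt (\<sigma>\<^sup>2 * ln 2 / (16 * C)))\<^sup>2" using c by (intro power_mono) (auto simp: c_def)
    then show ?thesis using C by simp
  qed
  have s0: "s > 0" using \<open>s > 1 / p\<close> p by (intro less_trans[of 0 "1/p" s]) auto
  \<comment> \<open>The energy is a multiple of \<open>n * 2 powr (- j * D)\<close>:
    \<open>D\<close> collects twice the amplitude exponent \<open>s + 1\<close>, the block length
    and the filter decay. \<open>D'\<close> is the analogue for the amplitude exponent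
    \<open>s + 1 - 1/p\<close>.\<close>
  define D where "D = 2 * s + 2 * \<nu> + 1"
  define D' where "D' = 2 * s + 2 * \<nu> + 1 - 2 / p"
  define \<alpha> where "\<alpha> = s - 1 / p + 1 / \<rho>"
  have D: "D > 0" using s0 \<open>\<nu> \<ge> 0\<close> by (simp add: D_def)
  have D': "D' > 0" using \<open>s > 1 / p\<close> \<open>\<nu> \<ge> 0\<close> by (simp add: D'_def)
  have \<alpha>: "\<alpha> > 0" using \<open>s > 1 / p\<close> \<rho> by (simp add: \<alpha>_def add_pos_pos)
  \<comment> \<open>\<open>2 powr (- s)\<close> pays for the lower bound on \<open>n\<close> being
    available at level \<open>j - 1\<close> only; 8192 is the constant of
    \<open>risk_regular\<close>.\<close>
  define c1 where "c1 = c * 2 powr (- s) / (8192 * exp 1)"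
  have c1: "c1 > 0" using c by (simp add: c1_def)
  have regular: "ennreal (c1 * (1 / real n) powr (s / D)) \<le> minimax_risk M W Y \<sigma> x0 \<rho> (besov_ball v s p q R) n" if n: "n \<ge> 2" for n
  proof -
    obtain j :: nat where j: "j \<ge> 1" "real n \<le> 2 powr (real j * D)" "2 powr (real (j - 1) * D) \<le> real n"
      using regular_level[OF D n] by blast
    let ?g = "c * 2 powr (- (real j * (s + 1)))"
    have g: "?g > 0" using c by simp
    have energy: "?g\<^sup>2 * 2 ^ j * C * 2 powr (- 2 * \<nu> * real j) * real n / (2 * \<sigma>\<^sup>2) \<le> 1 / 8"
    proof -
      have "?g\<^sup>2 * 2 ^ j * C * 2 powr (- 2 * \<nu> * real j) * real n / (2 * \<sigma>\<^sup>2) =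
        c\<^sup>2 * (C / (2 * \<sigma>\<^sup>2)) * real n * (2 powr (- (real j * (s + 1))) * 2 powr (- (real j * (s + 1))) * 2 powr real j * 2 powr (- 2 * \<nu> * real j))"
        by (simp add: power2_eq_square powr_realpow)
      also have "2 powr (- (real j * (s + 1))) * 2 powr (- (real j * (s + 1))) * 2 powr real j * 2 powr (- 2 * \<nu> * real j) = 2 powr (- (real j * D))"
        unfolding powr_add[symmetric] by (rule arg_cong[where f="\<lambda>x. 2 powr x"]) (simp add: D_def algebra_simps)
      also have "c\<^sup>2 * (C / (2 * \<sigma>\<^sup>2)) * real n * 2 powr (- (real j * D)) \<le> \<sigma>\<^sup>2 * ln 2 / (16 * C) * (C / (2 * \<sigma>\<^sup>2)) * 2 powr (real j * D) * 2 powr (- (real j * D))"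
        using c2 C j(2) by (intro mult_right_mono mult_mono) auto
      also have "\<dots> = ln 2 / 32" using C \<sigma> by (simp add: powr_minus field_simps)
      also have "\<dots> \<le> 1 / 8" using ln_2_less_1 by simp
      finally show ?thesis .
    qed
    have rate: "c1 * (1 / real n) powr (s / D) \<le> ?g * 2 ^ j / (8192 * exp 1)"
    proof -
      have "(1 / real n) powr (s / D) = real n powr (- (s / D))" using n by (simp add: powr_minus_divide powr_divide)
      also have "\<dots> \<le> (2 powr (real (j - 1) * D)) powr (- (s / D))"
        using j(3) s0 D by (intro powr_mono2') auto
      also have "\<dots> = 2 powr (s - real j * s)"
        using D j(1) by (simp add: powr_powr of_nat_diff algebra_simps)
      finally have "c1 * (1 / real n) powr (s / D) \<le> c1 * 2 powr (s - real j * s)" using c1 by (intro mult_left_mono) auto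
      also have "\<dots> = c * (2 powr (- s) * 2 powr (s - real j * s)) / (8192 * exp 1)" by (simp add: c1_def)
      also have "2 powr (- s) * 2 powr (s - real j * s) = 2 powr (- (real j * (s + 1))) * 2 powr real j"
        unfolding powr_add[symmetric] by (rule arg_cong[where f="\<lambda>x. 2 powr x"]) (simp add: algebra_simps)
      finally show ?thesis by (simp add: powr_realpow)
    qed
    show ?thesis
    proof (rule minimax_risk_ge)
      fix T :: "(real \<Rightarrow> real \<times> real) \<Rightarrow> real \<Rightarrow> real" assume T: "T \<in> estimators"
      obtain S where S: "S \<subseteq> {..<2 ^ j}" "ennreal (?g * 2 ^ j / (8192 * exp 1)) \<le>
         (\<integral>\<^sup>+\<omega>. Lnorm \<rho> (\<lambda>x. T (observation W Y \<sigma> x0 n (hypothesis j ?g S) \<omega>) x - hypothesis j ?g S x) \<partial>M)"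
        using risk_regular[OF Clow C T j(1) _ g energy \<rho>] n by auto
      show "\<exists>f\<in>besov_ball v s p q R. ennreal (c1 * (1 / real n) powr (s / D)) \<le>
         (\<integral>\<^sup>+\<omega>. Lnorm \<rho> (\<lambda>x. T (observation W Y \<sigma> x0 n f \<omega>) x - f x) \<partial>M)"
        by (rule bexI[where x="hypothesis j ?g S"], rule order_trans[OF ennreal_leI[OF rate] S(2)], rule ballS[OF c j(1) S(1)])
    qed
  qed
  define O' where "O' = sparse_overlap \<rho>"
  have O': "O' > 0" using \<rho> by (simp add: O'_def sparse_overlap_def add_pos_pos)
  \<comment> \<open>12 yields the first smallness condition of \<open>risk_sparse\<close>, the
    logarithm the second.\<close>
  define j0 where "j0 = max 12 (nat \<lceil>2 * log 2 (8 * O')\<rceil>)"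
  have large: "2 powr (- real j / 4) \<le> 1 / 8" "sparse_overlap \<rho> * 2 powr (- real j / 2) \<le> 1 / 8" if j: "j \<ge> j0" for j
  proof -
    have "2 powr (- real j / 4) \<le> 2 powr (- 3)" using j by (intro powr_mono) (auto simp: j0_def)
    also have "2 powr (- 3) = (1 / 8 :: real)" by (simp add: powr_minus_divide)
    finally show "2 powr (- real j / 4) \<le> 1 / 8" .
    have "log 2 (8 * O') \<le> real j / 2" using j unfolding j0_def by linarith
    then have "2 powr log 2 (8 * O') \<le> 2 powr (real j / 2)" by (intro powr_mono) auto
    then have "8 * O' \<le> 2 powr (real j / 2)" using O' by simp
    then show "sparse_overlap \<rho> * 2 powr (- real j / 2) \<le> 1 / 8"
      unfolding O'_def[symmetric] by (simp add: powr_minus_divide field_simps)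
  qed
  have j01: "j0 \<ge> 1" by (simp add: j0_def)
  obtain K where K: "K > 0" "\<And>n. n \<ge> (2::nat) \<Longrightarrow> \<exists>j\<ge>j0. real n \<le> real j * 2 powr (real j * D') \<and> 2 powr (real j * D') \<le> K * (real n / ln (real n))"
    using sparse_level[OF D' j01] by blast
  define \<kappa> where "\<kappa> = c * ((2 powr (- \<rho> - 1) / 12) powr (1 / \<rho>) / 8)"
  have \<kappa>: "\<kappa> > 0" using c by (simp add: \<kappa>_def)
  define c3 where "c3 = \<kappa> * K powr (- (\<alpha> / D'))"
  have c3: "c3 > 0" using \<kappa> K by (simp add: c3_def)
  have sparse: "ennreal (c3 * (ln (real n) / real n) powr (\<alpha> / D')) \<le> minimax_risk M W Y \<sigma> x0 \<rho> (besov_ball v s p q R) n" if n: "n \<ge> 2" for n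
  proof -
    obtain j where j: "j \<ge> j0" "real n \<le> real j * 2 powr (real j * D')" "2 powr (real j * D') \<le> K * (real n / ln (real n))"
      using K(2)[OF n] by blast
    have j1: "j \<ge> 1" using j j01 by simp
    let ?g = "c * 2 powr (- (real j * (s + 1 - 1/p)))"
    have g: "?g > 0" using c by simp
    have energy: "?g\<^sup>2 * 2 ^ j * C * 2 powr (- 2 * \<nu> * real j) * real n / (2 * \<sigma>\<^sup>2 * (real j * ln 2 / 4)) \<le> 1 / 8"
    proof -
      have "?g\<^sup>2 * 2 ^ j * C * 2 powr (- 2 * \<nu> * real j) * real n / (2 * \<sigma>\<^sup>2 * (real j * ln 2 / 4)) =
        c\<^sup>2 * (2 * C / (\<sigma>\<^sup>2 * ln 2 * real j)) * real n * (2 powr (- (real j * (s + 1 - 1/p))) * 2 powr (- (real j * (s + 1 - 1/p))) * 2 powr real j * 2 powr (- 2 * \<nu> * real j))"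
        by (simp add: power2_eq_square powr_realpow ac_simps)
      also have "2 powr (- (real j * (s + 1 - 1/p))) * 2 powr (- (real j * (s + 1 - 1/p))) * 2 powr real j * 2 powr (- 2 * \<nu> * real j) = 2 powr (- (real j * D'))"
        unfolding powr_add[symmetric] by (rule arg_cong[where f="\<lambda>x. 2 powr x"]) (simp add: D'_def algebra_simps)
      also have "c\<^sup>2 * (2 * C / (\<sigma>\<^sup>2 * ln 2 * real j)) * real n * 2 powr (- (real j * D')) \<le>
          \<sigma>\<^sup>2 * ln 2 / (16 * C) * (2 * C / (\<sigma>\<^sup>2 * ln 2 * real j)) * (real j * 2 powr (real j * D')) * 2 powr (- (real j * D'))"
        using c2 C j(2) by (intro mult_right_mono mult_mono) auto
      also have "\<dots> = 1 / 8" using C \<sigma> j1 by (simp add: powr_minus field_simps)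
      finally show ?thesis .
    qed
    have ln: "ln (real n) > 0" using n by simp
    have rate: "c3 * (ln (real n) / real n) powr (\<alpha> / D') \<le> sparse_radius \<rho> j ?g powr (1 / \<rho>) / 2"
    proof -
      have "K powr (- (\<alpha> / D')) * (ln (real n) / real n) powr (\<alpha> / D') = (K * (real n / ln (real n))) powr (- (\<alpha> / D'))"
        using n ln K(1) by (simp add: powr_mult powr_divide powr_minus field_simps)
      also have "\<dots> \<le> (2 powr (real j * D')) powr (- (\<alpha> / D'))"
        using j(3) \<alpha> D' by (intro powr_mono2') auto
      also have "\<dots> = 2 powr (- (real j * \<alpha>))" using D' by (simp add: powr_powr)
      finally have "\<kappa> * (K powr (- (\<alpha> / D')) * (ln (real n) / real n) powr (\<alpha> / D')) \<le> \<kappa> * 2 powr (- (real j * \<alpha>))"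
        using \<kappa> by (intro mult_left_mono) auto
      then show ?thesis unfolding sparse_radius_powr[OF \<rho> c(1)] c3_def \<kappa>_def \<alpha>_def by (simp only: mult.assoc)
    qed
    show ?thesis
    proof (rule minimax_risk_ge)
      fix T :: "(real \<Rightarrow> real \<times> real) \<Rightarrow> real \<Rightarrow> real" assume T: "T \<in> estimators"
      obtain k where k: "k < 2 ^ j" "ennreal (sparse_radius \<rho> j ?g powr (1 / \<rho>) / 2) \<le>
         (\<integral>\<^sup>+\<omega>. Lnorm \<rho> (\<lambda>x. T (observation W Y \<sigma> x0 n (hypothesis j ?g {k}) \<omega>) x - hypothesis j ?g {k} x) \<partial>M)"
        using risk_sparse[OF Clow C T j1 _ g energy \<rho> large[OF j(1)]] n by auto
      show "\<exists>f\<in>besov_ball v s p q R. ennreal (c3 * (ln (real n) / real n) powr (\<alpha> / D')) \<le>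
         (\<integral>\<^sup>+\<omega>. Lnorm \<rho> (\<lambda>x. T (observation W Y \<sigma> x0 n f \<omega>) x - f x) \<partial>M)"
        by (rule bexI[where x="hypothesis j ?g {k}"], rule order_trans[OF ennreal_leI[OF rate] k(2)], rule ballk[OF c j1 k(1)])
    qed
  qed
  show ?thesis
  proof (intro exI[of _ "min c1 c3"] conjI allI impI)
    show "min c1 c3 > 0" using c1 c3 by simp
    fix n :: nat assume n: "n \<ge> 2"
    have "ennreal (min c1 c3 * (1 / real n) powr (s / D)) \<le> ennreal (c1 * (1 / real n) powr (s / D))"
      by (intro ennreal_leI mult_right_mono) auto
    then show "ennreal (min c1 c3 * (1 / real n) powr (s / (2 * s + 2 * \<nu> + 1))) \<le> minimax_risk M W Y \<sigma> x0 \<rho> (besov_ball v s p q R) n"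
      using regular[OF n] unfolding D_def[symmetric] by (rule order_trans)
    have "ennreal (min c1 c3 * (ln (real n) / real n) powr (\<alpha> / D')) \<le> ennreal (c3 * (ln (real n) / real n) powr (\<alpha> / D'))"
      by (intro ennreal_leI mult_right_mono) auto
    then show "ennreal (min c1 c3 * (ln (real n) / real n) powr ((s - 1 / p + 1 / \<rho>) / (2 * s + 2 * \<nu> + 1 - 2 / p))) \<le> minimax_risk M W Y \<sigma> x0 \<rho> (besov_ball v s p q R) n"
      using sparse[OF n] unfolding D'_def[symmetric] \<alpha>_def[symmetric] by (rule order_trans)
  qed
qed

end
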